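(* Let $N,r\in\mathbb{N}$. Let $G$ be a group which has a subgroup $G'$ of index $N$. Then there exists a faithful topological dynamical system $(G,X)$ such that $\dim (G,X)_N=\lceil \frac{rN}{2}\rceil$ (thus the condition $\dim (G,X)_N<\frac{rN}{2}$ does not hold) and such that for all continuous functions $f:X\to[0,1]^r$ the induced map $f^G:X\to([0,1]^r)^G$ is not injective.
   Context: $\mathbb{N}=\{1,2,\dots\}$. A topological dynamical system $(G,X)$ consists of a group $G$ (with the discrete topology) acting on a compact metric space $X$ so that the action map $G\times X\to X$, $(g,x)\mapsto gx$, is continuous. It is faithful if the only $g\in G$ with $gx=x$ for all $x\in X$ is the identity. $(G,X)_N:=\{x\in X: |G\cdot x|\le N\}$, where $G\cdot x=\{gx: g\in G\}$. $\dim$ denotes Lebesgue covering dimension. For continuous $f:X\to[0,1]^r$, the map $f^G:X\to([0,1]^r)^G$ is given by $f^G(x)=(f(gx))_{g\in G}$.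
   Formalization: The group G is additionally assumed to admit some faithful topological dynamical system on a compact metric space; without this the claim fails, e.g. for groups of cardinality larger than the continuum, and the conclusion itself implies this assumption. *)

theory Defs
  imports "HOL-Analysis.Analysis" "HOL-Algebra.Group_Action"
begin

section \<open>Lebesgue covering dimension\<close>

definition covering_dim_le :: "'a topology \<Rightarrow> int \<Rightarrow> bool" where
  "covering_dim_le T n \<longleftrightarrow>
     (\<forall>\<U>. (\<forall>U\<in>\<U>. openin T U) \<and> topspace T \<subseteq> \<Union>\<U> \<longrightarrow>
       (\<exists>\<V>. (\<forall>V\<in>\<V>. openin T V) \<and> topspace T \<subseteq> \<Union>\<V> \<and>
            (\<forall>V\<in>\<V>. \<exists>U\<in>\<U>. V \<subseteq> U) \<and>
            (\<forall>x\<in>topspace T. finite {V\<in>\<V>. x \<in> V} \<and> int (card {V\<in>\<V>. x \<in> V}) \<le> n + 1)))"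

text \<open>Conventions: the empty space has dimension \<open>-1\<close>, and a space none of whose bounds
  is finite has dimension \<open>\<infinity>\<close> (the infimum of the empty set).\<close>

definition covering_dim :: "'a topology \<Rightarrow> ereal" where
  "covering_dim T = Inf {ereal (real_of_int n) | n. n \<ge> -1 \<and> covering_dim_le T n}"


section \<open>Topological dynamical systems\<close>

definition tds :: "('g, 'm) monoid_scheme \<Rightarrow> 'x metric \<Rightarrow> ('g \<Rightarrow> 'x \<Rightarrow> 'x) \<Rightarrow> bool" where
  "tds G X \<phi> \<longleftrightarrow>
     group_action G (mspace X) \<phi> \<and> compact_space (mtopology_of X) \<and>
     continuous_map (prod_topology (discrete_topology (carrier G)) (mtopology_of X))
       (mtopology_of X) (\<lambda>(g, x). \<phi> g x)"

definition faithful_tds :: "('g, 'm) monoid_scheme \<Rightarrow> 'x metric \<Rightarrow> ('g \<Rightarrow> 'x \<Rightarrow> 'x) \<Rightarrow> bool" where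
  "faithful_tds G X \<phi> \<longleftrightarrow>
     tds G X \<phi> \<and> (\<forall>g\<in>carrier G. (\<forall>x\<in>mspace X. \<phi> g x = x) \<longrightarrow> g = \<one>\<^bsub>G\<^esub>)"

definition small_orbit_points ::
    "('g, 'm) monoid_scheme \<Rightarrow> 'x metric \<Rightarrow> ('g \<Rightarrow> 'x \<Rightarrow> 'x) \<Rightarrow> nat \<Rightarrow> 'x set" where
  "small_orbit_points G X \<phi> N =
     {x \<in> mspace X. finite (orbit G \<phi> x) \<and> card (orbit G \<phi> x) \<le> N}"

text \<open>The cube \<open>[0,1]\<^sup>r\<close>, as functions on \<open>{..<r}\<close> (with the value \<open>undefined\<close> elsewhere).\<close>

definition unit_cube :: "nat \<Rightarrow> (nat \<Rightarrow> real) topology" where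
  "unit_cube r = product_topology (\<lambda>_. top_of_set {0..1}) {..<r}"

definition orbit_map ::
    "('g, 'm) monoid_scheme \<Rightarrow> ('g \<Rightarrow> 'x \<Rightarrow> 'x) \<Rightarrow> ('x \<Rightarrow> 'c) \<Rightarrow> 'x \<Rightarrow> 'g \<Rightarrow> 'c" where
  "orbit_map G \<phi> f x = (\<lambda>g\<in>carrier G. f (\<phi> g x))"


section \<open>Countable groups have faithful systems\<close>

text \<open>A discrete group need not act faithfully on any compact metric space: a homeomorphism
  of such a space is determined by its values on a countable dense subset, so a group
  of cardinality greater than the continuum has no faithful system. Every countable group has one,
  its one-point compactification, on which it acts by left translation and fixes the added
  point.\<close>

lemma countable_group_has_faithful_tds:
  fixes G :: "('g, 'm) monoid_scheme"
  assumes G: "group G" and cnt: "countable (carrier G)"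
  shows "\<exists>(Y :: 'g option metric) \<psi>. faithful_tds G Y \<psi>"
proof -
  interpret group G by (rule G)
  define M where "M = insert None (Some ` carrier G)"
  define w where "w = case_option 0 (\<lambda>g. 1 / (1 + real (to_nat_on (carrier G) g)))"
  define d where "d = (\<lambda>a b :: 'g option. if a = b then 0 else max (w a) (w b))"
  have wpos: "w (Some g) > 0" for g by (simp add: w_def add_pos_nonneg)
  have w0: "w None = 0" by (simp add: w_def)
  have wnn: "w a \<ge> 0" for a using wpos w0 by (cases a) (auto simp: less_imp_le)
  have dmax: "w a \<le> d a b \<and> w b \<le> d a b" if "a \<noteq> b" for a b
    using that by (simp add: d_def)
  interpret Metric_space M d
  proof
    show "0 \<le> d x y" for x y using wnn by (auto simp: d_def le_max_iff_disj)
    show "d x y = d y x" for x y by (auto simp: d_def max.commute)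
    show "(d x y = 0) = (x = y)" if "x \<in> M" "y \<in> M" for x y
    proof -
      have "max (w x) (w y) > 0" if "x \<noteq> y"
        using that wpos by (cases x; cases y) (auto simp: less_max_iff_disj)
      then show ?thesis by (cases "x = y") (auto simp: d_def)
    qed
    show "d x z \<le> d x y + d y z" for x y z
      using wnn[of x] wnn[of y] wnn[of z] by (auto simp: d_def)
  qed
  have few: "finite {a \<in> M. w a \<ge> e}" if e: "e > 0" for e
  proof -
    have "{a \<in> M. w a \<ge> e} \<subseteq> Some ` {g \<in> carrier G. to_nat_on (carrier G) g \<le> nat \<lceil>1 / e\<rceil>}"
    proof
      fix a assume a: "a \<in> {a \<in> M. w a \<ge> e}"
      then obtain g where g: "a = Some g" "g \<in> carrier G"
        using e w0 by (auto simp: M_def)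
      define n where "n = to_nat_on (carrier G) g"
      have "e \<le> 1 / (1 + real n)" using a g by (simp add: w_def n_def)
      then have "1 + real n \<le> 1 / e" using e by (simp add: field_simps)
      then have "n \<le> nat \<lceil>1 / e\<rceil>" by linarith
      then show "a \<in> Some ` {g \<in> carrier G. to_nat_on (carrier G) g \<le> nat \<lceil>1 / e\<rceil>}"
        using g n_def by auto
    qed
    moreover have "finite {g \<in> carrier G. to_nat_on (carrier G) g \<le> nat \<lceil>1 / e\<rceil>}"
    proof (rule finite_imageD[of "to_nat_on (carrier G)"])
      show "finite (to_nat_on (carrier G) ` {g \<in> carrier G. to_nat_on (carrier G) g \<le> nat \<lceil>1 / e\<rceil>})"
        by (rule finite_subset[of _ "{..nat \<lceil>1 / e\<rceil>}"]) auto
      show "inj_on (to_nat_on (carrier G)) {g \<in> carrier G. to_nat_on (carrier G) g \<le> nat \<lceil>1 / e\<rceil>}"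
        using inj_on_to_nat_on[OF cnt] by (rule inj_on_subset) auto
    qed
    ultimately show ?thesis by (meson finite_imageI finite_subset)
  qed
  have opn: "openin mtopology U \<longleftrightarrow> U \<subseteq> M \<and> (None \<in> U \<longrightarrow> finite (M - U))" for U
  proof (intro iffI conjI impI)
    assume U: "openin mtopology U"
    then show "U \<subseteq> M" by (simp add: openin_mtopology)
    assume "None \<in> U"
    then obtain e where e: "e > 0" "mball None e \<subseteq> U" using U by (auto simp: openin_mtopology)
    have "M - U \<subseteq> {a \<in> M. w a \<ge> e}"
    proof
      fix a assume "a \<in> M - U"
      then have "a \<in> M" "a \<notin> mball None e" using e by auto
      moreover have "None \<in> M" by (simp add: M_def)
      moreover have "a \<noteq> None" using \<open>None \<in> U\<close> \<open>a \<in> M - U\<close> by (metis DiffD2)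
      ultimately have "a \<noteq> None" "d None a \<ge> e" by (auto simp: in_mball)
      then show "a \<in> {a \<in> M. w a \<ge> e}" using \<open>a \<in> M\<close> w0 wnn[of a] by (auto simp: d_def)
    qed
    then show "finite (M - U)" using few[OF e(1)] finite_subset by blast
  next
    assume U: "U \<subseteq> M \<and> (None \<in> U \<longrightarrow> finite (M - U))"
    show "openin mtopology U"
      unfolding openin_mtopology
    proof (intro conjI allI impI)
      fix x assume x: "x \<in> U"
      show "\<exists>r>0. mball x r \<subseteq> U"
      proof (cases x)
        case (Some g)
        have "mball x (w x) \<subseteq> U"
        proof
          fix b assume "b \<in> mball x (w x)"
          then have "d x b < w x" by (simp add: in_mball)
          then have "b = x" using dmax[of x b] by force
          then show "b \<in> U" using x by simp
        qed
        then show ?thesis using wpos Some by auto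
      next
        case None
        then have fin: "finite (M - U)" and "None \<in> U" using U x by auto
        define e where "e = Min (insert 1 (w ` (M - U)))"
        have "w a > 0" if "a \<in> M - U" for a
          using that wpos \<open>None \<in> U\<close> by (cases a) (blast, metis)
        then have "e > 0" using fin by (simp add: e_def)
        moreover have "mball x e \<subseteq> U"
        proof
          fix a assume a: "a \<in> mball x e"
          show "a \<in> U"
          proof (rule ccontr)
            assume "a \<notin> U"
            then have aM: "a \<in> M - U" using a by (auto simp: in_mball)
            then have "e \<le> w a" using fin by (simp add: e_def)
            moreover have "a \<noteq> None" using \<open>a \<notin> U\<close> \<open>None \<in> U\<close> by metis
            moreover have "d None a < e" using a None by (simp add: in_mball)
            ultimately show False using dmax[of None a] by force
          qed
        qed
        ultimately show ?thesis by blast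
      qed
    qed (use U in auto)
  qed
  have comp: "compact_space mtopology"
    unfolding compact_space_def compactin_def
  proof (intro conjI allI impI)
    fix \<U> assume \<U>: "Ball \<U> (openin mtopology) \<and> topspace mtopology \<subseteq> \<Union>\<U>"
    have "None \<in> M" by (simp add: M_def)
    then obtain U0 where U0: "U0 \<in> \<U>" "None \<in> U0" using \<U> by auto
    then have fin: "finite (M - U0)" using \<U> opn by auto
    have "\<forall>a\<in>M - U0. \<exists>U\<in>\<U>. a \<in> U" using \<U> by auto
    then obtain c where c: "\<And>a. a \<in> M - U0 \<Longrightarrow> c a \<in> \<U> \<and> a \<in> c a" by metis
    show "\<exists>\<F>. finite \<F> \<and> \<F> \<subseteq> \<U> \<and> topspace mtopology \<subseteq> \<Union>\<F>"
      by (rule exI[of _ "insert U0 (c ` (M - U0))"]) (use fin c U0 in auto)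
  qed simp
  define \<psi> where "\<psi> = (\<lambda>g. \<lambda>a\<in>M. map_option (\<lambda>h. g \<otimes>\<^bsub>G\<^esub> h) a)"
  have \<psi>M: "\<psi> g a \<in> M" if "g \<in> carrier G" "a \<in> M" for g a
    using that by (auto simp: \<psi>_def M_def)
  have \<psi>comp: "\<psi> (g \<otimes>\<^bsub>G\<^esub> h) a = \<psi> g (\<psi> h a)"
    if "g \<in> carrier G" "h \<in> carrier G" "a \<in> M" for g h a
    using that by (auto simp: \<psi>_def M_def m_assoc)
  have \<psi>one: "\<psi> \<one>\<^bsub>G\<^esub> a = a" if "a \<in> M" for a
    using that by (auto simp: \<psi>_def M_def)
  have bij: "bij_betw (\<psi> g) M M" if "g \<in> carrier G" for g
    by (rule bij_betw_byWitness[where f' = "\<psi> (inv\<^bsub>G\<^esub> g)"])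
      (use that \<psi>M \<psi>one in \<open>auto simp flip: \<psi>comp\<close>)
  have Bij: "\<psi> g \<in> Bij M" if "g \<in> carrier G" for g
    using bij[OF that] by (auto simp: Bij_def \<psi>_def)
  have act: "group_action G M \<psi>"
    unfolding group_action_def group_hom_def group_hom_axioms_def
  proof (intro conjI)
    show "\<psi> \<in> hom G (BijGroup M)"
    proof (rule homI)
      show "\<psi> g \<in> carrier (BijGroup M)" if "g \<in> carrier G" for g
        using Bij[OF that] by (simp add: BijGroup_def)
      fix g h assume gh: "g \<in> carrier G" "h \<in> carrier G"
      have "\<psi> (g \<otimes>\<^bsub>G\<^esub> h) a = compose M (\<psi> g) (\<psi> h) a" for a
        using \<psi>comp[OF gh, of a] by (cases "a \<in> M") (auto simp: compose_def \<psi>_def)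
      then show "\<psi> (g \<otimes>\<^bsub>G\<^esub> h) = \<psi> g \<otimes>\<^bsub>BijGroup M\<^esub> \<psi> h"
        using gh Bij by (auto simp: BijGroup_def)
    qed
  qed (use G group_BijGroup in auto)
  have cont1: "continuous_map mtopology mtopology (\<psi> g)" if g: "g \<in> carrier G" for g
    unfolding continuous_map_def
  proof (intro conjI allI impI)
    show "\<psi> g \<in> topspace mtopology \<rightarrow> topspace mtopology" using \<psi>M[OF g] by auto
    fix U assume U: "openin mtopology U"
    have "finite (M - {x \<in> M. \<psi> g x \<in> U})" if "\<psi> g None \<in> U"
    proof (rule finite_imageD[of "\<psi> g"])
      have "None \<in> U" using that by (simp add: \<psi>_def M_def)
      then have "finite (M - U)" using U opn by blast
      then show "finite (\<psi> g ` (M - {x \<in> M. \<psi> g x \<in> U}))"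
        by (rule finite_subset[rotated]) (use \<psi>M[OF g] in auto)
      show "inj_on (\<psi> g) (M - {x \<in> M. \<psi> g x \<in> U})"
        using bij[OF g] by (auto simp: bij_betw_def intro: inj_on_subset)
    qed
    then show "openin mtopology {x \<in> topspace mtopology. \<psi> g x \<in> U}"
      by (auto simp: opn)
  qed
  have cont: "continuous_map (prod_topology (discrete_topology (carrier G)) mtopology) mtopology
      (\<lambda>(g, x). \<psi> g x)"
    unfolding continuous_map_def
  proof (intro conjI allI impI)
    show "(\<lambda>(g, x). \<psi> g x) \<in> topspace (prod_topology (discrete_topology (carrier G)) mtopology)
        \<rightarrow> topspace mtopology"
      using \<psi>M by auto
    fix U assume U: "openin mtopology U"
    let ?P = "{p \<in> topspace (prod_topology (discrete_topology (carrier G)) mtopology).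
      (case p of (g, x) \<Rightarrow> \<psi> g x) \<in> U}"
    have "?P = (\<Union>g\<in>carrier G. {g} \<times> {x \<in> topspace mtopology. \<psi> g x \<in> U})" by auto
    moreover have "openin (prod_topology (discrete_topology (carrier G)) mtopology)
        ({g} \<times> {x \<in> topspace mtopology. \<psi> g x \<in> U})" if "g \<in> carrier G" for g
      unfolding openin_prod_Times_iff
      using that openin_continuous_map_preimage[OF cont1[OF that] U] by simp
    ultimately show "openin (prod_topology (discrete_topology (carrier G)) mtopology) ?P"
      by auto
  qed
  have faithful: "g = \<one>\<^bsub>G\<^esub>" if g: "g \<in> carrier G" and fx: "\<forall>x\<in>M. \<psi> g x = x" for g
  proof -
    have "\<psi> g (Some \<one>\<^bsub>G\<^esub>) = Some \<one>\<^bsub>G\<^esub>" using fx by (simp add: M_def)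
    then show ?thesis using g by (simp add: \<psi>_def M_def)
  qed
  have "faithful_tds G (metric (M, d)) \<psi>"
    using act comp cont faithful by (simp add: faithful_tds_def tds_def mtopology_of_def)
  then show ?thesis by blast
qed

end

theory Submission
  imports Defs "HOL-Homology.Invariance_of_Domain" "Jordan_Normal_Form.Char_Poly"
begin

text \<open>
  Put \<open>d = \<lceil>r N / 2\<rceil>\<close>. A compact \<open>d\<close>-dimensional space \<open>Z\<close> without an embedding into
  \<open>\<real>\<^sup>2\<^sup>d\<close> gives the system \<open>G/G' \<times> Z\<close>, on which \<open>f\<^sup>G\<close> is injective only if
  \<open>z \<mapsto> (f (c, z))\<^sub>c\<close> embeds \<open>Z\<close> into \<open>\<real>\<^sup>r\<^sup>N\<close>. For \<open>Z\<close> we take a skeleton of a simplex that contains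
  the join of \<open>d + 1\<close> three-point sets, and Flores' argument: a map of \<open>Z\<close> into \<open>\<real>\<^sup>2\<^sup>d\<close>
  identifying no two points with disjoint supports yields an odd nowhere zero map from the
  sphere of dimension \<open>2 d + 1\<close> to \<open>\<real>\<^sup>2\<^sup>d\<^sup>+\<^sup>1\<close>, against Borsuk-Ulam. The same argument bounds the
  covering dimension of \<open>Z\<close> from below, because a cover of small order provides a map into
  \<open>\<real>\<^sup>2\<^sup>d\<close> (vertices of the nerve on the moment curve) that only identifies nearby points.

  To obtain a faithful system, collapse in the given system \<open>Y\<close> the closed set \<open>F\<close> of points with
  at most \<open>N\<close> translates to one point. What this loses is recovered by the one-point
  compactification of a countable invariant dense part of \<open>F\<close>, which is zero-dimensional.
\<close>

section \<open>Generic perturbations and rounding\<close>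

text \<open>The number \<open>d\<close> is the least integer with \<open>r * N \<le> 2 * d\<close>:
  a function into the \<open>r\<close>-cube gives \<open>r * N\<close> real functions on
  \<open>Z\<close>, one block of \<open>r\<close> for each coset, and Flores' theorem handles
  \<open>2 * d\<close> of them. The points of \<open>Y\<close> with small orbits may have any
  dimension, so adding \<open>Y\<close> unchanged could spoil the equality for the dimension; this
  is why \<open>F\<close> shrinks to a point. Elements of \<open>G\<close> that move only points of
  \<open>F\<close> then become invisible. Orbits in \<open>F\<close> are finite, so countably many
  of them form a countable set even when \<open>G\<close> is uncountable; letting \<open>G\<close>
  permute such a set as isolated points makes these elements visible again at the cost of dimension
  zero. Borsuk-Ulam is reached through the parity of degrees: an odd self-map of a sphere must be
  deformed, through nowhere zero maps, until it preserves the equator. Perturbing generically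
  without losing oddness or continuity is the obstacle behind the rounding and colouring; the same
  colouring later cuts the complex into small pieces.\<close>

lemma finite_singular_diagonal_shifts:
  fixes b :: "nat \<Rightarrow> nat \<Rightarrow> real" and \<sigma> :: "nat \<Rightarrow> real"
  assumes \<sigma>: "\<And>j. j < m \<Longrightarrow> \<sigma> j * \<sigma> j = 1"
  shows "finite {\<delta>. \<exists>c. (\<exists>j<m. c j \<noteq> 0) \<and>
           (\<forall>k<m. (\<Sum>j<m. c j * (b j k + (if k = j then \<delta> * \<sigma> j else 0))) = 0)}"
proof -
  \<comment> \<open>Multiplying equation \<open>k\<close> by \<open>\<sigma> k\<close>, whose square
    is 1, turns a vanishing combination into \<open>A c = \<delta> c\<close>. So every exceptional
    \<delta> is an eigenvalue of \<open>A\<close>, hence a root of its characteristic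
    polynomial.\<close>
  define A where "A = mat m m (\<lambda>(k, j). - \<sigma> k * b j k)"
  have A: "A \<in> carrier_mat m m" by (simp add: A_def)
  have "char_poly A \<noteq> 0" using degree_monic_char_poly[OF A] by auto
  then have fin: "finite {\<delta>. poly (char_poly A) \<delta> = 0}" by (rule poly_roots_finite)
  show ?thesis
  proof (rule finite_subset[OF _ fin], rule subsetI)
    fix \<delta> assume "\<delta> \<in> {\<delta>. \<exists>c. (\<exists>j<m. c j \<noteq> 0) \<and>
           (\<forall>k<m. (\<Sum>j<m. c j * (b j k + (if k = j then \<delta> * \<sigma> j else 0))) = 0)}"
    then obtain c j0 where j0: "j0 < m" "c j0 \<noteq> 0"
      and c: "\<And>k. k < m \<Longrightarrow> (\<Sum>j<m. c j * (b j k + (if k = j then \<delta> * \<sigma> j else 0))) = 0"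
      by blast
    have "A *\<^sub>v vec m c = \<delta> \<cdot>\<^sub>v vec m c"
    proof (rule eq_vecI)
      fix k assume "k < dim_vec (\<delta> \<cdot>\<^sub>v vec m c)"
      then have k: "k < m" by simp
      have "(\<Sum>j<m. c j * b j k) + \<delta> * \<sigma> k * c k = 0"
      proof -
        have "(\<Sum>j<m. c j * (b j k + (if k = j then \<delta> * \<sigma> j else 0)))
            = (\<Sum>j<m. c j * b j k + (if k = j then \<delta> * \<sigma> j * c j else 0))"
          by (rule sum.cong) (auto simp: algebra_simps)
        then show ?thesis using c[OF k] k by (simp add: sum.distrib)
      qed
      then have "\<sigma> k * ((\<Sum>j<m. c j * b j k) + \<delta> * \<sigma> k * c k) = 0" by simp
      then have "\<sigma> k * (\<Sum>j<m. c j * b j k) + \<delta> * (\<sigma> k * \<sigma> k) * c k = 0"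
        by (simp only: distrib_left mult_ac)
      then have "\<sigma> k * (\<Sum>j<m. c j * b j k) + \<delta> * c k = 0" using \<sigma>[OF k] by simp
      moreover have "(A *\<^sub>v vec m c) $ k = - (\<sigma> k * (\<Sum>j<m. c j * b j k))"
        using k by (simp add: A_def scalar_prod_def sum_distrib_left sum_negf lessThan_atLeast0 mult_ac)
      ultimately show "(A *\<^sub>v vec m c) $ k = (\<delta> \<cdot>\<^sub>v vec m c) $ k" using k by simp
    qed (simp add: A_def)
    moreover have "vec m c \<noteq> 0\<^sub>v m"
      using j0 by (metis index_vec index_zero_vec(1))
    ultimately have "eigenvalue A \<delta>"
      unfolding eigenvalue_def eigenvector_def using A by (intro exI[of _ "vec m c"]) auto
    then show "\<delta> \<in> {\<delta>. poly (char_poly A) \<delta> = 0}"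
      using eigenvalue_root_char_poly[OF A] by simp
  qed
qed

text \<open>Pigeonhole: a colour \<open>j\<close> that fails picks a coordinate \<open>i\<close>
  with \<open>v i + s j\<close> an integer. Such an \<open>i\<close> determines \<open>j\<close>,
  since two colours differ by less than 1, and \<open>v i\<close> is not an integer, since
  \<open>0 < s j < 1\<close>.\<close>

lemma exists_free_colour:
  fixes v :: "'i \<Rightarrow> real" and s :: "'j \<Rightarrow> real"
  assumes I: "finite I" and card: "card {i\<in>I. v i \<notin> \<int>} < card J"
    and s: "\<And>j. j \<in> J \<Longrightarrow> 0 < s j \<and> s j < 1" and inj: "inj_on s J"
  shows "\<exists>j\<in>J. \<forall>i\<in>I. v i + s j \<notin> \<int>"
proof (rule ccontr)
  assume "\<not> ?thesis"
  then have "\<forall>j\<in>J. \<exists>i\<in>I. v i + s j \<in> \<int>" by blast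
  then obtain a where a: "\<And>j. j \<in> J \<Longrightarrow> a j \<in> I \<and> v (a j) + s j \<in> \<int>" by metis
  have notint: "x \<notin> \<int>" if "-1 < x" "x < 1" "x \<noteq> 0" for x :: real
    using that by (auto elim!: Ints_cases)
  have "inj_on a J"
  proof (rule inj_onI)
    fix j j' assume j: "j \<in> J" "j' \<in> J" "a j = a j'"
    have "(v (a j) + s j) - (v (a j') + s j') \<in> \<int>" using a[OF j(1)] a[OF j(2)] by (intro Ints_diff) auto
    then have "s j - s j' \<in> \<int>" using j by simp
    then have "s j = s j'" using notint[of "s j - s j'"] s[OF j(1)] s[OF j(2)] by force
    then show "j = j'" using inj j by (auto dest: inj_onD)
  qed
  moreover have "a ` J \<subseteq> {i\<in>I. v i \<notin> \<int>}"
  proof (intro image_subsetI CollectI conjI notI)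
    fix j assume j: "j \<in> J"
    show "a j \<in> I" using a[OF j] by blast
    assume "v (a j) \<in> \<int>"
    then have "(v (a j) + s j) - v (a j) \<in> \<int>" using a[OF j] by (intro Ints_diff) auto
    then show False using notint[of "s j"] s[OF j] by simp
  qed
  ultimately show False using card I card_inj_on_le[of a J "{i\<in>I. v i \<notin> \<int>}"] by simp
qed

lemma continuous_on_Max_image:
  fixes f :: "'i \<Rightarrow> 'a::topological_space \<Rightarrow> real"
  assumes "finite I" "I \<noteq> {}" "\<And>i. i \<in> I \<Longrightarrow> continuous_on S (f i)"
  shows "continuous_on S (\<lambda>x. Max ((\<lambda>i. f i x) ` I))"
  using assms
proof (induction I rule: finite_ne_induct)
  case (insert i I)
  then have "continuous_on S (\<lambda>x. max (f i x) (Max ((\<lambda>i. f i x) ` I)))"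
    by (intro continuous_on_max) auto
  then show ?case using insert by simp
qed simp

lemma compact_cube: "compact {y :: nat \<Rightarrow> real. \<forall>i. a i \<le> y i \<and> y i \<le> b i}"
proof -
  have "compactin (product_topology (\<lambda>_. euclidean) UNIV) (PiE UNIV (\<lambda>i. {a i..b i}))"
    by (simp add: compactin_PiE)
  moreover have "PiE UNIV (\<lambda>i. {a i..b i}) = {y. \<forall>i. a i \<le> y i \<and> y i \<le> b i}"
    by (auto simp: PiE_def Pi_def)
  ultimately show ?thesis
    by (simp add: euclidean_product_topology flip: compactin_euclidean_iff)
qed

text \<open>The metric on functions weights the coordinates by powers of 1/2, and these weights sum
  to 2.\<close>

lemma dist_fun_le_coordinates:
  fixes x y :: "nat \<Rightarrow> real"
  assumes "\<And>i. \<bar>x i - y i\<bar> \<le> e"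
  shows "dist x y \<le> 2 * e"
proof -
  have e: "0 \<le> e" using assms[of 0] by linarith
  have "dist x y \<le> suminf (\<lambda>n. (1/2)^n * e)"
    unfolding dist_fun_def
  proof (rule suminf_le)
    show "(1/2)^n * min (dist (x (from_nat n)) (y (from_nat n))) 1 \<le> (1/2)^n * e" for n
      using assms[of "from_nat n"] by (intro mult_left_mono) (auto simp: dist_real_def)
    show "summable (\<lambda>n. (1/2)^n * min (dist (x (from_nat n)) (y (from_nat n))) (1::real))"
      by (rule summable_comparison_test'[of "\<lambda>n. (1/2)^n"]) (auto simp: summable_geometric_iff)
    show "summable (\<lambda>n. (1/2)^n * e)"
      by (intro summable_mult2) (simp add: summable_geometric_iff)
  qed
  also have "\<dots> = 2 * e"
    using suminf_mult2[of "\<lambda>n. (1/2::real)^n" e] suminf_geometric[of "1/2::real"]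
    by (simp add: summable_geometric_iff)
  finally show ?thesis .
qed

section \<open>Odd maps of spheres\<close>

lemma topspace_nsphere: "topspace (nsphere n) = {x. (\<Sum>i\<le>n. (x i)\<^sup>2) = 1 \<and> (\<forall>i>n. x i = 0)}"
  by (simp add: nsphere)

lemma nsphere_eq_top_of_set: "nsphere n = top_of_set (topspace (nsphere n))"
  by (simp add: nsphere euclidean_product_topology)

lemma continuous_map_nsphere_iff:
  "continuous_map (nsphere m) (nsphere n) f \<longleftrightarrow>
     continuous_on (topspace (nsphere m)) f \<and> f \<in> topspace (nsphere m) \<rightarrow> topspace (nsphere n)"
  by (subst (1 2) nsphere_eq_top_of_set) (auto simp: continuous_map_in_subtopology)

section \<open>Radial projection onto the sphere and the degree of projected maps\<close>

definition sphere_proj :: "nat \<Rightarrow> (nat \<Rightarrow> real) \<Rightarrow> nat \<Rightarrow> real" where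
  "sphere_proj n x = (\<lambda>i. if i \<le> n then x i / sqrt (\<Sum>j\<le>n. (x j)\<^sup>2) else 0)"

lemma sum_squares_pos:
  fixes x :: "nat \<Rightarrow> real"
  assumes "\<exists>i\<le>n. x i \<noteq> 0"
  shows "(\<Sum>j\<le>n. (x j)\<^sup>2) > 0"
  using assms by (auto intro!: sum_pos2)

lemma sphere_proj_in_nsphere:
  assumes "\<exists>i\<le>n. x i \<noteq> 0"
  shows "sphere_proj n x \<in> topspace (nsphere n)"
  using sum_squares_pos[OF assms]
  by (simp add: topspace_nsphere sphere_proj_def power_divide sum_nonneg flip: sum_divide_distrib)

lemma sphere_proj_id: "x \<in> topspace (nsphere n) \<Longrightarrow> sphere_proj n x = x"
  by (auto simp: topspace_nsphere sphere_proj_def)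

lemma sphere_proj_scale:
  assumes "c > 0"
  shows "sphere_proj n (\<lambda>i. x i / c) = sphere_proj n x"
proof -
  have "(\<Sum>j\<le>n. (x j / c)\<^sup>2) = (\<Sum>j\<le>n. (x j)\<^sup>2) / c\<^sup>2"
    by (simp add: power_divide sum_divide_distrib)
  then show ?thesis using assms by (auto simp: sphere_proj_def real_sqrt_divide fun_eq_iff)
qed

lemma sphere_proj_minus: "sphere_proj n (\<lambda>i. - x i) = (\<lambda>i. - sphere_proj n x i)"
  by (auto simp: sphere_proj_def)

lemma nsphere_nonzero: "x \<in> topspace (nsphere n) \<Longrightarrow> \<exists>i\<le>n. x i \<noteq> 0"
  by (rule ccontr) (auto simp: topspace_nsphere)

lemma continuous_on_sphere_proj:
  assumes "\<And>i. i \<le> n \<Longrightarrow> continuous_on S (\<lambda>x. f x i)" "\<And>x. x \<in> S \<Longrightarrow> \<exists>i\<le>n. f x i \<noteq> 0"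
  shows "continuous_on S (\<lambda>x. sphere_proj n (f x))"
proof (rule continuous_on_coordinatewise_then_product)
  fix i
  have "continuous_on S (\<lambda>x. f x i / sqrt (\<Sum>j\<le>n. (f x j)\<^sup>2))" if "i \<le> n"
    using assms sum_squares_pos[of n "f _"] that by (intro continuous_intros) (auto simp: less_le)
  then show "continuous_on S (\<lambda>x. sphere_proj n (f x) i)"
    by (cases "i \<le> n") (auto simp: sphere_proj_def)
qed

lemma continuous_map_sphere_proj:
  assumes "\<And>i. i \<le> n \<Longrightarrow> continuous_on (topspace (nsphere m)) (\<lambda>x. f x i)"
    and "\<And>x. x \<in> topspace (nsphere m) \<Longrightarrow> \<exists>i\<le>n. f x i \<noteq> 0"
  shows "continuous_map (nsphere m) (nsphere n) (\<lambda>x. sphere_proj n (f x))"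
  using continuous_on_sphere_proj[OF assms] sphere_proj_in_nsphere assms(2)
  by (auto simp: continuous_map_nsphere_iff)

text \<open>The segment from \<open>f x\<close> to \<open>g x\<close> misses the origin, so the
  linear homotopy can be projected to the sphere. Both deformations in the proof that odd maps have
  odd degree are of this form.\<close>

lemma Brouwer_degree2_sphere_proj_eq:
  assumes f: "\<And>i. i \<le> n \<Longrightarrow> continuous_on (topspace (nsphere n)) (\<lambda>x. f x i)"
    and g: "\<And>i. i \<le> n \<Longrightarrow> continuous_on (topspace (nsphere n)) (\<lambda>x. g x i)"
    and nz: "\<And>x t. x \<in> topspace (nsphere n) \<Longrightarrow> 0 \<le> t \<Longrightarrow> t \<le> 1 \<Longrightarrow>
               \<exists>i\<le>n. (1 - t) * f x i + t * g x i \<noteq> 0"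
  shows "Brouwer_degree2 n (\<lambda>x. sphere_proj n (f x)) = Brouwer_degree2 n (\<lambda>x. sphere_proj n (g x))"
proof (rule Brouwer_degree2_homotopic)
  let ?S = "topspace (nsphere n)"
  let ?h = "\<lambda>(t, x). sphere_proj n (\<lambda>i. (1 - t) * f x i + t * g x i)"
  have "continuous_on ({0..1::real} \<times> ?S) ?h"
    unfolding case_prod_unfold
  proof (rule continuous_on_sphere_proj)
    fix i assume i: "i \<le> n"
    have "continuous_on ({0..1::real} \<times> ?S) (\<lambda>p. f (snd p) i)" "continuous_on ({0..1::real} \<times> ?S) (\<lambda>p. g (snd p) i)"
      using continuous_on_compose2[OF f[OF i] continuous_on_snd[OF continuous_on_id], of "{0..1::real} \<times> ?S"]
        continuous_on_compose2[OF g[OF i] continuous_on_snd[OF continuous_on_id], of "{0..1::real} \<times> ?S"]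
      by auto
    then show "continuous_on ({0..1::real} \<times> ?S) (\<lambda>p. (1 - fst p) * f (snd p) i + fst p * g (snd p) i)"
      by (intro continuous_intros)
  qed (use nz in auto)
  moreover have "?h \<in> {0..1::real} \<times> ?S \<rightarrow> ?S"
    using nz by (auto intro!: sphere_proj_in_nsphere)
  ultimately have "continuous_map (prod_topology (top_of_set {0..1::real}) (top_of_set ?S)) (top_of_set ?S) ?h"
    by (auto simp: continuous_map_in_subtopology)
  then have "continuous_map (prod_topology (top_of_set {0..1::real}) (nsphere n)) (nsphere n) ?h"
    by (simp flip: nsphere_eq_top_of_set)
  then show "homotopic_with (\<lambda>x. True) (nsphere n) (nsphere n) (\<lambda>x. sphere_proj n (f x))
     (\<lambda>x. sphere_proj n (g x))"
    unfolding homotopic_with_def by (intro exI[of _ ?h]) auto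
qed

text \<open>Rounding \<open>\<bar>v\<bar>\<close> and keeping the sign, rather than rounding \<open>v\<close>, makes the rounding odd.\<close>

definition odd_round :: "real \<Rightarrow> real \<Rightarrow> real \<Rightarrow> real" where
  "odd_round M s v = sgn v * of_int \<lfloor>M * \<bar>v\<bar> + s\<rfloor>"

lemma odd_round_minus: "odd_round M s (- v) = - odd_round M s v"
  by (simp add: odd_round_def sgn_minus)

lemma odd_round_close:
  assumes "M > 0" "0 < s" "s < 1"
  shows "\<bar>odd_round M s v / M - v\<bar> \<le> 1 / M"
proof -
  let ?k = "of_int \<lfloor>M * \<bar>v\<bar> + s\<rfloor> :: real"
  have k: "\<bar>?k - M * \<bar>v\<bar>\<bar> \<le> 1" using assms by linarith
  have "odd_round M s v / M - v = sgn v * (?k - M * \<bar>v\<bar>) / M"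
    using assms by (simp add: odd_round_def field_simps) (simp add: sgn_if abs_if)
  then have "\<bar>odd_round M s v / M - v\<bar> = \<bar>sgn v\<bar> * \<bar>?k - M * \<bar>v\<bar>\<bar> / M"
    using assms by (simp add: abs_mult)
  also have "\<dots> \<le> 1 / M"
    using k assms by (intro divide_right_mono) (auto simp: sgn_if)
  finally show ?thesis .
qed

lemma odd_round_range:
  fixes M :: nat
  assumes "0 < s" "s < 1" "\<bar>v\<bar> \<le> 1"
  shows "odd_round (real M) s v \<in> of_int ` {- int M..int M}"
proof -
  have "real M * \<bar>v\<bar> \<le> real M" using assms by (simp add: mult_left_le)
  then have "\<lfloor>real M * \<bar>v\<bar> + s\<rfloor> \<le> int M" using assms by linarith
  moreover have "0 \<le> \<lfloor>real M * \<bar>v\<bar> + s\<rfloor>" using assms by simp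
  moreover define k where "k = \<lfloor>real M * \<bar>v\<bar> + s\<rfloor>"
  ultimately have k: "0 \<le> k" "k \<le> int M" by auto
  have "odd_round (real M) s v = of_int ((if v = 0 then 0 else if v > 0 then 1 else -1) * k)"
    by (simp add: odd_round_def k_def sgn_if)
  then show ?thesis
    using k by (intro image_eqI) (assumption, auto)
qed

lemma odd_round_unit:
  fixes M :: nat
  assumes "0 < s" "s < 1" "\<bar>v\<bar> = 1"
  shows "\<bar>odd_round (real M) s v\<bar> = real M"
proof -
  have "\<lfloor>real M + s\<rfloor> = int M" using assms by linarith
  then show ?thesis using assms by (auto simp: odd_round_def abs_mult sgn_if)
qed

text \<open>The floor is locally constant off the integers. The sign jumps only at
  \<open>v0 = 0\<close>, where the floor is 0 because \<open>0 < s < 1\<close>, so this jump is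
  multiplied by 0.\<close>

lemma eventually_odd_round_eq:
  assumes v: "(v \<longlongrightarrow> v0) F" and ni: "M * \<bar>v0\<bar> + s \<notin> \<int>" and s: "0 < s" "s < 1"
  shows "eventually (\<lambda>y. odd_round M s (v y) = odd_round M s v0) F"
proof -
  have "((\<lambda>y. M * \<bar>v y\<bar> + s) \<longlongrightarrow> M * \<bar>v0\<bar> + s) F" by (intro tendsto_intros v)
  then have fl: "eventually (\<lambda>y. \<lfloor>M * \<bar>v y\<bar> + s\<rfloor> = \<lfloor>M * \<bar>v0\<bar> + s\<rfloor>) F"
    using ni by (rule eventually_floor_eq)
  show ?thesis
  proof (cases "v0 = 0")
    case True
    then have "\<lfloor>M * \<bar>v0\<bar> + s\<rfloor> = 0" using s by (simp add: floor_eq_iff)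
    with fl show ?thesis by (auto elim!: eventually_mono simp: odd_round_def)
  next
    case False
    have "eventually (\<lambda>y. sgn (v y) = sgn v0) F"
    proof (cases "v0 > 0")
      case True
      then show ?thesis using order_tendstoD(1)[OF v True] by (auto elim!: eventually_mono)
    next
      case nF: False
      then have "v0 < 0" using False by simp
      then show ?thesis using order_tendstoD(2)[OF v \<open>v0 < 0\<close>] by (auto elim!: eventually_mono)
    qed
    with fl show ?thesis by eventually_elim (simp add: odd_round_def)
  qed
qed

text \<open>An odd function with values 1 and -1 on nonzero vectors is wanted. Its jumps are
  harmless because it is only evaluated at rounded directions.\<close>

definition odd_sign :: "(nat \<Rightarrow> real) \<Rightarrow> real" where
  "odd_sign l = sgn (l (LEAST i. l i \<noteq> 0))"

lemma odd_sign_minus: "odd_sign (\<lambda>i. - l i) = - odd_sign l"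
  by (simp add: odd_sign_def sgn_minus)

lemma odd_sign_square:
  assumes "l i \<noteq> 0"
  shows "odd_sign l * odd_sign l = 1"
proof -
  have "l (LEAST i. l i \<noteq> 0) \<noteq> 0" by (rule LeastI[where P = "\<lambda>i. l i \<noteq> 0"]) (fact assms)
  then show ?thesis by (simp add: odd_sign_def sgn_if)
qed

text \<open>At a zero of \<open>\<tau>\<close> the bound on \<open>w\<close> squeezes the product to
  0; elsewhere \<open>\<rho>\<close> is constant nearby and the product is a constant multiple of
  \<open>\<tau>\<close>. So \<open>\<rho>\<close> may jump wherever \<open>\<tau>\<close>
  vanishes.\<close>

lemma continuous_on_mult_locally_constant:
  fixes \<tau> :: "'a::topological_space \<Rightarrow> real" and w :: "'b \<Rightarrow> real"
  assumes \<tau>: "continuous_on S \<tau>" and bd: "\<And>x. x \<in> S \<Longrightarrow> \<bar>w (\<rho> x)\<bar> \<le> B"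
    and lc: "\<And>x. x \<in> S \<Longrightarrow> \<tau> x \<noteq> 0 \<Longrightarrow> eventually (\<lambda>y. \<rho> y = \<rho> x) (at x within S)"
  shows "continuous_on S (\<lambda>x. \<tau> x * w (\<rho> x))"
  unfolding continuous_on_def
proof
  fix x assume x: "x \<in> S"
  have \<tau>x: "(\<tau> \<longlongrightarrow> \<tau> x) (at x within S)" using \<tau> x by (simp add: continuous_on_def)
  show "((\<lambda>x. \<tau> x * w (\<rho> x)) \<longlongrightarrow> \<tau> x * w (\<rho> x)) (at x within S)"
  proof (cases "\<tau> x = 0")
    case True
    have "((\<lambda>y. \<bar>\<tau> y\<bar> * B) \<longlongrightarrow> 0) (at x within S)"
      using tendsto_mult_right[OF tendsto_rabs[OF \<tau>x], of B] True by simp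
    moreover have "eventually (\<lambda>y. norm (\<tau> y * w (\<rho> y)) \<le> \<bar>\<tau> y\<bar> * B) (at x within S)"
      unfolding eventually_at_topological
      using bd by (intro exI[of _ UNIV]) (auto simp: abs_mult intro!: mult_left_mono)
    ultimately show ?thesis using True by (simp add: Lim_null_comparison)
  next
    case False
    have "((\<lambda>y. \<tau> y * w (\<rho> x)) \<longlongrightarrow> \<tau> x * w (\<rho> x)) (at x within S)"
      by (intro tendsto_intros \<tau>x)
    moreover have "eventually (\<lambda>y. \<tau> y * w (\<rho> x) = \<tau> y * w (\<rho> y)) (at x within S)"
      using lc[OF x False] by eventually_elim simp
    ultimately show ?thesis by (rule Lim_transform_eventually)
  qed
qed

section \<open>Rounded directions and the perturbed map\<close>

definition max_coord :: "nat \<Rightarrow> (nat \<Rightarrow> real) \<Rightarrow> real" where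
  "max_coord n x = Max ((\<lambda>i. \<bar>x i\<bar>) ` {..n})"

lemma max_coord_ge: "i \<le> n \<Longrightarrow> \<bar>x i\<bar> \<le> max_coord n x"
  by (simp add: max_coord_def)

lemma max_coord_attained: "\<exists>i\<le>n. \<bar>x i\<bar> = max_coord n x"
proof -
  have "max_coord n x \<in> (\<lambda>i. \<bar>x i\<bar>) ` {..n}"
    unfolding max_coord_def by (rule Max_in) auto
  then show ?thesis by force
qed

lemma max_coord_pos: "\<exists>i\<le>n. x i \<noteq> 0 \<Longrightarrow> max_coord n x > 0"
  using max_coord_ge by (metis abs_le_zero_iff not_less order.trans)

lemma max_coord_nonneg: "max_coord n x \<ge> 0"
  using max_coord_ge[of 0 n x] by simp

lemma max_coord_minus: "max_coord n (\<lambda>i. - x i) = max_coord n x"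
  by (simp add: max_coord_def)

lemma continuous_on_max_coord:
  assumes "\<And>i. i \<le> n \<Longrightarrow> continuous_on S (\<lambda>x. f x i)"
  shows "continuous_on S (\<lambda>x. max_coord n (f x))"
  unfolding max_coord_def
  by (rule continuous_on_Max_image) (auto intro!: continuous_on_rabs assms)

text \<open>The colours 0 to \<open>n\<close> are \<open>n + 1\<close> distinct shifts strictly
  between 0 and 1, enough for points with at most \<open>n\<close> noninteger coordinates.\<close>

definition colour :: "nat \<Rightarrow> nat \<Rightarrow> real" where
  "colour n j = (real j + 1) / (real n + 2)"

lemma colour_bounds: "j \<le> n \<Longrightarrow> 0 < colour n j \<and> colour n j < 1"
  by (simp add: colour_def)

lemma inj_colour: "inj_on (colour n) J"
  by (auto simp: inj_on_def colour_def)

text \<open>Division by the maximum norm puts the direction on the boundary of a cube, where some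
  coordinate is 1 or -1. The rounded vectors are integer points of a cube of half-width
  \<open>M\<close>, hence finite in number.\<close>

definition round_dir :: "nat \<Rightarrow> nat \<Rightarrow> nat \<Rightarrow> (nat \<Rightarrow> real) \<Rightarrow> nat \<Rightarrow> real" where
  "round_dir n M j x =
     (\<lambda>i. if i \<le> n then odd_round (real M) (colour n j) (x i / max_coord n x) else 0)"

definition bump :: "nat \<Rightarrow> nat \<Rightarrow> nat \<Rightarrow> (nat \<Rightarrow> real) \<Rightarrow> real" where
  "bump n M j x =
     (\<Prod>i\<le>n. \<bar>sin (pi * (real M * \<bar>x i / max_coord n x\<bar> + colour n j))\<bar>) * (if j = n then \<bar>x n\<bar> else 1)"

text \<open>The directions of \<open>x\<close> where rounding with colour \<open>j\<close> is discontinuous are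
  zeros of \<open>bump n M j\<close> (the last factor also kills colour \<open>n\<close> on the equator \<open>x n = 0\<close>), so
  \<open>perturbed\<close> is continuous although \<open>round_dir\<close> jumps there. Oddness
  forces the shift \<open>\<delta>\<close> to be multiplied by an odd sign of the direction.\<close>

definition perturbed :: "nat \<Rightarrow> nat \<Rightarrow> real \<Rightarrow> ((nat \<Rightarrow> real) \<Rightarrow> nat \<Rightarrow> real) \<Rightarrow> (nat \<Rightarrow> real) \<Rightarrow> nat \<Rightarrow> real" where
  "perturbed n M \<delta> f x k = (\<Sum>j\<le>n. bump n M j x *
     (f (sphere_proj n (round_dir n M j x)) k + (if k = j then \<delta> * odd_sign (round_dir n M j x) else 0)))"

lemma round_dir_minus: "round_dir n M j (\<lambda>i. - x i) = (\<lambda>i. - round_dir n M j x i)"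
  by (auto simp: round_dir_def max_coord_minus odd_round_minus[symmetric])

lemma bump_minus: "bump n M j (\<lambda>i. - x i) = bump n M j x"
  by (simp add: bump_def max_coord_minus)

lemma bump_nonneg: "bump n M j x \<ge> 0"
  by (auto simp: bump_def intro!: mult_nonneg_nonneg prod_nonneg)

lemma sin_pi_eq_0_iff: "sin (pi * u) = 0 \<longleftrightarrow> u \<in> \<int>"
  by (auto simp: sin_zero_iff_int2 Ints_def)

lemma bump_nonzeroD: "bump n M j x \<noteq> 0 \<Longrightarrow> i \<le> n \<Longrightarrow> real M * \<bar>x i / max_coord n x\<bar> + colour n j \<notin> \<int>"
  by (auto simp: bump_def sin_pi_eq_0_iff)

context
  fixes n M :: nat and x :: "nat \<Rightarrow> real"
  assumes M: "M > 0" and x: "\<exists>i\<le>n. x i \<noteq> 0"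
begin

lemma ratio_le_1: "i \<le> n \<Longrightarrow> \<bar>x i / max_coord n x\<bar> \<le> 1"
  using max_coord_ge[of i n x] max_coord_pos[OF x] by simp

lemma ratio_eq_1: "\<exists>i\<le>n. \<bar>x i / max_coord n x\<bar> = 1"
  using max_coord_attained[of n x] max_coord_pos[OF x] by force

lemma round_dir_range: "j \<le> n \<Longrightarrow> i \<le> n \<Longrightarrow> round_dir n M j x i \<in> of_int ` {- int M..int M}"
  using ratio_le_1 colour_bounds by (auto simp: round_dir_def intro!: odd_round_range)

text \<open>Adding a colour below 1 to \<open>M\<close> and rounding down returns \<open>M\<close>.
  So rounded directions stay on the boundary of the cube and are never zero.\<close>

lemma round_dir_unit: "j \<le> n \<Longrightarrow> \<exists>i\<le>n. \<bar>round_dir n M j x i\<bar> = real M"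
proof -
  assume j: "j \<le> n"
  obtain i where "i \<le> n" "\<bar>x i / max_coord n x\<bar> = 1" using ratio_eq_1 by blast
  moreover from this have "\<bar>odd_round (real M) (colour n j) (x i / max_coord n x)\<bar> = real M"
    using odd_round_unit colour_bounds[OF j] by blast
  ultimately show ?thesis
    by (intro exI[of _ i]) (simp add: round_dir_def)
qed

lemma round_dir_nonzero: "j \<le> n \<Longrightarrow> \<exists>i\<le>n. round_dir n M j x i \<noteq> 0"
  using round_dir_unit[of j] M by (metis abs_zero of_nat_0_eq_iff less_irrefl)

lemma round_dir_close:
  assumes "j \<le> n" "i \<le> n"
  shows "\<bar>round_dir n M j x i / real M - x i / max_coord n x\<bar> \<le> 1 / real M"
  using odd_round_close[of "real M" "colour n j"] colour_bounds[OF assms(1)] M assms(2)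
  by (simp add: round_dir_def)

text \<open>The coordinate of largest modulus becomes an integer, so at most \<open>n\<close> of the
  \<open>n + 1\<close> coordinates can block a colour. On the equator the last coordinate is an
  integer too, and the \<open>n\<close> colours below \<open>n\<close> suffice; this is what permits
  colour \<open>n\<close> to be switched off there.\<close>

lemma exists_bump_pos:
  assumes J: "J = (if x n = 0 then {..<n} else {..n})"
  shows "\<exists>j\<in>J. bump n M j x > 0"
proof -
  let ?v = "\<lambda>i. real M * \<bar>x i / max_coord n x\<bar>"
  obtain i0 where i0: "i0 \<le> n" "\<bar>x i0 / max_coord n x\<bar> = 1" using ratio_eq_1 by blast
  have "{i\<in>{..n}. ?v i \<notin> \<int>} \<subseteq> J - {i0}"
  proof
    fix i assume "i \<in> {i\<in>{..n}. ?v i \<notin> \<int>}"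
    then have i: "i \<le> n" "?v i \<notin> \<int>" by auto
    have "i \<noteq> i0" using i i0 by (metis Ints_of_nat mult.right_neutral)
    moreover have "i \<noteq> n" if "x n = 0" using i that by auto
    ultimately show "i \<in> J - {i0}" using i J by auto
  qed
  moreover have "i0 \<in> J"
    using i0 J by (cases "i0 = n") auto
  ultimately have "{i\<in>{..n}. ?v i \<notin> \<int>} \<subset> J" by blast
  then have "card {i\<in>{..n}. ?v i \<notin> \<int>} < card J"
    by (rule psubset_card_mono[rotated]) (simp add: J)
  then obtain j where j: "j \<in> J" "\<forall>i\<in>{..n}. ?v i + colour n j \<notin> \<int>"
    using exists_free_colour[of "{..n}" ?v J "colour n"] colour_bounds inj_colour J by (auto split: if_splits)
  have "bump n M j x \<noteq> 0"
    using j J by (auto simp: bump_def sin_pi_eq_0_iff split: if_splits)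
  then show ?thesis using j bump_nonneg[of n M j x] by (intro bexI[of _ j]) auto
qed

end

lemma continuous_on_coord_nsphere: "continuous_on (topspace (nsphere n)) (\<lambda>x. x i)"
  by (rule continuous_on_subset[OF continuous_on_product_coordinates]) simp

text \<open>The map \<open>f\<close> enters only through its values at rounded directions, and these
  are locally constant wherever the bump is nonzero. Coordinates of unit vectors and of the shift
  bound the weights.\<close>

lemma continuous_on_perturbed:
  assumes f: "f \<in> topspace (nsphere n) \<rightarrow> topspace (nsphere n)" and M: "M > 0"
  shows "continuous_on (topspace (nsphere n)) (\<lambda>x. perturbed n M \<delta> f x k)"
  unfolding perturbed_def
proof (rule continuous_on_sum)
  fix j assume "j \<in> {..n}"
  then have j: "j \<le> n" by simp
  let ?S = "topspace (nsphere n)"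
  let ?w = "\<lambda>l. f (sphere_proj n l) k + (if k = j then \<delta> * odd_sign l else 0)"
  have ratio: "continuous_on ?S (\<lambda>x. x i / max_coord n x)" for i
  proof (rule continuous_on_divide)
    show "continuous_on ?S (\<lambda>x. max_coord n x)"
      by (rule continuous_on_max_coord) (rule continuous_on_coord_nsphere)
    show "\<forall>x\<in>?S. max_coord n x \<noteq> 0" using max_coord_pos[OF nsphere_nonzero] by force
  qed (rule continuous_on_coord_nsphere)
  show "continuous_on ?S (\<lambda>x. bump n M j x * ?w (round_dir n M j x))"
  proof (rule continuous_on_mult_locally_constant[where \<rho> = "round_dir n M j" and w = ?w and B = "1 + \<bar>\<delta>\<bar>"])
    show "continuous_on ?S (bump n M j)"
    proof -
      have "continuous_on ?S (\<lambda>x. if j = n then \<bar>x n\<bar> else 1)"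
        by (cases "j = n") (auto intro!: continuous_intros continuous_on_coord_nsphere)
      then show ?thesis unfolding bump_def by (intro continuous_on_mult continuous_intros ratio)
    qed
    fix x assume x: "x \<in> ?S"
    note nz = nsphere_nonzero[OF x]
    have "f (sphere_proj n (round_dir n M j x)) \<in> ?S"
      using f sphere_proj_in_nsphere[OF round_dir_nonzero[OF M nz j]] by blast
    then have "\<bar>f (sphere_proj n (round_dir n M j x)) k\<bar> \<le> 1"
      using topspace_nsphere_1 abs_square_le_1 by blast
    moreover have "\<bar>if k = j then \<delta> * odd_sign (round_dir n M j x) else 0\<bar> \<le> \<bar>\<delta>\<bar>"
      by (auto simp: odd_sign_def abs_mult sgn_if)
    ultimately show "\<bar>?w (round_dir n M j x)\<bar> \<le> 1 + \<bar>\<delta>\<bar>" by linarith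
    assume b: "bump n M j x \<noteq> 0"
    have "eventually (\<lambda>y. odd_round (real M) (colour n j) (y i / max_coord n y)
              = odd_round (real M) (colour n j) (x i / max_coord n x)) (at x within ?S)" if i: "i \<le> n" for i
    proof -
      have "((\<lambda>y. y i / max_coord n y) \<longlongrightarrow> x i / max_coord n x) (at x within ?S)"
        using ratio x by (simp add: continuous_on_def)
      then show ?thesis
        using bump_nonzeroD[OF b i] colour_bounds[OF j] by (intro eventually_odd_round_eq) auto
    qed
    then have "eventually (\<lambda>y. \<forall>i\<in>{..n}. odd_round (real M) (colour n j) (y i / max_coord n y)
              = odd_round (real M) (colour n j) (x i / max_coord n x)) (at x within ?S)"
      by (intro eventually_ball_finite) auto
    then show "eventually (\<lambda>y. round_dir n M j y = round_dir n M j x) (at x within ?S)"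
      by (rule eventually_mono) (auto simp: round_dir_def)
  qed
qed

lemma perturbed_minus:
  assumes odd: "\<And>x. x \<in> topspace (nsphere n) \<Longrightarrow> f (\<lambda>i. - x i) = (\<lambda>i. - f x i)"
    and M: "M > 0" and x: "x \<in> topspace (nsphere n)"
  shows "perturbed n M \<delta> f (\<lambda>i. - x i) k = - perturbed n M \<delta> f x k"
proof -
  have "f (sphere_proj n (round_dir n M j (\<lambda>i. - x i))) k = - f (sphere_proj n (round_dir n M j x)) k"
    if "j \<le> n" for j
    using odd[OF sphere_proj_in_nsphere[OF round_dir_nonzero[OF M nsphere_nonzero[OF x] that]]]
    by (simp add: round_dir_minus sphere_proj_minus)
  then show ?thesis
    by (auto simp: perturbed_def bump_minus round_dir_minus odd_sign_minus algebra_simps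
        simp flip: sum_negf intro!: sum.cong)
qed

lemma eventually_round_dir_approx:
  assumes f: "continuous_map (nsphere n) (nsphere n) f" and e: "e > 0"
  shows "\<forall>\<^sub>F M in sequentially. \<forall>x\<in>topspace (nsphere n). \<forall>j\<le>n. \<forall>k\<le>n.
           \<bar>f (sphere_proj n (round_dir n M j x)) k - f x k\<bar> \<le> e"
proof -
  let ?S = "topspace (nsphere n)"
  \<comment> \<open>The boundary of a cube of half-width 1, continued by zeros: compact and without
    the origin, so \<open>f\<close> after projection is uniformly continuous on it. It contains both
    the normalised \<open>x\<close> and the rounded direction divided by \<open>M\<close>, which are
    at distance at most \<open>2 / M\<close>.\<close>
  define C where "C = {y :: nat \<Rightarrow> real. \<forall>i. (if i \<le> n then -1 else 0) \<le> y i \<and> y i \<le> (if i \<le> n then 1 else 0)}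
      \<inter> (\<Union>i\<le>n. {y. \<bar>y i\<bar> = 1})"
  have compC: "compact C"
    unfolding C_def
    by (intro compact_Int_closed compact_cube closed_UN closed_Collect_eq continuous_intros
        continuous_on_product_coordinates ballI) auto
  have nzC: "\<exists>i\<le>n. y i \<noteq> 0" if "y \<in> C" for y using that by (auto simp: C_def)
  have "\<forall>\<^sub>F M in sequentially. \<forall>x\<in>?S. \<forall>j\<le>n.
           \<bar>f (sphere_proj n (round_dir n M j x)) k - f x k\<bar> \<le> e" for k
  proof -
    have "continuous_on C (\<lambda>y. f (sphere_proj n y) k)"
    proof (rule continuous_on_compose2[where g = "\<lambda>x. f x k" and t = ?S])
      show "continuous_on ?S (\<lambda>x. f x k)"
        using f by (simp add: continuous_map_nsphere_iff continuous_on_product_then_coordinatewise)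
      show "continuous_on C (sphere_proj n)"
        using continuous_on_sphere_proj[of n C "\<lambda>x. x"] nzC
        by (simp add: continuous_on_product_coordinates[THEN continuous_on_subset])
    qed (use nzC sphere_proj_in_nsphere in auto)
    then have "uniformly_continuous_on C (\<lambda>y. f (sphere_proj n y) k)"
      using compC by (rule compact_uniformly_continuous)
    then obtain d where d: "d > 0" and dC: "\<And>y y'. y \<in> C \<Longrightarrow> y' \<in> C \<Longrightarrow> dist y' y < d \<Longrightarrow>
        dist (f (sphere_proj n y') k) (f (sphere_proj n y) k) < e"
      using e unfolding uniformly_continuous_on_def by meson
    have "\<forall>\<^sub>F M in sequentially. real M > 2 / d"
      by (rule eventually_gt_at_top[THEN filterlim_real_sequentially[THEN filterlim_iff[THEN iffD1], rule_format]])
    then show ?thesis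
    proof eventually_elim
      case (elim M)
      then have "real M > 0" using d by (meson divide_pos_pos less_trans zero_less_numeral)
      then have M: "M > 0" "2 / real M < d" using d elim by (auto simp: field_simps)
      show ?case
      proof (intro ballI allI impI)
        fix x j assume x: "x \<in> ?S" and j: "j \<le> n"
        note nz = nsphere_nonzero[OF x]
        define y where "y = (\<lambda>i. x i / max_coord n x)"
        define y' where "y' = (\<lambda>i. round_dir n M j x i / real M)"
        have "\<bar>y i\<bar> \<le> 1" if "i \<le> n" for i
          unfolding y_def by (rule ratio_le_1[OF M(1) nz that])
        moreover have "y i = 0" if "\<not> i \<le> n" for i
          using x that by (simp add: y_def topspace_nsphere)
        moreover have "\<exists>i\<le>n. \<bar>y i\<bar> = 1"
          unfolding y_def by (rule ratio_eq_1[OF M(1) nz])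
        ultimately have "y \<in> C"
          by (auto simp: C_def abs_le_iff)
        moreover have "y' \<in> C"
        proof -
          have "\<bar>round_dir n M j x i\<bar> \<le> real M" if "i \<le> n" for i
            using round_dir_range[OF M(1) nz j that] by (auto simp: abs_le_iff)
          then have "\<bar>y' i\<bar> \<le> 1" if "i \<le> n" for i
            using M that by (simp add: y'_def)
          moreover have "y' i = 0" if "\<not> i \<le> n" for i
            using that by (simp add: y'_def round_dir_def)
          moreover have "\<exists>i\<le>n. \<bar>y' i\<bar> = 1"
            using round_dir_unit[OF M(1) nz j] M by (force simp: y'_def)
          ultimately show ?thesis
            by (auto simp: C_def abs_le_iff)
        qed
        moreover have "dist y' y \<le> 2 * (1 / real M)"
        proof (rule dist_fun_le_coordinates)
          show "\<bar>y' i - y i\<bar> \<le> 1 / real M" for i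
            using round_dir_close[OF M(1) nz j, of i] x
            by (cases "i \<le> n") (auto simp: y_def y'_def round_dir_def topspace_nsphere)
        qed
        ultimately have "dist (f (sphere_proj n y') k) (f (sphere_proj n y) k) < e"
          using dC M by simp
        moreover have "sphere_proj n y = x"
          unfolding y_def using max_coord_pos[OF nz] x by (simp add: sphere_proj_scale sphere_proj_id)
        moreover have "sphere_proj n y' = sphere_proj n (round_dir n M j x)"
          unfolding y'_def using M by (simp add: sphere_proj_scale)
        ultimately show "\<bar>f (sphere_proj n (round_dir n M j x)) k - f x k\<bar> \<le> e"
          by (simp add: dist_real_def)
      qed
    qed
  qed
  then have "\<forall>\<^sub>F M in sequentially. \<forall>k\<in>{..n}. \<forall>x\<in>?S. \<forall>j\<le>n.
           \<bar>f (sphere_proj n (round_dir n M j x)) k - f x k\<bar> \<le> e"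
    by (intro eventually_ball_finite) auto
  then show ?thesis by (rule eventually_mono) auto
qed

text \<open>The perturbed vector is a nonnegative, nontrivial combination of vectors whose product
  with the unit vector \<open>f x\<close> is at least \<open>1 - 1/4 - 1/4\<close>: the
  approximation costs 1/4 over the \<open>n + 1\<close> coordinates, the shift another 1/4. Hence
  the segment from \<open>f x\<close> to the perturbed vector misses the origin.\<close>

lemma inner_perturbed_pos:
  assumes f: "f \<in> topspace (nsphere n) \<rightarrow> topspace (nsphere n)"
    and M: "M > 0" and x: "x \<in> topspace (nsphere n)" and \<delta>: "\<bar>\<delta>\<bar> \<le> 1/4"
    and app: "\<And>j k. j \<le> n \<Longrightarrow> k \<le> n \<Longrightarrow>
      \<bar>f (sphere_proj n (round_dir n M j x)) k - f x k\<bar> \<le> 1 / (4 * (real n + 1))"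
  shows "(\<Sum>k\<le>n. f x k * perturbed n M \<delta> f x k) > 0"
proof -
  note nz = nsphere_nonzero[OF x]
  have fx: "f x \<in> topspace (nsphere n)" using f x by blast
  have fx1: "\<bar>f x k\<bar> \<le> 1" for k using topspace_nsphere_1[OF fx] abs_square_le_1 by blast
  define a where "a = (\<lambda>j k. f (sphere_proj n (round_dir n M j x)) k
      + (if k = j then \<delta> * odd_sign (round_dir n M j x) else 0))"
  have a: "(\<Sum>k\<le>n. f x k * a j k) > 0" if j: "j \<le> n" for j
  proof -
    let ?e = "1 / (4 * (real n + 1))"
    let ?b = "f (sphere_proj n (round_dir n M j x))"
    have "(\<Sum>k\<le>n. f x k * a j k)
        = (\<Sum>k\<le>n. (f x k)\<^sup>2 + f x k * (?b k - f x k) + (if k = j then f x j * \<delta> * odd_sign (round_dir n M j x) else 0))"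
      by (rule sum.cong) (auto simp: a_def algebra_simps power2_eq_square)
    also have "\<dots> = (\<Sum>k\<le>n. (f x k)\<^sup>2) + (\<Sum>k\<le>n. f x k * (?b k - f x k)) + f x j * \<delta> * odd_sign (round_dir n M j x)"
      using j by (simp add: sum.distrib)
    also have "(\<Sum>k\<le>n. (f x k)\<^sup>2) = 1" using fx by (simp add: topspace_nsphere)
    finally have eq: "(\<Sum>k\<le>n. f x k * a j k)
        = 1 + (\<Sum>k\<le>n. f x k * (?b k - f x k)) + f x j * \<delta> * odd_sign (round_dir n M j x)" .
    have "\<bar>f x k * (?b k - f x k)\<bar> \<le> 1 * ?e" if "k \<le> n" for k
      unfolding abs_mult by (rule mult_mono) (use fx1 app[OF j that] in auto)
    then have "\<bar>\<Sum>k\<le>n. f x k * (?b k - f x k)\<bar> \<le> (\<Sum>k\<le>n. 1 * ?e)"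
      by (intro order.trans[OF sum_abs sum_mono]) auto
    also have "\<dots> = 1/4" by (simp add: field_simps)
    finally have 1: "\<bar>\<Sum>k\<le>n. f x k * (?b k - f x k)\<bar> \<le> 1/4" .
    have "\<bar>f x j * \<delta> * odd_sign (round_dir n M j x)\<bar> \<le> 1 * (1/4) * 1"
      unfolding abs_mult using fx1 \<delta>
      by (intro mult_mono) (auto simp: odd_sign_def sgn_if)
    with 1 show ?thesis unfolding eq by linarith
  qed
  obtain j0 where j0: "j0 \<le> n" "bump n M j0 x > 0"
    using exists_bump_pos[OF M nz refl] by (metis atMost_iff lessThan_iff less_imp_le)
  have "(\<Sum>k\<le>n. f x k * perturbed n M \<delta> f x k) = (\<Sum>k\<le>n. \<Sum>j\<le>n. bump n M j x * (f x k * a j k))"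
    by (simp add: perturbed_def a_def sum_distrib_left mult_ac)
  also have "\<dots> = (\<Sum>j\<le>n. \<Sum>k\<le>n. bump n M j x * (f x k * a j k))" by (rule sum.swap)
  also have "\<dots> = (\<Sum>j\<le>n. bump n M j x * (\<Sum>k\<le>n. f x k * a j k))" by (simp add: sum_distrib_left)
  also have "\<dots> > 0"
  proof (rule sum_pos2[of _ j0])
    show "0 \<le> bump n M j x * (\<Sum>k\<le>n. f x k * a j k)" if "j \<in> {..n}" for j
      using a[of j] that bump_nonneg by (auto intro!: mult_nonneg_nonneg less_imp_le)
    show "0 < bump n M j0 x * (\<Sum>k\<le>n. f x k * a j0 k)"
      using a[of j0] j0 by simp
  qed (use j0 in auto)
  finally show ?thesis .
qed

text \<open>On the equator only the colours below \<open>n\<close> contribute, and the finitely many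
  possible rounded directions exclude only finitely many \<open>\<delta>\<close>.\<close>

lemma finite_shifts_vanishing_on_equator:
  assumes M: "M > 0"
  shows "finite {\<delta>. \<exists>x\<in>topspace (nsphere n). x n = 0 \<and> (\<forall>k<n. perturbed n M \<delta> f x k = 0)}"
proof -
  define R where "R = {l :: nat \<Rightarrow> real. \<forall>i. (i \<in> {..n} \<longrightarrow> l i \<in> of_int ` {- int M..int M}) \<and> (i \<notin> {..n} \<longrightarrow> l i = 0)}
     \<inter> {l. \<exists>i. l i \<noteq> 0}"
  have finR: "finite R"
    unfolding R_def by (intro finite_Int disjI1 finite_set_of_finite_funs) auto
  \<comment> \<open>For a fixed choice \<open>L\<close> of rounded directions the condition says
    that \<open>n\<close> shifted vectors in dimension \<open>n\<close> are linearly dependent. With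
    arbitrary coefficients \<open>c\<close> in place of the bump values, finitely many choices of
    \<open>L\<close> replace the points \<open>x\<close>.\<close>
  define bad where "bad = (\<lambda>L. {\<delta>. \<exists>c. (\<exists>j<n. c j \<noteq> 0) \<and>
           (\<forall>k<n. (\<Sum>j<n. c j * (f (sphere_proj n (L j)) k + (if k = j then \<delta> * odd_sign (L j) else 0))) = 0)})"
  have finbad: "finite (bad L)" if "L \<in> {..<n} \<rightarrow>\<^sub>E R" for L
    unfolding bad_def
  proof (rule finite_singular_diagonal_shifts)
    fix j assume "j < n"
    then have "L j \<in> R" using that by auto
    then show "odd_sign (L j) * odd_sign (L j) = 1" by (auto simp: R_def intro: odd_sign_square)
  qed
  have "{\<delta>. \<exists>x\<in>topspace (nsphere n). x n = 0 \<and> (\<forall>k<n. perturbed n M \<delta> f x k = 0)}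
      \<subseteq> (\<Union>L\<in>{..<n} \<rightarrow>\<^sub>E R. bad L)"
  proof (clarify)
    fix \<delta> x assume x: "x \<in> topspace (nsphere n)" "x n = 0" and z: "\<forall>k<n. perturbed n M \<delta> f x k = 0"
    note nz = nsphere_nonzero[OF x(1)]
    define L where "L = (\<lambda>j\<in>{..<n}. round_dir n M j x)"
    have "round_dir n M j x \<in> R" if "j < n" for j
      using round_dir_range[OF M nz, of j] round_dir_nonzero[OF M nz, of j] that
      by (auto simp: R_def) (simp add: round_dir_def)
    then have L: "L \<in> {..<n} \<rightarrow>\<^sub>E R" by (auto simp: L_def)
    have "bump n M n x = 0" using x by (simp add: bump_def)
    then have "perturbed n M \<delta> f x k = (\<Sum>j<n. bump n M j x * (f (sphere_proj n (L j)) k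
        + (if k = j then \<delta> * odd_sign (L j) else 0)))" if "k < n" for k
      using that by (auto simp: perturbed_def L_def simp flip: lessThan_Suc_atMost intro!: sum.cong)
    with z have "\<forall>k<n. (\<Sum>j<n. bump n M j x * (f (sphere_proj n (L j)) k
        + (if k = j then \<delta> * odd_sign (L j) else 0))) = 0" by simp
    moreover have "\<exists>j<n. bump n M j x \<noteq> 0"
      using exists_bump_pos[OF M nz refl] x by auto
    ultimately have "\<delta> \<in> bad L"
      unfolding bad_def by (intro CollectI exI[of _ "\<lambda>j. bump n M j x"] conjI)
    then show "\<delta> \<in> (\<Union>L\<in>{..<n} \<rightarrow>\<^sub>E R. bad L)" by (rule UN_I[OF L])
  qed
  moreover have "finite (\<Union>L\<in>{..<n} \<rightarrow>\<^sub>E R. bad L)"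
    using finR finbad by (auto intro!: finite_PiE)
  ultimately show ?thesis by (rule finite_subset)
qed

text \<open>The library theorem on odd maps needs the equator to be preserved. A small odd perturbation
  makes the first \<open>n\<close> coordinates nonzero on the equator, and then the last one can be
  scaled down to zero there without creating zeros.\<close>

theorem odd_Brouwer_degree2:
  assumes "continuous_map (nsphere n) (nsphere n) f"
    and "\<And>x. x \<in> topspace (nsphere n) \<Longrightarrow> f (\<lambda>i. - x i) = (\<lambda>i. - f x i)"
  shows "odd (Brouwer_degree2 n f)"
  using assms
proof (induction n arbitrary: f)
  case 0
  define pp :: "nat \<Rightarrow> real" where "pp = (\<lambda>i. if i = 0 then 1 else 0)"
  let ?r = "\<lambda>x :: nat \<Rightarrow> real. \<lambda>i. if i = 0 then - x i else x i"
  have S: "topspace (nsphere 0) = {pp, \<lambda>i. - pp i}"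
    by (auto simp: topspace_nsphere pp_def fun_eq_iff power2_eq_1_iff split: if_split_asm)
  have fpp: "f (\<lambda>i. - pp i) = (\<lambda>i. - f pp i)" using 0(2) S by auto
  have "f pp = pp \<or> f pp = (\<lambda>i. - pp i)"
    using 0(1) S by (auto simp: continuous_map_nsphere_iff)
  then show ?case
  proof
    assume "f pp = pp"
    then have "\<And>x. x \<in> topspace (nsphere 0) \<Longrightarrow> f x = id x" using S fpp by auto
    then show ?thesis using Brouwer_degree2_eq[of 0 f id] by simp
  next
    assume *: "f pp = (\<lambda>i. - pp i)"
    have "f x = ?r x" if "x \<in> topspace (nsphere 0)" for x
    proof -
      have "f x = (\<lambda>i. - x i)" using that S fpp * by auto
      then show ?thesis using that by (auto simp: topspace_nsphere)
    qed
    then show ?thesis using Brouwer_degree2_eq[of 0 f ?r] Brouwer_degree2_reflection[of 0] by simp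
  qed
next
  case (Suc m)
  define n where "n = Suc m"
  note cont = Suc.prems(1)[folded n_def] and odd_f = Suc.prems(2)[folded n_def]
  let ?S = "topspace (nsphere n)"
  have f: "f \<in> ?S \<rightarrow> ?S" and cf: "continuous_on ?S f"
    using cont by (auto simp: continuous_map_nsphere_iff)
  have cf': "continuous_on ?S (\<lambda>x. f x i)" for i
    using cf by (rule continuous_on_product_then_coordinatewise)
  have "\<forall>\<^sub>F M in sequentially. M > 0 \<and> (\<forall>x\<in>?S. \<forall>j\<le>n. \<forall>k\<le>n.
           \<bar>f (sphere_proj n (round_dir n M j x)) k - f x k\<bar> \<le> 1 / (4 * (real n + 1)))"
    by (intro eventually_conj eventually_gt_at_top eventually_round_dir_approx[OF cont]) simp
  then obtain M where M: "M > 0" and app: "\<And>x j k. x \<in> ?S \<Longrightarrow> j \<le> n \<Longrightarrow> k \<le> n \<Longrightarrow>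
           \<bar>f (sphere_proj n (round_dir n M j x)) k - f x k\<bar> \<le> 1 / (4 * (real n + 1))"
    unfolding eventually_sequentially by blast
  define Bad where "Bad = {\<delta>. \<exists>x\<in>?S. x n = 0 \<and> (\<forall>k<n. perturbed n M \<delta> f x k = 0)}"
  have "infinite ({0<..<1/4} - Bad)"
    unfolding Bad_def by (intro Diff_infinite_finite finite_shifts_vanishing_on_equator[OF M] infinite_Ioo) simp
  then have "{0<..<1/4} - Bad \<noteq> {}" using finite.emptyI by metis
  then obtain \<delta> where "\<delta> \<in> {0<..<1/4} - Bad" by blast
  then have \<delta>: "0 < \<delta>" "\<delta> < 1/4" "\<delta> \<notin> Bad" by auto
  then have good: "\<And>x. x \<in> ?S \<Longrightarrow> x n = 0 \<Longrightarrow> \<exists>k<n. perturbed n M \<delta> f x k \<noteq> 0"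
    unfolding Bad_def by blast
  define p where "p = perturbed n M \<delta> f"
  \<comment> \<open>The factor \<open>\<bar>x n\<bar>\<close> is even, so \<open>q\<close> stays
    odd; it vanishes on the equator, so the projection of \<open>q\<close> maps the equator to
    itself.\<close>
  define q where "q = (\<lambda>x k. if k < n then p x k else \<bar>x n\<bar> * p x k)"
  have cp: "continuous_on ?S (\<lambda>x. p x i)" for i
    unfolding p_def by (rule continuous_on_perturbed[OF f M])
  have cq: "continuous_on ?S (\<lambda>x. q x i)" for i
    by (cases "i < n") (auto simp: q_def intro!: continuous_intros cp continuous_on_coord_nsphere)
  have ip: "(\<Sum>k\<le>n. f x k * p x k) > 0" if "x \<in> ?S" for x
    unfolding p_def using inner_perturbed_pos[OF f M that _ app[OF that]] \<delta> by simp
  have nzp: "\<exists>k\<le>n. p x k \<noteq> 0" if x: "x \<in> ?S" for x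
  proof (rule ccontr)
    assume "\<not> ?thesis"
    then have "(\<Sum>k\<le>n. f x k * p x k) = 0" by (intro sum.neutral) auto
    then show False using ip[OF x] by auto
  qed
  \<comment> \<open>Paired with the unit vector \<open>f x\<close>, a point of the segment gives
    \<open>1 - t\<close> plus \<open>t\<close> times a positive number.\<close>
  have nz1: "\<exists>k\<le>n. (1 - t) * f x k + t * p x k \<noteq> 0" if x: "x \<in> ?S" and t: "0 \<le> t" "t \<le> 1" for x t
  proof (rule ccontr)
    assume "\<not> ?thesis"
    then have "(\<Sum>k\<le>n. f x k * ((1 - t) * f x k + t * p x k)) = 0" by (intro sum.neutral) auto
    moreover have "(\<Sum>k\<le>n. f x k * ((1 - t) * f x k + t * p x k))
        = (1 - t) * (\<Sum>k\<le>n. (f x k)\<^sup>2) + t * (\<Sum>k\<le>n. f x k * p x k)"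
      by (simp add: sum_distrib_left algebra_simps power2_eq_square sum.distrib sum_subtractf)
    moreover have "(\<Sum>k\<le>n. (f x k)\<^sup>2) = 1" using f x by (auto simp: topspace_nsphere)
    ultimately have "(1 - t) + t * (\<Sum>k\<le>n. f x k * p x k) = 0" by simp
    moreover have "t * (\<Sum>k\<le>n. f x k * p x k) \<ge> 0" using ip[OF x] t by simp
    ultimately have "t = 1 \<and> t * (\<Sum>k\<le>n. f x k * p x k) = 0" using t by linarith
    then show False using ip[OF x] by auto
  qed
  \<comment> \<open>Only the last coordinate changes. Where the others vanish, \<open>x\<close> is
    off the equator by the choice of \<delta>, so the last coordinate is multiplied by a positive
    factor.\<close>
  have nz2: "\<exists>k\<le>n. (1 - t) * p x k + t * q x k \<noteq> 0" if x: "x \<in> ?S" and t: "0 \<le> t" "t \<le> 1" for x t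
  proof (cases "\<exists>k<n. p x k \<noteq> 0")
    case True
    then obtain k where "k < n" "p x k \<noteq> 0" by blast
    then show ?thesis by (intro exI[of _ k]) (simp add: q_def algebra_simps)
  next
    case False
    then have xn: "x n \<noteq> 0" using good x p_def by blast
    obtain k where "k \<le> n" "p x k \<noteq> 0" using nzp[OF x] by blast
    then have "p x n \<noteq> 0" using False by (metis le_neq_implies_less)
    moreover have "(1 - t) + t * \<bar>x n\<bar> > 0"
      using t xn by (cases "t = 1") (auto intro: add_pos_nonneg)
    moreover have "(1 - t) * p x n + t * q x n = ((1 - t) + t * \<bar>x n\<bar>) * p x n"
      by (simp add: q_def algebra_simps)
    ultimately show ?thesis by (intro exI[of _ n]) simp
  qed
  define g where "g = (\<lambda>x. sphere_proj n (q x))"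
  have nzq: "\<exists>k\<le>n. q x k \<noteq> 0" if "x \<in> ?S" for x
    using nz2[OF that, of 1] by simp
  have g: "continuous_map (nsphere n) (nsphere n) g"
    unfolding g_def by (rule continuous_map_sphere_proj) (use cq nzq in auto)
  have "Brouwer_degree2 n f = Brouwer_degree2 n (\<lambda>x. sphere_proj n (f x))"
    using f by (intro Brouwer_degree2_eq) (auto simp: sphere_proj_id Pi_iff)
  also have "\<dots> = Brouwer_degree2 n (\<lambda>x. sphere_proj n (p x))"
    by (rule Brouwer_degree2_sphere_proj_eq) (use cf' cp nz1 in auto)
  also have "\<dots> = Brouwer_degree2 n g"
    unfolding g_def by (rule Brouwer_degree2_sphere_proj_eq) (use cq cp nz2 in auto)
  finally have fg: "Brouwer_degree2 n f = Brouwer_degree2 n g" .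
  have "q (\<lambda>i. - x i) = (\<lambda>k. - q x k)" if "x \<in> ?S" for x
    using perturbed_minus[of n f M x \<delta>] odd_f M that by (auto simp: q_def p_def)
  then have g_odd: "g (\<lambda>i. - x i) = (\<lambda>i. - g x i)" if "x \<in> ?S" for x
    using that by (simp add: g_def sphere_proj_minus)
  have sub: "topspace (nsphere m) \<subseteq> ?S"
    by (auto simp: topspace_nsphere n_def)
  have gm: "g \<in> topspace (nsphere m) \<rightarrow> topspace (nsphere m)"
  proof
    fix x assume x: "x \<in> topspace (nsphere m)"
    then have "x n = 0" by (simp add: topspace_nsphere n_def)
    then have "q x n = 0" by (simp add: q_def)
    then have "g x n = 0" by (simp add: g_def sphere_proj_def)
    moreover have "g x \<in> ?S" using g x sub by (auto simp: continuous_map_nsphere_iff)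
    ultimately show "g x \<in> topspace (nsphere m)"
      using topspace_nsphere_minus1[of "g x" n] by (simp add: n_def)
  qed
  have "even (Brouwer_degree2 n g - Brouwer_degree2 (n - Suc 0) g)"
    by (rule Borsuk_odd_mapping_degree_step[OF g]) (use g_odd gm in \<open>auto simp: n_def\<close>)
  moreover have "odd (Brouwer_degree2 m g)"
  proof (rule Suc.IH)
    show "continuous_map (nsphere m) (nsphere m) g"
      using g gm sub by (auto simp: continuous_map_nsphere_iff intro: continuous_on_subset)
  qed (use g_odd sub in auto)
  ultimately show ?case using fg by (simp add: n_def)
qed

text \<open>Projecting a nowhere zero \<open>h\<close> gives an odd map into the equator. As a
  self-map of the \<open>n\<close>-sphere it misses a pole and has degree 0, while on the equator
  its degree is odd; but the two degrees have the same parity.\<close>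

theorem Borsuk_Ulam:
  fixes h :: "(nat \<Rightarrow> real) \<Rightarrow> nat \<Rightarrow> real"
  assumes cont: "\<And>i. i < n \<Longrightarrow> continuous_on (topspace (nsphere n)) (\<lambda>x. h x i)"
    and odd_h: "\<And>x i. x \<in> topspace (nsphere n) \<Longrightarrow> i < n \<Longrightarrow> h (\<lambda>i. - x i) i = - h x i"
    and n: "n > 0"
  shows "\<exists>x\<in>topspace (nsphere n). \<forall>i<n. h x i = 0"
proof (rule ccontr)
  assume "\<not> ?thesis"
  then have nz: "\<And>x. x \<in> topspace (nsphere n) \<Longrightarrow> \<exists>i<n. h x i \<noteq> 0" by blast
  obtain m where m: "n = Suc m" using n by (cases n) auto
  define g where "g = (\<lambda>x. sphere_proj m (h x))"
  have sub: "topspace (nsphere m) \<subseteq> topspace (nsphere n)"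
    by (auto simp: topspace_nsphere m)
  have g: "continuous_map (nsphere n) (nsphere m) g"
    unfolding g_def by (rule continuous_map_sphere_proj) (use cont nz in \<open>auto simp: m less_Suc_eq_le\<close>)
  then have gS: "continuous_on (topspace (nsphere n)) g"
    and gr: "g \<in> topspace (nsphere n) \<rightarrow> topspace (nsphere m)"
    by (auto simp: continuous_map_nsphere_iff)
  have gn: "continuous_map (nsphere n) (nsphere n) g"
    using gS gr sub by (auto simp: continuous_map_nsphere_iff)
  have gm: "continuous_map (nsphere m) (nsphere m) g"
    using gS gr sub by (auto simp: continuous_map_nsphere_iff intro: continuous_on_subset)
  have odd_g: "g (\<lambda>i. - x i) = (\<lambda>i. - g x i)" if "x \<in> topspace (nsphere n)" for x
    using odd_h[OF that] by (auto simp: g_def sphere_proj_def m less_Suc_eq_le)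
  have "g ` topspace (nsphere n) \<noteq> topspace (nsphere n)"
  proof
    assume eq: "g ` topspace (nsphere n) = topspace (nsphere n)"
    have "(\<lambda>i. if i = n then 1 else 0 :: real) \<in> topspace (nsphere n)"
      by (simp add: topspace_nsphere if_distrib[of "\<lambda>x. x\<^sup>2"] cong: if_cong)
    then have "(\<lambda>i. if i = n then 1 else 0 :: real) \<in> g ` topspace (nsphere n)"
      using eq by simp
    then have "(\<lambda>i. if i = n then 1 else 0 :: real) \<in> topspace (nsphere m)"
      using gr by auto
    then show False by (auto simp: topspace_nsphere m)
  qed
  then have "Brouwer_degree2 n g = 0" by (rule Brouwer_degree2_nonsurjective[OF gn])
  moreover have "even (Brouwer_degree2 n g - Brouwer_degree2 (n - Suc 0) g)"
    by (rule Borsuk_odd_mapping_degree_step[OF gn]) (use odd_g gr sub in \<open>auto simp: m\<close>)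
  moreover have "odd (Brouwer_degree2 m g)"
    by (rule odd_Brouwer_degree2[OF gm]) (use odd_g sub in auto)
  ultimately show False by (simp add: m)
qed

section \<open>Bounds for the covering dimension\<close>

definition refines_with_order :: "'a topology \<Rightarrow> int \<Rightarrow> 'a set set \<Rightarrow> 'a set set \<Rightarrow> bool" where
  "refines_with_order T n \<U> \<V> \<longleftrightarrow> (\<forall>V\<in>\<V>. openin T V) \<and> topspace T \<subseteq> \<Union>\<V> \<and> (\<forall>V\<in>\<V>. \<exists>U\<in>\<U>. V \<subseteq> U) \<and>
     (\<forall>x\<in>topspace T. finite {V\<in>\<V>. x \<in> V} \<and> int (card {V\<in>\<V>. x \<in> V}) \<le> n + 1)"

lemma covering_dim_leI:
  assumes "\<And>\<U>. (\<And>U. U \<in> \<U> \<Longrightarrow> openin T U) \<Longrightarrow> topspace T \<subseteq> \<Union>\<U> \<Longrightarrow>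
    \<exists>\<V>. refines_with_order T n \<U> \<V>"
  shows "covering_dim_le T n"
  unfolding covering_dim_le_def refines_with_order_def[symmetric] using assms by simp

lemma covering_dim_leE:
  assumes "covering_dim_le T n" "\<And>U. U \<in> \<U> \<Longrightarrow> openin T U" "topspace T \<subseteq> \<Union>\<U>"
  obtains \<V> where "refines_with_order T n \<U> \<V>"
  using assms unfolding covering_dim_le_def refines_with_order_def[symmetric] by blast

lemma covering_dim_le_mono:
  assumes "covering_dim_le T m" "m \<le> n"
  shows "covering_dim_le T n"
proof (rule covering_dim_leI)
  fix \<U> assume "\<And>U. U \<in> \<U> \<Longrightarrow> openin T U" "topspace T \<subseteq> \<Union>\<U>"
  with assms(1) obtain \<V> where "refines_with_order T m \<U> \<V>"
    by (rule covering_dim_leE)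
  then have "refines_with_order T n \<U> \<V>"
    unfolding refines_with_order_def
  proof (elim conjE, intro conjI ballI)
    fix x assume "\<forall>x\<in>topspace T. finite {V\<in>\<V>. x \<in> V} \<and> int (card {V\<in>\<V>. x \<in> V}) \<le> m + 1"
      and "x \<in> topspace T"
    then have "finite {V\<in>\<V>. x \<in> V}" "int (card {V\<in>\<V>. x \<in> V}) \<le> m + 1" by simp_all
    then show "finite {V\<in>\<V>. x \<in> V}" "int (card {V\<in>\<V>. x \<in> V}) \<le> n + 1"
      using assms(2) by linarith+
  qed simp_all
  then show "\<exists>\<V>. refines_with_order T n \<U> \<V>" ..
qed

text \<open>Cut \<open>S\<close> along the walls where a multiple of a coordinate, shifted by the colour, is an integer.
  Each coordinate lies on walls of at most one of the \<open>d + 1\<close> colours and integer coordinates lie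
  on none, so the pieces that remain for the various colours cover \<open>S\<close>.\<close>

lemma covering_dim_le_cubical:
  fixes S :: "(nat \<Rightarrow> real) set"
  assumes S: "compact S" and supp: "\<And>x i. x \<in> S \<Longrightarrow> K \<le> i \<Longrightarrow> x i = 0"
    and card: "\<And>x. x \<in> S \<Longrightarrow> card {i\<in>{..<K}. x i \<notin> \<int>} \<le> d"
  shows "covering_dim_le (top_of_set S) (int d)"
proof (cases "S = {}")
  case True
  then show ?thesis unfolding covering_dim_le_def by (auto intro!: exI[of _ "{}"])
next
  case ne: False
  show ?thesis
  proof (rule covering_dim_leI)
    fix \<U> assume op: "\<And>U. U \<in> \<U> \<Longrightarrow> openin (top_of_set S) U" and cov: "topspace (top_of_set S) \<subseteq> \<Union>\<U>"
    define \<C> where "\<C> = {C. open C \<and> S \<inter> C \<in> \<U>}"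
    have "S \<subseteq> \<Union>\<C>"
    proof
      fix x assume "x \<in> S"
      then obtain U where U: "U \<in> \<U>" "x \<in> U" using cov by auto
      then obtain C where "open C" "U = S \<inter> C" using op[of U] by (auto simp: openin_open)
      then show "x \<in> \<Union>\<C>" using U by (auto simp: \<C>_def)
    qed
    moreover from this ne have "\<C> \<noteq> {}" by auto
    moreover have "\<And>B. B \<in> \<C> \<Longrightarrow> open B" by (simp add: \<C>_def)
    ultimately obtain \<delta> where \<delta>: "0 < \<delta>" "\<And>T. T \<subseteq> S \<Longrightarrow> diameter T < \<delta> \<Longrightarrow> \<exists>B\<in>\<C>. T \<subseteq> B"
      using Lebesgue_number_lemma[OF S] by metis
    obtain M :: nat where "real M > 2 / \<delta>" using reals_Archimedean2 by blast
    moreover from this have Mpos: "real M > 0" using \<delta> by (meson divide_pos_pos less_trans zero_less_numeral)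
    ultimately have M: "2 * (1 / real M) < \<delta>" using \<delta> by (simp add: field_simps)
    define u where "u = (\<lambda>j (x :: nat \<Rightarrow> real) i. real M * x i + colour d j)"
    define V where "V = (\<lambda>j (l :: nat \<Rightarrow> int). S \<inter> (\<Inter>i<K. {x. of_int (l i) < u j x i \<and> u j x i < of_int (l i) + 1}))"
    define \<V> where "\<V> = {V j l | j l. j \<le> d}"
    have "openin (top_of_set S) (V j l)" for j l
    proof -
      have "continuous_on UNIV (\<lambda>x. u j x i)" for i
        unfolding u_def by (intro continuous_intros continuous_on_product_coordinates)
      then have "open (\<Inter>i<K. {x. of_int (l i) < u j x i \<and> u j x i < of_int (l i) + 1})"
        by (intro open_INT ballI open_Collect_conj open_Collect_less continuous_intros) auto
      then show ?thesis unfolding V_def by (rule openin_open_Int)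
    qed
    then have 1: "\<forall>W\<in>\<V>. openin (top_of_set S) W" by (auto simp: \<V>_def)
    have 2: "topspace (top_of_set S) \<subseteq> \<Union>\<V>"
    proof
      fix x assume "x \<in> topspace (top_of_set S)"
      then have x: "x \<in> S" by simp
      have "card {i\<in>{..<K}. real M * x i \<notin> \<int>} \<le> card {i\<in>{..<K}. x i \<notin> \<int>}"
        by (rule card_mono) auto
      then obtain j where j: "j \<le> d" "\<forall>i\<in>{..<K}. real M * x i + colour d j \<notin> \<int>"
        using exists_free_colour[of "{..<K}" "\<lambda>i. real M * x i" "{..d}" "colour d"] card[OF x]
          colour_bounds inj_colour by auto
      have "of_int \<lfloor>u j x i\<rfloor> < u j x i \<and> u j x i < of_int \<lfloor>u j x i\<rfloor> + 1" if "i < K" for i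
      proof -
        have "of_int \<lfloor>u j x i\<rfloor> \<noteq> u j x i" using j that unfolding u_def by (metis Ints_of_int lessThan_iff)
        then show ?thesis by linarith
      qed
      then have "x \<in> V j (\<lambda>i. \<lfloor>u j x i\<rfloor>)" using x by (auto simp: V_def)
      then show "x \<in> \<Union>\<V>" using j by (auto simp: \<V>_def)
    qed
    have 3: "\<exists>U\<in>\<U>. W \<subseteq> U" if W0: "W \<in> \<V>" for W
    proof -
      obtain j l where W: "W = V j l" using W0 by (auto simp: \<V>_def)
      have WS: "W \<subseteq> S" by (auto simp: W V_def)
      have "dist x y \<le> 2 * (1 / real M)" if xy: "x \<in> W" "y \<in> W" for x y
      proof (rule dist_fun_le_coordinates)
        fix i
        show "\<bar>x i - y i\<bar> \<le> 1 / real M"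
        proof (cases "i < K")
          case True
          have "of_int (l i) < u j x i \<and> u j x i < of_int (l i) + 1"
            "of_int (l i) < u j y i \<and> u j y i < of_int (l i) + 1"
            using xy True by (auto simp: W V_def)
          then have "\<bar>u j x i - u j y i\<bar> \<le> 1" by linarith
          moreover have "u j x i - u j y i = real M * (x i - y i)" by (simp add: u_def algebra_simps)
          ultimately have "real M * \<bar>x i - y i\<bar> \<le> 1" using Mpos by (simp add: abs_mult)
          then show ?thesis using Mpos by (simp add: field_simps)
        next
          case False
          then show ?thesis using supp[of x i] supp[of y i] xy WS by (auto simp: subset_iff)
        qed
      qed
      then have "diameter W \<le> 2 * (1 / real M)"
        unfolding diameter_def using Mpos by (auto intro!: cSUP_least)
      then have "diameter W < \<delta>" using M by linarith
      then obtain B where "B \<in> \<C>" "W \<subseteq> B" using \<delta> WS by blast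
      then show ?thesis using WS by (intro bexI[of _ "S \<inter> B"]) (auto simp: \<C>_def)
    qed
    have 4: "finite {W\<in>\<V>. x \<in> W} \<and> int (card {W\<in>\<V>. x \<in> W}) \<le> int d + 1" if "x \<in> S" for x
    proof -
      \<comment> \<open>A point lies in at most one piece of each colour: the integers
        \<open>l i\<close> with \<open>i < K\<close> must be the floors of its shifted coordinates,
        and the piece depends on no other values of \<open>l\<close>.\<close>
      have sub: "{W\<in>\<V>. x \<in> W} \<subseteq> (\<lambda>j. V j (\<lambda>i. \<lfloor>u j x i\<rfloor>)) ` {..d}"
      proof
        fix W assume "W \<in> {W\<in>\<V>. x \<in> W}"
        then obtain j l where W: "W = V j l" "j \<le> d" "x \<in> V j l" by (auto simp: \<V>_def)
        then have "l i = \<lfloor>u j x i\<rfloor>" if "i < K" for i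
        proof -
          have "of_int (l i) < u j x i \<and> u j x i < of_int (l i) + 1" using W that by (simp add: V_def)
          then show ?thesis by linarith
        qed
        then have "V j l = V j (\<lambda>i. \<lfloor>u j x i\<rfloor>)" by (simp add: V_def)
        then show "W \<in> (\<lambda>j. V j (\<lambda>i. \<lfloor>u j x i\<rfloor>)) ` {..d}" using W by blast
      qed
      have "card {W\<in>\<V>. x \<in> W} \<le> card {..d}" by (rule surj_card_le[OF _ sub]) simp
      then show ?thesis using finite_subset[OF sub] by simp
    qed
    show "\<exists>\<V>. refines_with_order (top_of_set S) (int d) \<U> \<V>"
      unfolding refines_with_order_def
      using 1 2 3 4 by (intro exI[of _ \<V>]) simp
  qed
qed

section \<open>Maps into Euclidean space from covers of small order\<close>

lemma power_sums_zeroD: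
  fixes a c :: "'v \<Rightarrow> real"
  assumes A: "finite A" "inj_on a A" "card A \<le> m"
    and z: "\<And>k. k < m \<Longrightarrow> (\<Sum>v\<in>A. c v * a v ^ k) = 0" and v: "v \<in> A"
  shows "c v = 0"
proof -
  \<comment> \<open>The Lagrange polynomial of the node \<open>a v\<close>, not normalised. Its
    degree is below \<open>m\<close>, so the vanishing power sums annihilate it, and only the term
    of \<open>v\<close> survives.\<close>
  define q where "q = (\<Prod>w\<in>A - {v}. [:- a w, 1:])"
  have deg: "degree q < m"
  proof -
    have "degree q = card (A - {v})" unfolding q_def by (subst degree_prod_eq_sum_degree) auto
    also have "\<dots> < card A" using A v by (intro psubset_card_mono) auto
    finally show ?thesis using A by simp
  qed
  have q0: "poly q (a w) = 0" if "w \<in> A - {v}" for w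
    using that A by (auto simp: q_def poly_prod intro: prod_zero)
  have "poly q (a v) \<noteq> 0"
    using A v by (auto simp: q_def poly_prod inj_on_def)
  moreover have "(\<Sum>w\<in>A. c w * poly q (a w)) = 0"
  proof -
    have "(\<Sum>w\<in>A. c w * poly q (a w)) = (\<Sum>w\<in>A. \<Sum>k\<le>degree q. poly.coeff q k * (c w * a w ^ k))"
      by (simp add: poly_altdef sum_distrib_left mult_ac)
    also have "\<dots> = (\<Sum>k\<le>degree q. poly.coeff q k * (\<Sum>w\<in>A. c w * a w ^ k))"
      by (subst sum.swap) (simp add: sum_distrib_left)
    also have "\<dots> = 0" using z deg by (intro sum.neutral) simp
    finally show ?thesis .
  qed
  moreover have "(\<Sum>w\<in>A. c w * poly q (a w)) = c v * poly q (a v) + (\<Sum>w\<in>A - {v}. c w * poly q (a w))"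
    using A v by (simp add: sum.remove)
  moreover have "(\<Sum>w\<in>A - {v}. c w * poly q (a w)) = 0" using q0 by (intro sum.neutral) simp
  ultimately show ?thesis by simp
qed

text \<open>The maps are the coordinates of \<open>\<Sum>V. \<phi> V x *\<^sub>R (1, a\<^sub>V, a\<^sub>V\<^sup>2, \<dots>)\<close>, where \<open>\<phi> V\<close> is positive exactly on \<open>V\<close>.\<close>

lemma covering_dim_le_separating_maps:
  fixes S :: "'a::metric_space set"
  assumes S: "compact S" and dim: "covering_dim_le (top_of_set S) (int n)"
    and op: "\<And>U. U \<in> \<U> \<Longrightarrow> openin (top_of_set S) U" and cov: "S \<subseteq> \<Union>\<U>"
  obtains g :: "nat \<Rightarrow> 'a \<Rightarrow> real" where "\<And>k. continuous_on S (g k)"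
    and "\<And>x y. x \<in> S \<Longrightarrow> y \<in> S \<Longrightarrow> (\<And>k. k < 2 * n + 2 \<Longrightarrow> g k x = g k y) \<Longrightarrow> \<exists>U\<in>\<U>. x \<in> U \<and> y \<in> U"
proof -
  obtain \<V> where \<V>: "\<And>V. V \<in> \<V> \<Longrightarrow> openin (top_of_set S) V" "\<And>V. V \<in> \<V> \<Longrightarrow> \<exists>U\<in>\<U>. V \<subseteq> U"
    "S \<subseteq> \<Union>\<V>"
    and ord: "\<And>x. x \<in> S \<Longrightarrow> finite {V\<in>\<V>. x \<in> V} \<and> int (card {V\<in>\<V>. x \<in> V}) \<le> int n + 1"
  proof -
    obtain \<V> where "refines_with_order (top_of_set S) (int n) \<U> \<V>"
      using covering_dim_leE[OF dim op] cov by (metis topspace_euclidean_subtopology)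
    then show ?thesis by (intro that[of \<V>]) (simp_all add: refines_with_order_def)
  qed
  have "compact_space (top_of_set S)" using S by (simp add: compact_space_subtopology)
  then have "\<exists>\<F>. finite \<F> \<and> \<F> \<subseteq> \<V> \<and> S \<subseteq> \<Union>\<F>"
    unfolding compact_space_alt topspace_euclidean_subtopology using \<V>(1,3) by simp
  then obtain \<W> where \<W>: "finite \<W>" "\<W> \<subseteq> \<V>" "S \<subseteq> \<Union>\<W>" by blast
  obtain a :: "'a set \<Rightarrow> nat" where a: "inj_on a \<W>"
    using finite_imp_inj_to_nat_seg[OF \<W>(1)] by blast
  \<comment> \<open>\<open>infdist\<close> to the empty set is 0 by convention, so a member equal to
    \<open>S\<close> gets the value 1 separately.\<close>
  define \<phi> where "\<phi> = (\<lambda>V x. if S - V = {} then 1 else infdist x (S - V))"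
  define g where "g = (\<lambda>k x. \<Sum>V\<in>\<W>. \<phi> V x * real (a V) ^ k)"
  have \<phi>cont: "continuous_on S (\<phi> V)" for V
    by (cases "S - V = {}") (auto simp: \<phi>_def intro!: continuous_intros)
  have \<phi>0: "\<phi> V x \<noteq> 0 \<longleftrightarrow> x \<in> V" if V: "V \<in> \<W>" and x: "x \<in> S" for V x
  proof (cases "S - V = {}")
    case False
    obtain C where "open C" "V = S \<inter> C" using \<V>(1)[of V] V \<W> by (auto simp: openin_open)
    then have "S - V = S - C" "closed (S - C)" using S by (auto intro: compact_imp_closed)
    then have "closed (S - V)" by simp
    then show ?thesis using in_closed_iff_infdist_zero[OF _ False, of x] False x by (auto simp: \<phi>_def)
  qed (use x in \<open>auto simp: \<phi>_def\<close>)
  have "\<exists>U\<in>\<U>. x \<in> U \<and> y \<in> U"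
    if x: "x \<in> S" and y: "y \<in> S" and eq: "\<And>k. k < 2 * n + 2 \<Longrightarrow> g k x = g k y" for x y
  proof -
    define c where "c = (\<lambda>V. \<phi> V x - \<phi> V y)"
    \<comment> \<open>At most \<open>n + 1\<close> members contain \<open>x\<close> and at most
      \<open>n + 1\<close> contain \<open>y\<close>, so \<open>2 * n + 2\<close> moments determine
      all differences \<open>c V\<close>. For \<open>n = d - 1\<close> these are
      \<open>2 * d\<close> functions, the number in Flores' theorem.\<close>
    define A where "A = {V\<in>\<W>. x \<in> V \<or> y \<in> V}"
    have finA: "finite A" using \<W> by (simp add: A_def)
    have "A \<subseteq> {V\<in>\<V>. x \<in> V} \<union> {V\<in>\<V>. y \<in> V}" using \<W> by (auto simp: A_def)
    then have "card A \<le> card ({V\<in>\<V>. x \<in> V} \<union> {V\<in>\<V>. y \<in> V})" using ord[OF x] ord[OF y] by (intro card_mono) auto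
    also have "\<dots> \<le> card {V\<in>\<V>. x \<in> V} + card {V\<in>\<V>. y \<in> V}" by (rule card_Un_le)
    also have "\<dots> \<le> 2 * n + 2" using ord[OF x] ord[OF y] by simp
    finally have cA: "card A \<le> 2 * n + 2" .
    have zero: "(\<Sum>V\<in>A. c V * real (a V) ^ k) = 0" if "k < 2 * n + 2" for k
    proof -
      have "(\<Sum>V\<in>A. c V * real (a V) ^ k) = (\<Sum>V\<in>\<W>. c V * real (a V) ^ k)"
      proof (intro sum.mono_neutral_left ballI)
        fix V assume "V \<in> \<W> - A"
        then have "V \<in> \<W>" "x \<notin> V" "y \<notin> V" by (auto simp: A_def)
        then have "\<phi> V x = 0" "\<phi> V y = 0" using \<phi>0 x y by blast+
        then show "c V * real (a V) ^ k = 0" by (simp add: c_def)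
      qed (use \<W> in \<open>auto simp: A_def\<close>)
      also have "\<dots> = g k x - g k y" by (simp add: g_def c_def left_diff_distrib sum_subtractf)
      finally show ?thesis using eq[OF that] by simp
    qed
    have inj: "inj_on (\<lambda>V. real (a V)) A" using a by (auto simp: inj_on_def A_def)
    obtain V where V: "V \<in> \<W>" "x \<in> V" using \<W> x by auto
    then have "V \<in> A" by (simp add: A_def)
    then have "c V = 0" using power_sums_zeroD[OF finA inj cA zero] by simp
    then have "y \<in> V" using \<phi>0[OF V(1) x] \<phi>0[OF V(1) y] V by (simp add: c_def)
    then show ?thesis using \<V>(2)[of V] V \<W> by blast
  qed
  moreover have "continuous_on S (g k)" for k
    unfolding g_def by (intro continuous_intros \<phi>cont)
  ultimately show ?thesis using that by blast
qed

lemma covering_dim_le_disjoint_Un: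
  assumes A: "covering_dim_le (top_of_set A) n" and B: "covering_dim_le (top_of_set B) n"
    and opA: "openin (top_of_set (A \<union> B)) A" and opB: "openin (top_of_set (A \<union> B)) B" and disj: "A \<inter> B = {}"
  shows "covering_dim_le (top_of_set (A \<union> B)) n"
proof (rule covering_dim_leI)
  fix \<U> assume op: "\<And>U. U \<in> \<U> \<Longrightarrow> openin (top_of_set (A \<union> B)) U"
    and cov: "topspace (top_of_set (A \<union> B)) \<subseteq> \<Union>\<U>"
  have ex: "\<exists>\<V>. refines_with_order (top_of_set C) n ((\<inter>) C ` \<U>) \<V>"
    if C: "covering_dim_le (top_of_set C) n" "C \<subseteq> A \<union> B" for C
  proof -
    have "openin (top_of_set C) U" if "U \<in> (\<inter>) C ` \<U>" for U
      using op C(2) that by (auto simp: openin_open)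
    moreover have "topspace (top_of_set C) \<subseteq> \<Union>((\<inter>) C ` \<U>)" using cov C(2) by auto
    ultimately show ?thesis using covering_dim_leE[OF C(1)] by metis
  qed
  obtain \<V>A where VA: "refines_with_order (top_of_set A) n ((\<inter>) A ` \<U>) \<V>A" using ex[OF A] by blast
  obtain \<V>B where VB: "refines_with_order (top_of_set B) n ((\<inter>) B ` \<U>) \<V>B" using ex[OF B] by blast
  have opV: "openin (top_of_set A) V" if "V \<in> \<V>A" for V
    using VA that unfolding refines_with_order_def by simp
  have opW: "openin (top_of_set B) V" if "V \<in> \<V>B" for V
    using VB that unfolding refines_with_order_def by simp
  have refA: "\<exists>U\<in>\<U>. V \<subseteq> U" if "V \<in> \<V>A" for V
    using VA that unfolding refines_with_order_def by auto
  have refB: "\<exists>U\<in>\<U>. V \<subseteq> U" if "V \<in> \<V>B" for V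
    using VB that unfolding refines_with_order_def by auto
  have subA: "V \<subseteq> A" if "V \<in> \<V>A" for V
    using openin_imp_subset[OF opV[OF that]] .
  have subB: "V \<subseteq> B" if "V \<in> \<V>B" for V
    using openin_imp_subset[OF opW[OF that]] .
  have "refines_with_order (top_of_set (A \<union> B)) n \<U> (\<V>A \<union> \<V>B)"
    unfolding refines_with_order_def
  proof (intro conjI ballI)
    fix V assume V: "V \<in> \<V>A \<union> \<V>B"
    then show "openin (top_of_set (A \<union> B)) V"
      using openin_trans[OF opV opA] openin_trans[OF opW opB] by (elim UnE)
    show "\<exists>U\<in>\<U>. V \<subseteq> U"
      using V refA refB by (elim UnE)
  next
    show "topspace (top_of_set (A \<union> B)) \<subseteq> \<Union>(\<V>A \<union> \<V>B)"
      using VA VB unfolding refines_with_order_def by auto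
  next
    fix x assume "x \<in> topspace (top_of_set (A \<union> B))"
    then consider "x \<in> A" "x \<notin> B" | "x \<in> B" "x \<notin> A" using disj by auto
    then have "finite {V \<in> \<V>A \<union> \<V>B. x \<in> V} \<and> int (card {V \<in> \<V>A \<union> \<V>B. x \<in> V}) \<le> n + 1"
    proof cases
      case 1
      then have "{V \<in> \<V>A \<union> \<V>B. x \<in> V} = {V \<in> \<V>A. x \<in> V}" using subB by blast
      then show ?thesis using VA 1 unfolding refines_with_order_def by simp
    next
      case 2
      then have "{V \<in> \<V>A \<union> \<V>B. x \<in> V} = {V \<in> \<V>B. x \<in> V}" using subA by blast
      then show ?thesis using VB 2 unfolding refines_with_order_def by simp
    qed
    then show "finite {V \<in> \<V>A \<union> \<V>B. x \<in> V}" "int (card {V \<in> \<V>A \<union> \<V>B. x \<in> V}) \<le> n + 1" by auto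
  qed
  then show "\<exists>\<V>. refines_with_order (top_of_set (A \<union> B)) n \<U> \<V>" ..
qed

text \<open>One member of the cover around \<open>p\<close>, together with the singletons outside
  it, is a disjoint refinement.\<close>

lemma covering_dim_le_isolated:
  assumes p: "p \<in> S" and iso: "\<And>x. x \<in> S \<Longrightarrow> x \<noteq> p \<Longrightarrow> openin (top_of_set S) {x}"
  shows "covering_dim_le (top_of_set S) 0"
proof (rule covering_dim_leI)
  fix \<U> assume op: "\<And>U. U \<in> \<U> \<Longrightarrow> openin (top_of_set S) U" and cov: "topspace (top_of_set S) \<subseteq> \<Union>\<U>"
  obtain U where U: "U \<in> \<U>" "p \<in> U" using p cov by auto
  have US: "U \<subseteq> S" using op[OF U(1)] by (rule openin_imp_subset)
  define \<V> where "\<V> = insert U ((\<lambda>x. {x}) ` (S - U))"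
  have eq: "{V \<in> \<V>. x \<in> V} = {if x \<in> U then U else {x}}" if "x \<in> S" for x
    using that US by (auto simp: \<V>_def)
  have "refines_with_order (top_of_set S) 0 \<U> \<V>"
    unfolding refines_with_order_def
  proof (intro conjI ballI)
    fix V assume V: "V \<in> \<V>"
    then show "openin (top_of_set S) V" using op U iso by (auto simp: \<V>_def)
    show "\<exists>U\<in>\<U>. V \<subseteq> U" using V U cov by (auto simp: \<V>_def)
  qed (use eq in \<open>auto simp: \<V>_def\<close>)
  then show "\<exists>\<V>. refines_with_order (top_of_set S) 0 \<U> \<V>" ..
qed

section \<open>A complex without embedding\<close>

text \<open>The \<open>d\<close>-skeleton of a simplex with \<open>3 (d + 1)\<close> vertices, with barycentric coordinates normalised
  by their maximum instead of their sum, so that every point has an integer coordinate \<open>1\<close>.\<close>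

definition skeleton :: "nat \<Rightarrow> (nat \<Rightarrow> real) set" where
  "skeleton d = {y. (\<forall>i. 0 \<le> y i \<and> y i \<le> (if i < 3 * (d + 1) then 1 else 0)) \<and>
     card {i \<in> {..<3 * (d + 1)}. y i \<noteq> 0} \<le> d + 1 \<and> (\<exists>i<3 * (d + 1). y i = 1)}"

lemma closed_coord_eq: "closed {y :: nat \<Rightarrow> real. y i = c}"
  by (intro closed_Collect_eq continuous_on_product_coordinates continuous_on_const)

lemma compact_skeleton: "compact (skeleton d)"
proof -
  let ?K = "3 * (d + 1)"
  have "{y :: nat \<Rightarrow> real. card {i \<in> {..<?K}. y i \<noteq> 0} \<le> d + 1}
      = (\<Union>A\<in>{A\<in>Pow {..<?K}. card A \<le> d + 1}. \<Inter>i\<in>{..<?K} - A. {y. y i = 0})" (is "_ = ?R")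
  proof (intro subset_antisym subsetI)
    fix y assume "y \<in> ?R"
    then obtain A where A: "A \<subseteq> {..<?K}" "card A \<le> d + 1" "\<forall>i\<in>{..<?K} - A. y i = 0" by auto
    then have "card {i \<in> {..<?K}. y i \<noteq> 0} \<le> card A"
      by (intro card_mono) (auto intro: finite_subset)
    then show "y \<in> {y. card {i \<in> {..<?K}. y i \<noteq> 0} \<le> d + 1}" using A by simp
  next
    fix y :: "nat \<Rightarrow> real" assume "y \<in> {y. card {i \<in> {..<?K}. y i \<noteq> 0} \<le> d + 1}"
    then show "y \<in> ?R" by (intro UN_I[of "{i \<in> {..<?K}. y i \<noteq> 0}"]) auto
  qed
  moreover have "closed ?R"
    by (intro closed_UN closed_INT ballI closed_coord_eq) auto
  ultimately have 1: "closed {y :: nat \<Rightarrow> real. card {i \<in> {..<?K}. y i \<noteq> 0} \<le> d + 1}" by simp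
  have 2: "closed (\<Union>i<?K. {y :: nat \<Rightarrow> real. y i = 1})"
    by (intro closed_UN ballI closed_coord_eq) auto
  have "skeleton d = ({y. \<forall>i. 0 \<le> y i \<and> y i \<le> (if i < ?K then 1 else 0)}
      \<inter> {y. card {i \<in> {..<?K}. y i \<noteq> 0} \<le> d + 1}) \<inter> (\<Union>i<?K. {y. y i = 1})"
    unfolding skeleton_def by blast
  then show ?thesis using 1 2 compact_cube[of "\<lambda>_. 0"] by (simp add: compact_Int_closed)
qed

text \<open>This is the benefit of normalising by the maximum: one of the at most
  \<open>d + 1\<close> nonzero coordinates equals 1, which saves the one needed for the cubical
  bound.\<close>

lemma card_nonint_skeleton:
  assumes y: "y \<in> skeleton d"
  shows "card {i \<in> {..<3 * (d + 1)}. y i \<notin> \<int>} \<le> d"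
proof -
  let ?A = "{i \<in> {..<3 * (d + 1)}. y i \<noteq> 0}"
  obtain i0 where i0: "i0 < 3 * (d + 1)" "y i0 = 1" using y by (auto simp: skeleton_def)
  have "{i \<in> {..<3 * (d + 1)}. y i \<notin> \<int>} \<subseteq> ?A - {i0}" using i0 by auto
  then have "card {i \<in> {..<3 * (d + 1)}. y i \<notin> \<int>} \<le> card (?A - {i0})" by (rule card_mono[rotated]) simp
  also have "\<dots> = card ?A - 1" using i0 by (intro card_Diff_singleton) simp
  finally show ?thesis using y unfolding skeleton_def by auto
qed

text \<open>The plane maps to the cone over three points so that \<open>z\<close> and \<open>-z\<close> go to
  different legs: record by how much the largest of three linear forms with sum zero
  exceeds the other two.\<close>

definition excess :: "real \<Rightarrow> real \<Rightarrow> real \<Rightarrow> real" where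
  "excess a b c = max 0 (a - max b c)"

lemma excess_eq_0_iff: "excess a b c = 0 \<longleftrightarrow> a \<le> b \<or> a \<le> c"
  by (auto simp: excess_def max_def)

text \<open>Coordinates \<open>2 * k\<close> and \<open>2 * k + 1\<close> span a plane that feeds
  the vertices \<open>3 * k\<close> to \<open>3 * k + 2\<close>. With \<open>k \<le> d\<close> the
  source has dimension \<open>2 * d + 2\<close>, and its unit sphere the dimension
  \<open>2 * d + 1\<close>.\<close>

definition tripod :: "nat \<Rightarrow> (nat \<Rightarrow> real) \<Rightarrow> nat \<Rightarrow> real" where
  "tripod d x i = (let u = x (2 * (i div 3)); v = x (2 * (i div 3) + 1); w = - u - v in
     if i < 3 * (d + 1) then
       if i mod 3 = 0 then excess u v w else if i mod 3 = 1 then excess v u w else excess w u v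
     else 0)"

lemma tripod_nonneg: "tripod d x i \<ge> 0"
proof -
  have "excess a b c \<ge> 0" for a b c by (simp add: excess_def)
  then show ?thesis by (simp add: tripod_def Let_def)
qed

lemma continuous_on_tripod: "continuous_on S (\<lambda>x. tripod d x i)"
proof -
  have c: "continuous_on S (\<lambda>x :: nat \<Rightarrow> real. x j)" for j
    by (rule continuous_on_subset[OF continuous_on_product_coordinates]) simp
  have e: "continuous_on S (\<lambda>x. excess (f x) (g x) (h x))"
    if "continuous_on S f" "continuous_on S g" "continuous_on S h" for f g h :: "(nat \<Rightarrow> real) \<Rightarrow> real"
    unfolding excess_def by (intro continuous_intros continuous_on_max that)
  show ?thesis
    unfolding tripod_def Let_def
    by (cases "i < 3 * (d + 1)"; cases "i mod 3 = 0"; cases "i mod 3 = 1"; simp;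
        intro continuous_intros e c)
qed

text \<open>A form that strictly exceeds the other two at a point lies strictly below them at the
  antipode.\<close>

lemma tripod_disjoint: "tripod d x i = 0 \<or> tripod d (\<lambda>j. - x j) i = 0"
  by (auto simp: tripod_def Let_def excess_eq_0_iff)

text \<open>Two forms on the same plane cannot both be the strict maximum, so each of the
  \<open>d + 1\<close> planes contributes at most one vertex.\<close>

lemma card_tripod: "card {i \<in> {..<3 * (d + 1)}. tripod d x i \<noteq> 0} \<le> d + 1"
proof -
  let ?A = "{i \<in> {..<3 * (d + 1)}. tripod d x i \<noteq> 0}"
  define L where "L = (\<lambda>k r :: nat. if r = 0 then x (2 * k) else if r = 1 then x (2 * k + 1)
      else - x (2 * k) - x (2 * k + 1))"
  have L: "L (i div 3) r < L (i div 3) (i mod 3)"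
    if i: "tripod d x i \<noteq> 0" and r: "r \<in> {0, 1, 2}" "r \<noteq> i mod 3" for i r
  proof -
    define m where "m = i mod 3"
    have "m \<in> {0, 1, 2}" by (auto simp: m_def)
    then consider "m = 0" | "m = 1" | "m = 2" by blast
    then show ?thesis
      using i r unfolding m_def[symmetric]
      by cases (auto simp: tripod_def Let_def L_def excess_eq_0_iff not_le m_def[symmetric] split: if_split_asm)
  qed
  have "inj_on (\<lambda>i. i div 3) ?A"
  proof (rule inj_onI)
    fix i j assume ij: "i \<in> ?A" "j \<in> ?A" "i div 3 = j div 3"
    have "i mod 3 \<in> {0, 1, 2}" "j mod 3 \<in> {0, 1, 2}" by auto
    then have "i mod 3 = j mod 3"
      using L[of i "j mod 3"] L[of j "i mod 3"] ij by force
    moreover have "i = 3 * (i div 3) + i mod 3" by simp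
    moreover have "j = 3 * (j div 3) + j mod 3" by simp
    ultimately show "i = j" using ij(3) by argo
  qed
  moreover have "(\<lambda>i. i div 3) ` ?A \<subseteq> {..<d + 1}" by auto
  ultimately show ?thesis using card_inj_on_le[of _ ?A "{..<d + 1}"] by simp
qed

text \<open>On each plane the three forms have no strict maximum and, by the condition at the
  antipode, no strict minimum. Hence they are equal, and as their sum is zero they vanish.\<close>

lemma tripod_eq_0D:
  assumes z: "\<And>i. i < 3 * (d + 1) \<Longrightarrow> tripod d x i = 0 \<and> tripod d (\<lambda>j. - x j) i = 0"
    and j: "j < 2 * (d + 1)"
  shows "x j = 0"
proof -
  define k where "k = j div 2"
  have "k < d + 1" unfolding k_def using j by (simp add: less_mult_imp_div_less mult.commute)
  then have k: "3 * k + 2 < 3 * (d + 1)" by simp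
  have div: "(3 * k) div 3 = k" "(3 * k + 1) div 3 = k" "(3 * k + 2) div 3 = k"
    "(3 * k) mod 3 = 0" "(3 * k + 1) mod 3 = 1" "(3 * k + 2) mod 3 = 2" by presburger+
  define u v where "u = x (2 * k)" and "v = x (2 * k + 1)"
  have "(u \<le> v \<or> u \<le> - u - v) \<and> (- u \<le> - v \<or> - u \<le> u + v)"
    using z[of "3 * k"] k div(1,4)
    by (simp add: tripod_def Let_def u_def v_def excess_eq_0_iff add.commute del: One_nat_def)
  moreover have "(v \<le> u \<or> v \<le> - u - v) \<and> (- v \<le> - u \<or> - v \<le> u + v)"
    using z[of "3 * k + 1"] k div(2,5)
    by (simp add: tripod_def Let_def u_def v_def excess_eq_0_iff add.commute del: One_nat_def)
  moreover have "(- u - v \<le> u \<or> - u - v \<le> v) \<and> (u + v \<le> - u \<or> u + v \<le> - v)"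
    using z[of "3 * k + 2"] k div(3,6)
    by (simp add: tripod_def Let_def u_def v_def excess_eq_0_iff add.commute del: One_nat_def)
  ultimately have "u = 0" "v = 0"
    by (elim conjE disjE; linarith)+
  then have "x (2 * k) = 0 \<and> x (2 * k + 1) = 0" by (simp add: u_def v_def)
  moreover have "j = 2 * k \<or> j = 2 * k + 1" unfolding k_def by presburger
  ultimately show ?thesis by auto
qed

section \<open>Flores' theorem and the lower bound for the dimension\<close>

lemma continuous_on_mult_bounded:
  fixes \<tau> g :: "'a::topological_space \<Rightarrow> real"
  assumes \<tau>: "continuous_on S \<tau>" and bd: "\<And>x. x \<in> S \<Longrightarrow> \<tau> x \<noteq> 0 \<Longrightarrow> \<bar>g x\<bar> \<le> B"
    and g: "continuous_on {x\<in>S. \<tau> x \<noteq> 0} g"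
  shows "continuous_on S (\<lambda>x. \<tau> x * g x)"
  unfolding continuous_on_def
proof
  fix x assume x: "x \<in> S"
  have \<tau>x: "(\<tau> \<longlongrightarrow> \<tau> x) (at x within S)" using \<tau> x by (simp add: continuous_on_def)
  show "((\<lambda>x. \<tau> x * g x) \<longlongrightarrow> \<tau> x * g x) (at x within S)"
  proof (cases "\<tau> x = 0")
    case True
    have "((\<lambda>y. \<bar>\<tau> y\<bar> * \<bar>B\<bar>) \<longlongrightarrow> 0) (at x within S)"
      using tendsto_mult_right[OF tendsto_rabs[OF \<tau>x], of "\<bar>B\<bar>"] True by simp
    moreover have "norm (\<tau> y * g y) \<le> \<bar>\<tau> y\<bar> * \<bar>B\<bar>" if "y \<in> S" for y
    proof (cases "\<tau> y = 0")
      case False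
      then have "\<bar>g y\<bar> \<le> \<bar>B\<bar>" using bd[OF that] by linarith
      then show ?thesis by (simp add: abs_mult mult_left_mono)
    qed simp
    then have "eventually (\<lambda>y. norm (\<tau> y * g y) \<le> \<bar>\<tau> y\<bar> * \<bar>B\<bar>) (at x within S)"
      unfolding eventually_at_topological by (intro exI[of _ UNIV]) auto
    ultimately show ?thesis using True by (simp add: Lim_null_comparison)
  next
    case False
    obtain A where A: "open A" "A \<inter> S = \<tau> -` (- {0}) \<inter> S"
      using \<tau>[unfolded continuous_on_open_invariant, rule_format, of "- {0}"] by (auto simp: open_closed)
    then have eq: "at x within S = at x within {x\<in>S. \<tau> x \<noteq> 0}"
      using x False by (intro at_within_nhd[of x A]) auto
    show ?thesis
      unfolding eq using g x False \<tau>x[unfolded eq] by (intro tendsto_mult) (auto simp: continuous_on_def)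
  qed
qed

theorem Flores:
  fixes f :: "nat \<Rightarrow> (nat \<Rightarrow> real) \<Rightarrow> real"
  assumes f: "\<And>k. k < 2 * d \<Longrightarrow> continuous_on (skeleton d) (f k)"
  shows "\<exists>x\<in>skeleton d. \<exists>y\<in>skeleton d. (\<forall>i. x i = 0 \<or> y i = 0) \<and> (\<forall>k<2 * d. f k x = f k y)"
proof -
  define \<tau> where "\<tau> = (\<lambda>x. max_coord (3 * d + 2) (tripod d x))"
  define U where "U = (\<lambda>x i. tripod d x i / \<tau> x)"
  have K: "3 * (d + 1) = Suc (3 * d + 2)" by simp
  have \<tau>0: "\<tau> x \<ge> 0" for x unfolding \<tau>_def by (rule max_coord_nonneg)
  have U: "U x \<in> skeleton d" if "\<tau> x \<noteq> 0" for x
  proof -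
    have pos: "\<tau> x > 0" using \<tau>0[of x] that by simp
    have le: "tripod d x i \<le> \<tau> x" if "i < 3 * (d + 1)" for i
      using max_coord_ge[of i "3 * d + 2" "tripod d x"] that by (simp add: \<tau>_def)
    obtain i0 where i0: "i0 \<le> 3 * d + 2" "\<bar>tripod d x i0\<bar> = \<tau> x"
      using max_coord_attained unfolding \<tau>_def by blast
    then have "U x i0 = 1" using pos tripod_nonneg[of d x i0] by (simp add: U_def)
    moreover have "{i \<in> {..<3 * (d + 1)}. U x i \<noteq> 0} = {i \<in> {..<3 * (d + 1)}. tripod d x i \<noteq> 0}"
      using pos by (auto simp: U_def)
    moreover have "0 \<le> U x i \<and> U x i \<le> (if i < 3 * (d + 1) then 1 else 0)" for i
      using pos le[of i] tripod_nonneg[of d x i] by (simp add: U_def) (simp add: tripod_def)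
    ultimately show ?thesis
      using card_tripod[of d x] i0(1) unfolding skeleton_def by auto
  qed
  have c\<tau>: "continuous_on A \<tau>" for A
    unfolding \<tau>_def by (rule continuous_on_max_coord) (rule continuous_on_tripod)
  have cU: "continuous_on {x \<in> UNIV. \<tau> x \<noteq> 0} U"
    unfolding U_def
    by (intro continuous_on_coordinatewise_then_product continuous_on_divide c\<tau> continuous_on_tripod) auto
  \<comment> \<open>The cone over \<open>f k\<close>: the point \<open>U x\<close> lies in the
    skeleton where the height \<open>\<tau> x\<close> is nonzero, and multiplication by the height
    extends the composition continuously by 0.\<close>
  define G where "G = (\<lambda>k x. \<tau> x * f k (U x))"
  have cG: "continuous_on UNIV (G k)" if k: "k < 2 * d" for k
  proof -
    have "bounded (f k ` skeleton d)"
      by (intro compact_imp_bounded compact_continuous_image f k compact_skeleton)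
    then obtain B where B: "\<And>y. y \<in> skeleton d \<Longrightarrow> \<bar>f k y\<bar> \<le> B"
      by (auto simp: bounded_iff)
    show ?thesis
      unfolding G_def
    proof (rule continuous_on_mult_bounded)
      show "continuous_on {x \<in> UNIV. \<tau> x \<noteq> 0} (\<lambda>x. f k (U x))"
        by (rule continuous_on_compose2[OF f[OF k] cU]) (use U in auto)
    qed (use c\<tau> B U in auto)
  qed
  \<comment> \<open>The \<open>2 * d\<close> differences of \<open>G\<close> and one difference of
    heights make \<open>2 * d + 1\<close> odd functions. At a common zero the two heights agree, so
    they cancel from the equations for \<open>f\<close> once they are known to be nonzero.\<close>
  define h where "h = (\<lambda>x i. if i < 2 * d then G i x - G i (\<lambda>j. - x j) else \<tau> x - \<tau> (\<lambda>j. - x j))"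
  have neg: "continuous_on A (\<lambda>x :: nat \<Rightarrow> real. \<lambda>j. - x j)" for A
    by (intro continuous_on_coordinatewise_then_product continuous_on_minus
        continuous_on_subset[OF continuous_on_product_coordinates]) simp
  have "\<exists>x\<in>topspace (nsphere (2 * d + 1)). \<forall>i<2 * d + 1. h x i = 0"
  proof (rule Borsuk_Ulam)
    fix i
    have "continuous_on A (\<lambda>x. G i x - G i (\<lambda>j. - x j))" if "i < 2 * d" for A
      by (intro continuous_on_diff continuous_on_subset[OF cG[OF that]]
          continuous_on_compose2[OF cG[OF that] neg]) auto
    moreover have "continuous_on A (\<lambda>x. \<tau> x - \<tau> (\<lambda>j. - x j))" for A
      by (intro continuous_on_diff c\<tau> continuous_on_compose2[OF c\<tau>[of UNIV] neg]) auto
    ultimately show "continuous_on (topspace (nsphere (2 * d + 1))) (\<lambda>x. h x i)"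
      by (cases "i < 2 * d") (simp_all add: h_def)
  qed (auto simp: h_def)
  then obtain x where x: "x \<in> topspace (nsphere (2 * d + 1))" and h0: "\<And>i. i < 2 * d + 1 \<Longrightarrow> h x i = 0"
    by blast
  have eq: "\<tau> x = \<tau> (\<lambda>j. - x j)" using h0[of "2 * d"] by (simp add: h_def)
  have ne: "\<tau> x \<noteq> 0"
  proof
    assume z: "\<tau> x = 0"
    have z0: "tripod d v i = 0" if "\<tau> v = 0" "i < 3 * (d + 1)" for v i
      using max_coord_ge[of i "3 * d + 2" "tripod d v"] that by (simp add: \<tau>_def)
    have "x j = 0" if "j < 2 * (d + 1)" for j
      using z0 z eq by (intro tripod_eq_0D[OF _ that]) simp
    then show False using nsphere_nonzero[OF x] by auto
  qed
  show ?thesis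
  proof (rule bexI[of _ "U x"], rule bexI[of _ "U (\<lambda>j. - x j)"], intro conjI allI impI)
    fix i
    show "U x i = 0 \<or> U (\<lambda>j. - x j) i = 0"
      using tripod_disjoint[of d x i] by (auto simp: U_def)
  next
    fix k assume "k < 2 * d"
    then show "f k (U x) = f k (U (\<lambda>j. - x j))"
      using h0[of k] ne eq by (simp add: h_def G_def)
  qed (use U ne eq in auto)
qed

text \<open>Two points of the skeleton with disjoint supports differ by 1 in some coordinate, so no
  box of half-width 1/2 contains both images. A refinement of too small an order would provide
  \<open>2 * d\<close> functions contradicting Flores' theorem. The shift \<open>Suc i\<close>
  leaves coordinate 0 free to label copies of the skeleton.\<close>

lemma not_covering_dim_le_if_skeleton:
  fixes S :: "(nat \<Rightarrow> real) set"
  assumes S: "compact S" and e: "continuous_on (skeleton d) e" "e ` skeleton d \<subseteq> S"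
    and e_Suc: "\<And>y i. y \<in> skeleton d \<Longrightarrow> e y (Suc i) = y i" and d: "d \<ge> 1"
  shows "\<not> covering_dim_le (top_of_set S) (int d - 1)"
proof
  assume dim: "covering_dim_le (top_of_set S) (int d - 1)"
  define N where "N = (\<lambda>w. S \<inter> (\<Inter>i<3 * (d + 1). {z. \<bar>z (Suc i) - w (Suc i)\<bar> < 1/2}))"
  have opN: "openin (top_of_set S) (N w)" for w
    unfolding N_def
    by (intro openin_open_Int open_INT ballI open_Collect_less continuous_intros
        continuous_on_product_coordinates) auto
  obtain g :: "nat \<Rightarrow> (nat \<Rightarrow> real) \<Rightarrow> real" where g: "\<And>k. continuous_on S (g k)"
    and sep: "\<And>x y. x \<in> S \<Longrightarrow> y \<in> S \<Longrightarrow> (\<And>k. k < 2 * (d - 1) + 2 \<Longrightarrow> g k x = g k y) \<Longrightarrow>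
      \<exists>U\<in>N ` S. x \<in> U \<and> y \<in> U"
  proof (rule covering_dim_le_separating_maps[OF S, of "d - 1" "N ` S"])
    show "covering_dim_le (top_of_set S) (int (d - 1))" using dim d by (simp add: of_nat_diff)
    show "S \<subseteq> \<Union>(N ` S)" by (auto simp: N_def)
  qed (use opN in auto)
  obtain x y where xy: "x \<in> skeleton d" "y \<in> skeleton d" "\<And>i. x i = 0 \<or> y i = 0"
    and eq: "\<And>k. k < 2 * d \<Longrightarrow> g k (e x) = g k (e y)"
    using Flores[of d "\<lambda>k x. g k (e x)"] continuous_on_compose2[OF g e] by blast
  have "e x \<in> S" "e y \<in> S" using e(2) xy by auto
  then obtain w where w: "e x \<in> N w" "e y \<in> N w"
    using sep[of "e x" "e y"] eq d by auto
  obtain i where i: "i < 3 * (d + 1)" "x i = 1" using xy(1) by (auto simp: skeleton_def)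
  then have "y i = 0" using xy(3)[of i] by simp
  moreover have "\<bar>x i - w (Suc i)\<bar> < 1/2" "\<bar>y i - w (Suc i)\<bar> < 1/2"
    using w i(1) e_Suc xy(1,2) by (auto simp: N_def)
  ultimately show False using i by linarith
qed

lemma covering_dim_eqI:
  assumes "covering_dim_le T d" "\<not> covering_dim_le T (d - 1)" "d \<ge> 0"
  shows "covering_dim T = ereal (real_of_int d)"
  unfolding covering_dim_def
proof (rule antisym)
  show "Inf {ereal (real_of_int n) | n. n \<ge> -1 \<and> covering_dim_le T n} \<le> ereal (real_of_int d)"
    using assms by (intro Inf_lower) auto
  show "ereal (real_of_int d) \<le> Inf {ereal (real_of_int n) | n. n \<ge> -1 \<and> covering_dim_le T n}"
  proof (rule Inf_greatest)
    fix a assume "a \<in> {ereal (real_of_int n) | n. n \<ge> -1 \<and> covering_dim_le T n}"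
    then obtain n where n: "a = ereal (real_of_int n)" "covering_dim_le T n" by blast
    then have "\<not> n \<le> d - 1" using covering_dim_le_mono assms(2) by blast
    then show "ereal (real_of_int d) \<le> a" using n by simp
  qed
qed

section \<open>Transport of systems into the space of real sequences\<close>

lemma metric_dist_subset:
  fixes S :: "'a::metric_space set"
  shows "mspace (metric (S, dist)) = S" "mtopology_of (metric (S, dist)) = top_of_set S"
proof -
  interpret S: Submetric UNIV "dist :: 'a \<Rightarrow> 'a \<Rightarrow> real" S
    by (simp add: Submetric.intro Submetric_axioms.intro Met_TC.Metric_space_axioms)
  show "mspace (metric (S, dist)) = S" by (simp add: S.sub.Metric_space_axioms)
  show "mtopology_of (metric (S, dist)) = top_of_set S"
    by (simp add: mtopology_of_def S.sub.Metric_space_axioms S.mtopology_submetric)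
qed

text \<open>The group is discrete, so joint continuity reduces to continuity of each
  \<open>\<phi> g\<close>.\<close>

lemma tds_metric_dist:
  fixes S :: "'a::metric_space set"
  assumes act: "group_action G S \<phi>" and S: "compact S"
    and cont: "\<And>g. g \<in> carrier G \<Longrightarrow> continuous_on S (\<phi> g)"
  shows "tds G (metric (S, dist)) \<phi>"
  unfolding tds_def metric_dist_subset
proof (intro conjI act)
  show "compact_space (top_of_set S)" using S by (simp add: compact_space_subtopology)
  have im: "\<phi> g \<in> S \<rightarrow> S" if "g \<in> carrier G" for g
    using group_action.surj_prop[OF act that] by auto
  have cm: "continuous_map (top_of_set S) (top_of_set S) (\<phi> g)" if "g \<in> carrier G" for g
    using cont[OF that] im[OF that] by (auto simp: continuous_map_in_subtopology)
  let ?P = "prod_topology (discrete_topology (carrier G)) (top_of_set S)"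
  show "continuous_map ?P (top_of_set S) (\<lambda>(g, x). \<phi> g x)"
    unfolding continuous_map_def
  proof (intro conjI allI impI)
    show "(\<lambda>(g, x). \<phi> g x) \<in> topspace ?P \<rightarrow> topspace (top_of_set S)" using im by auto
    fix U assume U: "openin (top_of_set S) U"
    have eq: "{p \<in> topspace ?P. (case p of (g, x) \<Rightarrow> \<phi> g x) \<in> U}
        = (\<Union>g\<in>carrier G. {g} \<times> {x \<in> topspace (top_of_set S). \<phi> g x \<in> U})" by auto
    have "openin ?P ({g} \<times> {x \<in> topspace (top_of_set S). \<phi> g x \<in> U})" if "g \<in> carrier G" for g
      unfolding openin_prod_Times_iff
      using that openin_continuous_map_preimage[OF cm[OF that] U] by simp
    then show "openin ?P {p \<in> topspace ?P. (case p of (g, x) \<Rightarrow> \<phi> g x) \<in> U}"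
      unfolding eq by (intro openin_Union) auto
  qed
qed

lemma group_action_transport:
  assumes G: "group G" and inj: "inj_on \<iota> \<Omega>"
    and closed: "\<And>g \<omega>. g \<in> carrier G \<Longrightarrow> \<omega> \<in> \<Omega> \<Longrightarrow> act g \<omega> \<in> \<Omega>"
    and one: "\<And>\<omega>. \<omega> \<in> \<Omega> \<Longrightarrow> act \<one>\<^bsub>G\<^esub> \<omega> = \<omega>"
    and mult: "\<And>g h \<omega>. g \<in> carrier G \<Longrightarrow> h \<in> carrier G \<Longrightarrow> \<omega> \<in> \<Omega> \<Longrightarrow>
      act (g \<otimes>\<^bsub>G\<^esub> h) \<omega> = act g (act h \<omega>)"
  shows "group_action G (\<iota> ` \<Omega>) (\<lambda>g. \<lambda>x\<in>\<iota> ` \<Omega>. \<iota> (act g (inv_into \<Omega> \<iota> x)))"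
proof -
  interpret group G by (rule G)
  define \<phi> where "\<phi> = (\<lambda>g. \<lambda>x\<in>\<iota> ` \<Omega>. \<iota> (act g (inv_into \<Omega> \<iota> x)))"
  let ?S = "\<iota> ` \<Omega>"
  have \<phi>: "\<phi> g (\<iota> \<omega>) = \<iota> (act g \<omega>)" if "\<omega> \<in> \<Omega>" for g \<omega>
    using that inj by (simp add: \<phi>_def)
  have \<phi>S: "\<phi> g x \<in> ?S" if "g \<in> carrier G" "x \<in> ?S" for g x
    using that closed by (auto simp: \<phi>)
  have comp: "\<phi> (g \<otimes>\<^bsub>G\<^esub> h) x = \<phi> g (\<phi> h x)" if "g \<in> carrier G" "h \<in> carrier G" "x \<in> ?S" for g h x
    using that closed mult by (auto simp: \<phi>)
  have id: "\<phi> \<one>\<^bsub>G\<^esub> x = x" if "x \<in> ?S" for x using that one by (auto simp: \<phi>)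
  have "bij_betw (\<phi> g) ?S ?S" if "g \<in> carrier G" for g
    by (rule bij_betw_byWitness[where f' = "\<phi> (inv\<^bsub>G\<^esub> g)"])
      (use that \<phi>S id in \<open>auto simp flip: comp\<close>)
  then have Bij: "\<phi> g \<in> Bij ?S" if "g \<in> carrier G" for g
    using that by (auto simp: Bij_def \<phi>_def)
  have "\<phi> \<in> hom G (BijGroup ?S)"
  proof (rule homI)
    show "\<phi> g \<in> carrier (BijGroup ?S)" if "g \<in> carrier G" for g
      using Bij[OF that] by (simp add: BijGroup_def)
    fix g h assume gh: "g \<in> carrier G" "h \<in> carrier G"
    have "\<phi> (g \<otimes>\<^bsub>G\<^esub> h) x = compose ?S (\<phi> g) (\<phi> h) x" for x
    proof (cases "x \<in> ?S")
      case False
      then show ?thesis by (simp only: compose_def \<phi>_def restrict_def if_False)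
    qed (simp add: compose_def comp gh)
    then show "\<phi> (g \<otimes>\<^bsub>G\<^esub> h) = \<phi> g \<otimes>\<^bsub>BijGroup ?S\<^esub> \<phi> h"
      using gh Bij by (auto simp: BijGroup_def)
  qed
  then show ?thesis
    unfolding \<phi>_def[symmetric] group_action_def group_hom_def group_hom_axioms_def
    using G group_BijGroup by blast
qed

text \<open>Subsets of \<open>L\<close> avoiding \<open>p\<close> are open. By compactness the open
  sets containing \<open>p\<close> have finite complement in \<open>L\<close>, and an injective map
  pulls finite sets back to finite sets.\<close>

lemma continuous_on_one_accumulation_point:
  fixes L :: "'a::metric_space set"
  assumes L: "compact L" and iso: "\<And>x. x \<in> L \<Longrightarrow> x \<noteq> p \<Longrightarrow> openin (top_of_set L) {x}"
    and inj: "inj_on f L" and im: "f ` L \<subseteq> L" and fp: "f p = p"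
  shows "continuous_on L f"
proof -
  have opn: "openin (top_of_set L) A" if "A \<subseteq> L" "p \<notin> A" for A
  proof -
    have "openin (top_of_set L) (\<Union>x\<in>A. {x})" using that iso by (intro openin_Union) auto
    then show ?thesis by simp
  qed
  have fin: "finite (L - U)" if U: "openin (top_of_set L) U" "p \<in> U" for U
  proof -
    let ?\<C> = "insert U ((\<lambda>x. {x}) ` (L - U))"
    have "\<forall>C\<in>?\<C>. openin (top_of_set L) C" using U opn by auto
    moreover have "compact_space (top_of_set L)" using L by (simp add: compact_space_subtopology)
    moreover have "topspace (top_of_set L) \<subseteq> \<Union>?\<C>" by auto
    ultimately obtain \<F> where F: "finite \<F>" "\<F> \<subseteq> ?\<C>" "L \<subseteq> \<Union>\<F>"
      unfolding compact_space_alt by (metis topspace_euclidean_subtopology)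
    have "L - U \<subseteq> \<Union>(\<F> - {U})" using F(3) by blast
    moreover have "finite (\<Union>(\<F> - {U}))" using F(1,2) by auto
    ultimately show ?thesis by (rule finite_subset)
  qed
  have "openin (top_of_set L) (L \<inter> f -` U)" if U: "openin (top_of_set L) U" for U
  proof (cases "p \<in> L \<inter> f -` U")
    case False
    then show ?thesis using fp opn[of "L \<inter> f -` U"] by blast
  next
    case True
    then have "finite (L - U)" using fp fin[OF U] by simp
    have "finite (L - L \<inter> f -` U)"
    proof (rule finite_imageD)
      show "finite (f ` (L - L \<inter> f -` U))" using im by (intro finite_subset[OF _ \<open>finite (L - U)\<close>]) auto
      show "inj_on f (L - L \<inter> f -` U)" using inj by (rule inj_on_subset) auto
    qed
    then have "openin (top_of_set L) (L \<inter> - (L - L \<inter> f -` U))"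
      by (intro openin_open_Int open_Compl finite_imp_closed)
    moreover have "L \<inter> - (L - L \<inter> f -` U) = L \<inter> f -` U" by auto
    ultimately show ?thesis by simp
  qed
  then show ?thesis using im continuous_on_open_gen[of f L L] by blast
qed

text \<open>The union of finite nets for the radii \<open>1 / (n + 1)\<close> is enumerated.
  Membership of \<open>q n\<close> stands under the quantifier because for an empty space the values
  of \<open>q\<close> are arbitrary.\<close>

lemma compact_metric_dense_sequence:
  assumes Y: "compact_space (mtopology_of Y)"
  shows "\<exists>q :: nat \<Rightarrow> 'y. \<forall>y\<in>mspace Y. \<forall>e>0. \<exists>n. q n \<in> mspace Y \<and> mdist Y (q n) y < e"
proof -
  interpret Metric_space "mspace Y" "mdist Y" by simp
  have "mtotally_bounded (mspace Y)"
    using Y by (intro compactin_imp_mtotally_bounded) (simp add: mtopology_of_def compact_space_def)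
  then have "\<exists>K. finite K \<and> K \<subseteq> mspace Y \<and> mspace Y \<subseteq> (\<Union>x\<in>K. mball x (1 / (real n + 1)))" for n
    unfolding mtotally_bounded_def by (simp add: add_pos_nonneg)
  then obtain K where K: "\<And>n. finite (K n)" "\<And>n. K n \<subseteq> mspace Y"
    "\<And>n. mspace Y \<subseteq> (\<Union>x\<in>K n. mball x (1 / (real n + 1)))" by metis
  define Q where "Q = (\<Union>n. K n)"
  have cQ: "countable Q" unfolding Q_def using K(1) by (simp add: countable_finite)
  have "\<exists>n. from_nat_into Q n \<in> mspace Y \<and> mdist Y (from_nat_into Q n) y < e"
    if y: "y \<in> mspace Y" and e: "e > 0" for y e
  proof -
    obtain n where n: "1 / (real n + 1) < e"
      using reals_Archimedean[OF e] by (auto simp: inverse_eq_divide add.commute)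
    obtain x where x: "x \<in> K n" "y \<in> mball x (1 / (real n + 1))" using K(3)[of n] y by auto
    then have "x \<in> Q" "mdist Y x y < e" "x \<in> mspace Y" using n K(2) by (auto simp: Q_def)
    then show ?thesis using from_nat_into_to_nat_on[OF cQ] by metis
  qed
  then show ?thesis by (intro exI[of _ "from_nat_into Q"]) blast
qed

section \<open>Points with small orbits in the given system\<close>

lemma continuous_map_tds:
  assumes "tds G Y \<psi>" "g \<in> carrier G"
  shows "continuous_map (mtopology_of Y) (mtopology_of Y) (\<psi> g)"
proof -
  have "continuous_map (mtopology_of Y) (mtopology_of Y) ((\<lambda>(g, x). \<psi> g x) \<circ> (\<lambda>x. (g, x)))"
    using assms by (intro continuous_map_compose[of _ "prod_topology (discrete_topology (carrier G)) (mtopology_of Y)"])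
      (auto simp: tds_def continuous_map_pairwise o_def)
  then show ?thesis by (simp add: o_def)
qed

text \<open>A point outside has \<open>N + 1\<close> distinct translates, and these stay distinct nearby.\<close>

lemma closedin_small_orbit_points:
  assumes Y: "tds G Y \<psi>"
  shows "closedin (mtopology_of Y) (small_orbit_points G Y \<psi> N)"
proof -
  let ?F = "small_orbit_points G Y \<psi> N"
  have sub: "?F \<subseteq> mspace Y" by (auto simp: small_orbit_points_def)
  have "openin (mtopology_of Y) (mspace Y - ?F)"
  proof (subst openin_subopen, intro ballI)
    fix y assume "y \<in> mspace Y - ?F"
    then have y: "y \<in> mspace Y" and big: "\<not> (finite (orbit G \<psi> y) \<and> card (orbit G \<psi> y) \<le> N)"
      by (auto simp: small_orbit_points_def)
    obtain B where B: "B \<subseteq> orbit G \<psi> y" "finite B" "card B = Suc N"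
    proof (cases "finite (orbit G \<psi> y)")
      case True
      then have "Suc N \<le> card (orbit G \<psi> y)" using big by simp
      then show ?thesis using that obtain_subset_with_card_n by metis
    next
      case False
      then show ?thesis using that infinite_arbitrarily_large by metis
    qed
    have "\<forall>b\<in>B. \<exists>g. g \<in> carrier G \<and> b = \<psi> g y" using B(1) by (auto simp: orbit_def)
    then obtain \<gamma> where \<gamma>: "\<And>b. b \<in> B \<Longrightarrow> \<gamma> b \<in> carrier G \<and> b = \<psi> (\<gamma> b) y" by metis
    define T where "T = (\<Inter>p\<in>{p\<in>B \<times> B. fst p \<noteq> snd p}.
        {z \<in> mspace Y. \<psi> (\<gamma> (fst p)) z \<noteq> \<psi> (\<gamma> (snd p)) z}) \<inter> mspace Y"
    have op2: "openin (mtopology_of Y) {z \<in> mspace Y. \<psi> g z \<noteq> \<psi> h z}"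
      if "g \<in> carrier G" "h \<in> carrier G" for g h
    proof -
      have "Hausdorff_space (mtopology_of Y)"
        by (simp add: mtopology_of_def Metric_space.Hausdorff_space_mtopology)
      then have "closedin (mtopology_of Y) {z \<in> mspace Y. \<psi> g z = \<psi> h z}"
        using closedin_continuous_maps_eq[OF _ continuous_map_tds[OF Y that(1)] continuous_map_tds[OF Y that(2)]]
        by simp
      moreover have "{z \<in> mspace Y. \<psi> g z \<noteq> \<psi> h z} = mspace Y - {z \<in> mspace Y. \<psi> g z = \<psi> h z}" by auto
      ultimately show ?thesis by (simp add: closedin_def)
    qed
    have "openin (mtopology_of Y) T"
    proof (cases "{p\<in>B \<times> B. fst p \<noteq> snd p} = {}")
      case True
      show ?thesis unfolding T_def True using openin_topspace[of "mtopology_of Y"] by simp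
    next
      case False
      then show ?thesis
        unfolding T_def using B(2) \<gamma> op2 openin_topspace[of "mtopology_of Y"]
        by (intro openin_Int openin_INT2) auto
    qed
    moreover have "y \<in> T" using y \<gamma> by (auto simp: T_def)
    moreover have "T \<subseteq> mspace Y - ?F"
    proof
      fix z assume z: "z \<in> T"
      have "inj_on (\<lambda>b. \<psi> (\<gamma> b) z) B"
        using z by (auto simp: inj_on_def T_def)
      then have "card ((\<lambda>b. \<psi> (\<gamma> b) z) ` B) = Suc N" using B(3) by (simp add: card_image)
      moreover have "(\<lambda>b. \<psi> (\<gamma> b) z) ` B \<subseteq> orbit G \<psi> z" using \<gamma> by (auto simp: orbit_def)
      ultimately have "\<not> (finite (orbit G \<psi> z) \<and> card (orbit G \<psi> z) \<le> N)"
        using card_mono by (metis not_less_eq_eq)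
      then show "z \<in> mspace Y - ?F" using z by (auto simp: T_def small_orbit_points_def)
    qed
    ultimately show "\<exists>T. openin (mtopology_of Y) T \<and> y \<in> T \<and> T \<subseteq> mspace Y - ?F" by blast
  qed
  then show ?thesis using sub by (simp add: closedin_def)
qed

lemma small_orbit_points_invariant:
  assumes Y: "tds G Y \<psi>" and G: "group G" and g: "g \<in> carrier G" and y: "y \<in> small_orbit_points G Y \<psi> N"
  shows "\<psi> g y \<in> small_orbit_points G Y \<psi> N"
proof -
  have act: "group_action G (mspace Y) \<psi>" using Y by (simp add: tds_def)
  have ym: "y \<in> mspace Y" using y by (simp add: small_orbit_points_def)
  have "orbit G \<psi> (\<psi> g y) \<subseteq> orbit G \<psi> y"
  proof
    fix z assume "z \<in> orbit G \<psi> (\<psi> g y)"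
    then obtain h where h: "h \<in> carrier G" "z = \<psi> h (\<psi> g y)" by (auto simp: orbit_def)
    then have "z = \<psi> (h \<otimes>\<^bsub>G\<^esub> g) y" using group_action.composition_rule[OF act ym h(1) g] by simp
    then show "z \<in> orbit G \<psi> y"
      using h g group.is_monoid[OF G] by (auto simp: orbit_def intro: monoid.m_closed)
  qed
  moreover have "\<psi> g y \<in> mspace Y" using group_action.element_image[OF act g ym] by simp
  ultimately show ?thesis
    using y unfolding small_orbit_points_def by (auto intro: finite_subset dest: card_mono order.trans)
qed

text \<open>One point chosen in each ball about \<open>q n\<close> of radius
  \<open>1 / (k + 1)\<close> that meets the set gives a countable dense subset. Adding the orbits
  keeps it countable because they are finite. An element that moves a point moves all points near
  it, hence a chosen one.\<close>

lemma exists_countable_detecting_set: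
  fixes q :: "nat \<Rightarrow> 'y"
  assumes Y: "tds G Y \<psi>" and G: "group G"
    and q: "\<And>y e. y \<in> mspace Y \<Longrightarrow> e > 0 \<Longrightarrow> \<exists>n. q n \<in> mspace Y \<and> mdist Y (q n) y < e"
  shows "\<exists>D \<subseteq> small_orbit_points G Y \<psi> N. countable D \<and> (\<forall>g\<in>carrier G. \<forall>y\<in>D. \<psi> g y \<in> D) \<and>
    (\<forall>g\<in>carrier G. (\<forall>y\<in>D. \<psi> g y = y) \<longrightarrow> (\<forall>y\<in>small_orbit_points G Y \<psi> N. \<psi> g y = y))"
proof -
  interpret Metric_space "mspace Y" "mdist Y" by simp
  have act: "group_action G (mspace Y) \<psi>" using Y by (simp add: tds_def)
  have mt: "mtopology_of Y = mtopology" by (simp add: mtopology_of_def)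
  let ?F = "small_orbit_points G Y \<psi> N"
  have FY: "?F \<subseteq> mspace Y" by (auto simp: small_orbit_points_def)
  define P where "P = (\<lambda>(n, k). {p \<in> ?F. q n \<in> mspace Y \<and> mdist Y (q n) p < 1 / (real k + 1)})"
  define I where "I = {i. P i \<noteq> {}}"
  define p where "p = (\<lambda>i. SOME x. x \<in> P i)"
  have p: "p i \<in> P i" if "i \<in> I" for i
    using that unfolding I_def p_def by (simp add: some_in_eq)
  have pF: "p i \<in> ?F" if "i \<in> I" for i
    using p[OF that] by (auto simp: P_def split: prod.splits)
  define D where "D = (\<Union>i\<in>I. orbit G \<psi> (p i))"
  have "D \<subseteq> ?F"
    using pF small_orbit_points_invariant[OF Y G] by (fastforce simp: D_def orbit_def)
  moreover have "countable D"
    unfolding D_def using pF by (intro countable_UN) (auto simp: small_orbit_points_def countable_finite)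
  moreover have "\<psi> g y \<in> D" if g: "g \<in> carrier G" and y: "y \<in> D" for g y
  proof -
    obtain i h where i: "i \<in> I" "h \<in> carrier G" "y = \<psi> h (p i)" using y by (auto simp: D_def orbit_def)
    have "\<psi> g y = \<psi> (g \<otimes>\<^bsub>G\<^esub> h) (p i)"
      using group_action.composition_rule[OF act _ g i(2)] pF[OF i(1)] FY i(3) by auto
    moreover have "g \<otimes>\<^bsub>G\<^esub> h \<in> carrier G" using G g i(2) by (simp add: group.is_monoid monoid.m_closed)
    ultimately show ?thesis using i(1) by (auto simp: D_def orbit_def)
  qed
  moreover have "\<psi> g y = y" if g: "g \<in> carrier G" and fix_D: "\<forall>y\<in>D. \<psi> g y = y" and y: "y \<in> ?F" for g y
  proof (rule ccontr)
    assume ne: "\<psi> g y \<noteq> y"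
    have "closedin mtopology {z \<in> topspace mtopology. \<psi> g z = z}"
      using closedin_continuous_maps_eq[OF Hausdorff_space_mtopology continuous_map_tds[OF Y g, unfolded mt] continuous_map_id]
      by simp
    then have "openin mtopology (mspace Y - {z \<in> mspace Y. \<psi> g z = z})"
      by (simp add: closedin_def)
    then obtain e where e: "e > 0" "mball y e \<subseteq> mspace Y - {z \<in> mspace Y. \<psi> g z = z}"
      using y FY ne unfolding openin_mtopology by blast
    have "e / 2 > 0" using e by simp
    then obtain k where k: "inverse (real (Suc k)) < e / 2" using reals_Archimedean by blast
    define r where "r = 1 / (real k + 1)"
    have r: "r > 0" "2 * r < e" using k by (auto simp: r_def inverse_eq_divide add.commute add_pos_nonneg)
    obtain n where n: "q n \<in> mspace Y" "mdist Y (q n) y < r" using q[of y r] y FY r by blast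
    then have "y \<in> P (n, k)" using y by (simp add: P_def r_def)
    then have I: "(n, k) \<in> I" by (auto simp: I_def)
    let ?p = "p (n, k)"
    have pp: "?p \<in> mspace Y" "mdist Y (q n) ?p < r" using p[OF I] FY by (auto simp: P_def r_def)
    have "mdist Y y ?p \<le> mdist Y y (q n) + mdist Y (q n) ?p" using triangle y FY n pp by blast
    also have "\<dots> < e" using n(2) pp(2) r(2) commute[of y "q n"] by linarith
    finally have "?p \<in> mball y e" using y FY pp by auto
    then have "\<psi> g ?p \<noteq> ?p" using e(2) by blast
    moreover have "\<psi> \<one>\<^bsub>G\<^esub> ?p = ?p"
      using fun_cong[OF group_action.id_eq_one[OF act], of ?p] pp(1) by simp
    then have "?p \<in> orbit G \<psi> ?p"
      using monoid.one_closed[OF group.is_monoid[OF G]] by (force simp: orbit_def)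
    then have "?p \<in> D" using I by (auto simp: D_def)
    ultimately show False using fix_D by blast
  qed
  ultimately show ?thesis by (intro exI[of _ D] conjI ballI impI) simp_all
qed

section \<open>The faithful system\<close>

text \<open>Points of the system: \<open>Fibre c z\<close> in \<open>G/G' \<times> Z\<close>, \<open>Moving y\<close> for \<open>y\<close> in \<open>Y\<close> with more than \<open>N\<close>
  translates, \<open>Listed y\<close> in the countable part of \<open>F\<close>, and \<open>Origin\<close>, both the collapsed \<open>F\<close> and the
  point at infinity of the countable part.\<close>

datatype ('g, 'y) pt = Fibre "'g set" "nat \<Rightarrow> real" | Moving 'y | Listed 'y | Origin

locale small_orbit_construction = group G for G (structure) +
  fixes H :: "'a set" and N d :: nat and Y :: "'y metric" and \<psi> :: "'a \<Rightarrow> 'y \<Rightarrow> 'y"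
    and q :: "nat \<Rightarrow> 'y" and D :: "'y set" and idx :: "'a set \<Rightarrow> nat"
  assumes H: "subgroup H G" and fin_cosets: "finite (rcosets H)" and card_cosets: "card (rcosets H) = N"
    and N: "N \<ge> 1" and d: "d \<ge> 1"
    and faithful: "faithful_tds G Y \<psi>"
    and q: "\<And>y e. y \<in> mspace Y \<Longrightarrow> e > 0 \<Longrightarrow> \<exists>n. q n \<in> mspace Y \<and> mdist Y (q n) y < e"
    and D: "D \<subseteq> small_orbit_points G Y \<psi> N" "countable D" "\<And>g y. g \<in> carrier G \<Longrightarrow> y \<in> D \<Longrightarrow> \<psi> g y \<in> D"
    and detect: "\<And>g y. g \<in> carrier G \<Longrightarrow> (\<forall>y\<in>D. \<psi> g y = y) \<Longrightarrow> y \<in> small_orbit_points G Y \<psi> N \<Longrightarrow> \<psi> g y = y"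
    and idx: "inj_on idx (rcosets H)"
begin

abbreviation F where "F \<equiv> small_orbit_points G Y \<psi> N"
abbreviation W where "W \<equiv> mspace Y - F"

lemma tdsY: "tds G Y \<psi>" using faithful by (simp add: faithful_tds_def)

sublocale Y: group_action G "mspace Y" \<psi> using tdsY by (simp add: tds_def)

sublocale Y: Metric_space "mspace Y" "mdist Y" by simp

lemma mtopY: "mtopology_of Y = Y.mtopology" by (simp add: mtopology_of_def)

lemma FY: "F \<subseteq> mspace Y" by (auto simp: small_orbit_points_def)

lemma W_invariant:
  assumes g: "g \<in> carrier G" and y: "y \<in> W"
  shows "\<psi> g y \<in> W"
proof -
  have "\<psi> g y \<in> mspace Y" using Y.element_image[OF g] y by blast
  moreover have "\<psi> g y \<notin> F"
  proof
    assume "\<psi> g y \<in> F"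
    then have "\<psi> (inv g) (\<psi> g y) \<in> F" by (rule small_orbit_points_invariant[OF tdsY is_group inv_closed[OF g]])
    moreover have "\<psi> (inv g) (\<psi> g y) = y" using Y.orbit_sym_aux g y by blast
    ultimately show False using y by simp
  qed
  ultimately show ?thesis by simp
qed

lemma W_ball:
  assumes "y \<in> W"
  obtains e where "e > 0" "Y.mball y e \<subseteq> W"
proof -
  have "openin Y.mtopology W"
    using closedin_small_orbit_points[OF tdsY, of N] by (simp add: mtopY closedin_def)
  then have "\<forall>x. x \<in> W \<longrightarrow> (\<exists>r>0. Y.mball x r \<subseteq> W)" unfolding Y.openin_mtopology by (rule conjunct2)
  then obtain r where "r > 0" "Y.mball y r \<subseteq> W" using assms by meson
  then show ?thesis by (rule that)
qed

text \<open>Bumps around the \<open>q n\<close> whose support avoids \<open>F\<close>; they separate the points of \<open>Y\<close> with \<open>F\<close>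
  collapsed.\<close>

definition sep :: "nat \<Rightarrow> 'y \<Rightarrow> real" where
  "sep m y = (case prod_decode m of (n, k) \<Rightarrow>
     if q n \<in> mspace Y \<and> (\<forall>p\<in>F. mdist Y (q n) p \<ge> 1 / (real k + 1))
     then max 0 (1 / (real k + 1) - mdist Y (q n) y) else 0)"

lemma sep_F: "y \<in> F \<Longrightarrow> sep m y = 0"
proof -
  obtain n k where nk: "prod_decode m = (n, k)" by fastforce
  assume "y \<in> F"
  then show ?thesis by (simp add: sep_def nk)
qed

text \<open>A ball of radius \<open>r\<close> about \<open>q n\<close> that contains
  \<open>y\<close> stays within \<open>2 * r\<close> of \<open>y\<close>. For small \<open>r\<close>
  it avoids \<open>F\<close> as well as the points at distance at least \<open>e'\<close> from
  \<open>y\<close>.\<close>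

lemma sep_exists:
  assumes y: "y \<in> W" and e': "e' > 0"
  shows "\<exists>m. sep m y > 0 \<and> (\<forall>z\<in>mspace Y. mdist Y y z \<ge> e' \<longrightarrow> sep m z = 0)"
proof -
  obtain e where e: "e > 0" "Y.mball y e \<subseteq> W" using W_ball[OF y] .
  have "min e e' / 2 > 0" using e e' by simp
  then obtain k where k: "inverse (real (Suc k)) < min e e' / 2" using reals_Archimedean by blast
  define r where "r = 1 / (real k + 1)"
  have r: "r > 0" "2 * r < e" "2 * r < e'"
    using k by (auto simp: r_def inverse_eq_divide add.commute add_pos_nonneg)
  obtain n where n: "q n \<in> mspace Y" "mdist Y (q n) y < r" using q[of y r] y r by blast
  have far: "mdist Y (q n) x \<ge> r" if x: "x \<in> mspace Y" "mdist Y y x \<ge> 2 * r" for x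
    using Y.triangle[of y "q n" x] y n x Y.commute[of y "q n"] by auto
  have "mdist Y (q n) p \<ge> r" if p: "p \<in> F" for p
  proof (rule far)
    have "p \<notin> Y.mball y e" using p e by auto
    then show "mdist Y y p \<ge> 2 * r" using p FY y r by (auto simp: Y.in_mball)
  qed (use p FY in auto)
  then have "sep (prod_encode (n, k)) x = max 0 (r - mdist Y (q n) x)" for x
    using n by (simp add: sep_def r_def)
  moreover have "max 0 (r - mdist Y (q n) z) = 0" if "z \<in> mspace Y" "mdist Y y z \<ge> e'" for z
    using far[OF that(1)] that(2) r by simp
  ultimately show ?thesis using n r by (intro exI[of _ "prod_encode (n, k)"]) simp
qed

lemma continuous_sep: "continuous_map (mtopology_of Y) euclideanreal (sep m)"
proof -
  obtain n k where nk: "prod_decode m = (n, k)" by fastforce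
  show ?thesis
  proof (cases "q n \<in> mspace Y \<and> (\<forall>p\<in>F. mdist Y (q n) p \<ge> 1 / (real k + 1))")
    case True
    then have "sep m = (\<lambda>y. max 0 (1 / (real k + 1) - mdist Y (q n) y))" by (auto simp: sep_def nk)
    then show ?thesis
      using True by (simp only:) (intro continuous_intros continuous_map_real_max continuous_map_id[unfolded id_def], auto)
  next
    case False
    then have "sep m = (\<lambda>_. 0)" by (auto simp: sep_def nk fun_eq_iff)
    then show ?thesis by simp
  qed
qed

text \<open>Coordinate 0 is at least 1 on the fibres and 0 elsewhere. Outside the fibres, listed
  points use only coordinate 1 and moving points only the coordinates from 2 on, so that closures of
  these two families share only the image of \<open>Origin\<close>. The values
  \<open>1 / (n + 1)\<close> let the listed points accumulate only there.\<close>

fun emb :: "('a, 'y) pt \<Rightarrow> nat \<Rightarrow> real" where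
  "emb (Fibre c z) = case_nat (real (idx c) + 1) z"
| "emb (Moving y) = (\<lambda>i. if i < 2 then 0 else sep (i - 2) y)"
| "emb (Listed y) = (\<lambda>i. if i = 1 then 1 / (real (to_nat_on D y) + 1) else 0)"
| "emb Origin = (\<lambda>_. 0)"

text \<open>Right cosets carry the left action \<open>H a \<mapsto> H a g\<^sup>-\<^sup>1\<close>.\<close>

fun act :: "'a \<Rightarrow> ('a, 'y) pt \<Rightarrow> ('a, 'y) pt" where
  "act g (Fibre c z) = Fibre (c #> inv g) z"
| "act g (Moving y) = Moving (\<psi> g y)"
| "act g (Listed y) = Listed (\<psi> g y)"
| "act g Origin = Origin"

definition pts :: "('a, 'y) pt set" where
  "pts = (\<lambda>(c, z). Fibre c z) ` ((rcosets H) \<times> skeleton d) \<union> Moving ` W \<union> Listed ` D \<union> {Origin}"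

lemma in_pts_iff [simp]:
  "Fibre c z \<in> pts \<longleftrightarrow> c \<in> rcosets H \<and> z \<in> skeleton d"
  "Moving y \<in> pts \<longleftrightarrow> y \<in> W" "Listed y \<in> pts \<longleftrightarrow> y \<in> D" "Origin \<in> pts"
proof -
  show "Fibre c z \<in> pts \<longleftrightarrow> c \<in> rcosets H \<and> z \<in> skeleton d"
    unfolding pts_def by (simp add: image_iff)
  show "Moving y \<in> pts \<longleftrightarrow> y \<in> W"
    unfolding pts_def by (simp add: image_iff)
  show "Listed y \<in> pts \<longleftrightarrow> y \<in> D" "Origin \<in> pts"
    unfolding pts_def by (simp_all add: image_iff)
qed

lemma coset_sub: "c \<in> rcosets H \<Longrightarrow> c \<subseteq> carrier G"
  by (rule subgroup.rcosets_carrier[OF H is_group])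

lemma coset_act: "c \<in> rcosets H \<Longrightarrow> g \<in> carrier G \<Longrightarrow> c #> g \<in> rcosets H"
proof -
  assume c: "c \<in> rcosets H" and g: "g \<in> carrier G"
  obtain a where "a \<in> carrier G" "c = H #> a" using c by (auto simp: RCOSETS_def)
  then show ?thesis using g subgroup.subset[OF H] by (simp add: coset_mult_assoc rcosetsI)
qed

lemma act_pts:
  assumes g: "g \<in> carrier G" and \<omega>: "\<omega> \<in> pts"
  shows "act g \<omega> \<in> pts"
proof (cases \<omega>)
  case (Fibre c z)
  then show ?thesis using \<omega> coset_act[OF _ inv_closed[OF g], of c] by simp
next
  case (Moving y)
  then show ?thesis using \<omega> W_invariant[OF g, of y] by simp
next
  case (Listed y)
  then show ?thesis using \<omega> D(3)[OF g, of y] by simp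
qed simp

lemma D_mspace: "y \<in> D \<Longrightarrow> y \<in> mspace Y"
  using D(1) FY by blast

lemma act_one: "\<omega> \<in> pts \<Longrightarrow> act \<one> \<omega> = \<omega>"
proof -
  have "\<psi> \<one> y = y" if "y \<in> mspace Y" for y
    using fun_cong[OF Y.id_eq_one, of y] that by simp
  then show "\<omega> \<in> pts \<Longrightarrow> act \<one> \<omega> = \<omega>"
    using coset_sub D_mspace by (cases \<omega>) simp_all
qed

lemma act_mult:
  assumes "g \<in> carrier G" "h \<in> carrier G" "\<omega> \<in> pts"
  shows "act (g \<otimes> h) \<omega> = act g (act h \<omega>)"
proof (cases \<omega>)
  case (Fibre c z)
  then have "c \<subseteq> carrier G" using assms coset_sub by simp
  then show ?thesis using Fibre assms by (simp add: inv_mult_group coset_mult_assoc)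
next
  case (Moving y)
  then show ?thesis using assms Y.composition_rule[of y g h] by simp
next
  case (Listed y)
  then show ?thesis using assms Y.composition_rule[of y g h] D_mspace[of y] by simp
qed simp

lemma inj_emb: "inj_on emb pts"
proof (rule inj_onI)
  fix \<omega> \<omega>' assume \<omega>: "\<omega> \<in> pts" and \<omega>': "\<omega>' \<in> pts" and eq: "emb \<omega> = emb \<omega>'"
  have at: "emb \<omega> i = emb \<omega>' i" for i using eq by simp
  note at0 = at[of 0] and at1 = at[of 1] and atS = at[of "Suc _"] and atSS = at[of "_ + 2"]
  have pos: "\<exists>m. sep m y \<noteq> 0" if yW: "y \<in> W" for y
  proof -
    obtain m where "sep m y > 0" using sep_exists[of y 1] yW by fastforce
    then show ?thesis by (intro exI[of _ m]) simp
  qed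
  have sepD: "y = z" if yz: "y \<in> W" "z \<in> W" and eq: "\<And>m. sep m y = sep m z" for y z
  proof (rule ccontr)
    assume "y \<noteq> z"
    then have "mdist Y y z > 0" using yz by simp
    then obtain m where "sep m y > 0" "sep m z = 0"
      using sep_exists[OF yz(1), of "mdist Y y z"] yz(2) by blast
    then show False using eq[of m] by simp
  qed
  consider (fibre) c z where "\<omega> = Fibre c z" "c \<in> rcosets H" | (moving) y where "\<omega> = Moving y" "y \<in> W"
    | (listed) y where "\<omega> = Listed y" "y \<in> D" | (origin) "\<omega> = Origin"
    using \<omega> by (cases \<omega>) auto
  note cases1 = this
  consider (fibre) c z where "\<omega>' = Fibre c z" "c \<in> rcosets H" | (moving) y where "\<omega>' = Moving y" "y \<in> W"
    | (listed) y where "\<omega>' = Listed y" "y \<in> D" | (origin) "\<omega>' = Origin"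
    using \<omega>' by (cases \<omega>') auto
  note cases2 = this
  show "\<omega> = \<omega>'"
  proof (cases rule: cases1)
    case 1: (fibre c z)
    show ?thesis
    proof (cases rule: cases2)
      case (fibre c' z')
      have "c = c'" using at0 1 fibre idx by (auto dest: inj_onD)
      moreover have "z = z'" using atS 1 fibre by (intro ext) simp
      ultimately show ?thesis using 1 fibre by simp
    qed (use at0 1 in auto)
  next
    case 1: (moving y)
    obtain m where m: "sep m y \<noteq> 0" using pos 1 by blast
    show ?thesis
    proof (cases rule: cases2)
      case (moving y')
      then show ?thesis using atSS 1 sepD[of y y'] by simp
    qed (use at0 at1 atSS[of m] 1 m in auto)
  next
    case 1: (listed y)
    show ?thesis
    proof (cases rule: cases2)
      case (listed y')
      then have "to_nat_on D y = to_nat_on D y'" using at1 1 by simp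
      then show ?thesis using 1 listed inj_on_to_nat_on[OF D(2)] by (auto dest: inj_onD)
    qed (use at0 at1 1 in \<open>auto simp: add_eq_0_iff\<close>)
  next
    case 1: origin
    show ?thesis
    proof (cases rule: cases2)
      case (moving y)
      then obtain m where "sep m y \<noteq> 0" using pos by blast
      then show ?thesis using atSS[of m] 1 moving by simp
    qed (use at0 at1 1 in auto)
  qed
qed

abbreviation points where "points \<equiv> emb ` pts"

definition system :: "'a \<Rightarrow> (nat \<Rightarrow> real) \<Rightarrow> nat \<Rightarrow> real" where
  "system g = (\<lambda>x\<in>points. emb (act g (inv_into pts emb x)))"

lemma system_emb: "\<omega> \<in> pts \<Longrightarrow> system g (emb \<omega>) = emb (act g \<omega>)"
  using inj_emb by (simp add: system_def)

lemma group_action_system: "group_action G points system"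
  unfolding system_def
  by (rule group_action_transport[OF is_group inj_emb act_pts act_one act_mult])

section \<open>Compact pieces of the system and continuity of the action\<close>

definition fibre_part where "fibre_part c = (\<lambda>z. emb (Fibre c z)) ` skeleton d"
definition listed_part where "listed_part = insert (\<lambda>_. 0) ((\<lambda>y. emb (Listed y)) ` D)"
text \<open>The zero sequence is the image of each point of \<open>F\<close>; it is inserted by hand
  because \<open>F\<close> may be empty.\<close>

definition moving_part where "moving_part = insert (\<lambda>_. 0) ((\<lambda>y. emb (Moving y)) ` mspace Y)"

lemma emb_Moving_F: "y \<in> F \<Longrightarrow> emb (Moving y) = (\<lambda>_. 0)"
  by (simp add: fun_eq_iff sep_F)

lemma points_eq: "points = (\<Union>c\<in>rcosets H. fibre_part c) \<union> listed_part \<union> moving_part"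
proof -
  have "(\<lambda>y. emb (Moving y)) ` mspace Y \<subseteq> insert (\<lambda>_. 0) ((\<lambda>y. emb (Moving y)) ` W)"
    using emb_Moving_F by (intro image_subsetI) (metis Diff_iff image_eqI insertCI)
  then have "moving_part = insert (\<lambda>_. 0) ((\<lambda>y. emb (Moving y)) ` W)"
    unfolding moving_part_def by blast
  moreover have "emb ` (\<lambda>(c, z). Fibre c z) ` ((rcosets H) \<times> skeleton d) = (\<Union>c\<in>rcosets H. fibre_part c)"
  proof (intro subset_antisym subsetI)
    fix x assume "x \<in> emb ` (\<lambda>(c, z). Fibre c z) ` ((rcosets H) \<times> skeleton d)"
    then obtain c z where "c \<in> rcosets H" "z \<in> skeleton d" "x = emb (Fibre c z)" by auto
    then show "x \<in> (\<Union>c\<in>rcosets H. fibre_part c)" unfolding fibre_part_def by blast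
  next
    fix x assume "x \<in> (\<Union>c\<in>rcosets H. fibre_part c)"
    then obtain c z where "c \<in> rcosets H" "z \<in> skeleton d" "x = emb (Fibre c z)"
      unfolding fibre_part_def by blast
    then show "x \<in> emb ` (\<lambda>(c, z). Fibre c z) ` ((rcosets H) \<times> skeleton d)"
      by (intro image_eqI[of _ _ "Fibre c z"] image_eqI[of _ _ "(c, z)"]) auto
  qed
  moreover have "emb ` {Origin} = {\<lambda>_. 0}" by simp
  ultimately show ?thesis
    unfolding pts_def image_Un image_image[of emb Moving] image_image[of emb Listed] listed_part_def
    by (simp only:) blast
qed

lemma continuous_on_emb_Fibre: "continuous_on A (\<lambda>z. emb (Fibre c z))"
proof (rule continuous_on_coordinatewise_then_product)
  show "continuous_on A (\<lambda>z. emb (Fibre c z) i)" for i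
    by (cases i) (auto intro: continuous_on_subset[OF continuous_on_product_coordinates])
qed

lemma compact_fibre_part: "compact (fibre_part c)"
  unfolding fibre_part_def
  by (rule compact_continuous_image[OF continuous_on_emb_Fibre compact_skeleton])

lemma continuous_map_emb_Moving: "continuous_map (mtopology_of Y) euclidean (\<lambda>y. emb (Moving y))"
proof -
  have "continuous_map (mtopology_of Y) euclideanreal (\<lambda>y. emb (Moving y) i)" for i
    using continuous_sep[of "i - 2"] by (cases "i < 2") auto
  then have "continuous_map (mtopology_of Y) (product_topology (\<lambda>_. euclideanreal) UNIV) (\<lambda>y. emb (Moving y))"
    by (simp add: continuous_map_componentwise_UNIV del: emb.simps)
  then show ?thesis by (simp add: euclidean_product_topology del: emb.simps)
qed

lemma compact_spaceY: "compact_space (mtopology_of Y)"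
  using tdsY by (simp add: tds_def)

lemma compact_moving_image: "compact ((\<lambda>y. emb (Moving y)) ` mspace Y)"
proof -
  have "compactin euclidean ((\<lambda>y. emb (Moving y)) ` topspace (mtopology_of Y))"
    using compact_spaceY[unfolded compact_space_def] continuous_map_emb_Moving by (rule image_compactin)
  then show ?thesis by (simp del: emb.simps)
qed

lemma compact_moving_part: "compact moving_part"
  unfolding moving_part_def by (rule compact_insert[OF compact_moving_image])

lemma compact_listed_part: "compact listed_part"
proof -
  define f where "f = (\<lambda>n (i :: nat). if i = 1 then 1 / (real n + 1) else 0 :: real)"
  have "(\<lambda>n. dist (f n) (\<lambda>_. 0)) \<longlonglongrightarrow> 0"
  proof (rule tendsto_sandwich[of "\<lambda>_. 0" _ _ "\<lambda>n. 2 * (1 / (real n + 1))"])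
    have "dist (f n) (\<lambda>_. 0) \<le> 2 * (1 / (real n + 1))" for n
      by (rule dist_fun_le_coordinates) (simp add: f_def)
    then show "\<forall>\<^sub>F n in sequentially. dist (f n) (\<lambda>_. 0) \<le> 2 * (1 / (real n + 1))" by simp
    have "(\<lambda>n. 1 / (real n + 1)) \<longlonglongrightarrow> 0"
      using LIMSEQ_inverse_real_of_nat by (simp add: inverse_eq_divide add.commute)
    then show "(\<lambda>n. 2 * (1 / (real n + 1))) \<longlonglongrightarrow> 0" by (rule tendsto_mult_right_zero)
  qed auto
  then have "f \<longlonglongrightarrow> (\<lambda>_. 0)" by (rule tendsto_dist_iff[THEN iffD2])
  then have "limitin euclidean f (\<lambda>_. 0) sequentially" by simp
  moreover have "emb (Listed y) = f (to_nat_on D y)" for y by (simp add: f_def)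
  then have "(\<lambda>y. emb (Listed y)) ` D \<subseteq> range f" by (intro image_subsetI) (simp only: rangeI)
  ultimately have "compactin euclidean (insert (\<lambda>_. 0) ((\<lambda>y. emb (Listed y)) ` D))"
    by (rule compactin_sequence_with_limit) simp
  then show ?thesis by (simp only: listed_part_def compactin_euclidean_iff)
qed

lemma compact_points: "compact points"
  unfolding points_eq
  by (intro compact_Un compact_UN fin_cosets compact_fibre_part compact_listed_part compact_moving_part)

lemma isolated_listed:
  assumes x: "x \<in> listed_part" "x \<noteq> (\<lambda>_. 0)"
  shows "openin (top_of_set listed_part) {x}"
proof -
  obtain y where y: "y \<in> D" "x = emb (Listed y)" using x by (auto simp: listed_part_def simp del: emb.simps)
  define n where "n = to_nat_on D y"
  \<comment> \<open>The strip with \<open>z 1\<close> between \<open>1 / (n + 2)\<close> and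
    \<open>1 / n\<close>, which isolates \<open>1 / (n + 1)\<close>. The upper bound is multiplied
    out so that it also makes sense for \<open>n = 0\<close>.\<close>
  define O' where "O' = {z :: nat \<Rightarrow> real. 1 / (real n + 2) < z 1 \<and> real n * z 1 < 1}"
  have "open O'"
    unfolding O'_def
    by (intro open_Collect_conj open_Collect_less continuous_intros continuous_on_product_coordinates)
  moreover have "listed_part \<inter> O' = {x}"
  proof (intro subset_antisym subsetI)
    fix z assume z: "z \<in> listed_part \<inter> O'"
    then have "z \<noteq> (\<lambda>_. 0)" by (auto simp: O'_def)
    then obtain y' where y': "y' \<in> D" "z = emb (Listed y')" using z by (auto simp: listed_part_def simp del: emb.simps)
    define m where "m = to_nat_on D y'"
    have "1 / (real n + 2) < 1 / (real m + 1)" "real n * (1 / (real m + 1)) < 1"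
      using z y' by (auto simp: O'_def m_def)
    then have "real m + 1 < real n + 2" "real n < real m + 1" by (simp_all add: field_simps)
    then have "m = n" by linarith
    then have "y' = y" using y y' inj_on_to_nat_on[OF D(2)] by (auto simp: m_def n_def dest: inj_onD)
    then show "z \<in> {x}" using y y' by simp
  next
    fix z assume "z \<in> {x}"
    moreover have "1 / (real n + 2) < 1 / (real n + 1)" "real n * (1 / (real n + 1)) < 1"
      by (simp_all add: frac_less2)
    then have "x \<in> O'" using y(2) by (simp add: O'_def n_def)
    ultimately show "z \<in> listed_part \<inter> O'" using x by simp
  qed
  ultimately show ?thesis by (metis openin_open_Int)
qed

lemma system_zero: "system g (\<lambda>_. 0) = (\<lambda>_. 0)"
  using system_emb[of Origin g] by simp

lemma continuous_on_listed:
  assumes g: "g \<in> carrier G"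
  shows "continuous_on listed_part (system g)"
proof (rule continuous_on_one_accumulation_point[OF compact_listed_part isolated_listed])
  have sub: "listed_part \<subseteq> points" unfolding points_eq by blast
  show "inj_on (system g) listed_part"
    using group_action.inj_prop[OF group_action_system g] sub by (rule inj_on_subset)
  show "system g ` listed_part \<subseteq> listed_part"
    using D(3)[OF g] system_zero
    by (auto simp: listed_part_def system_emb simp del: emb.simps)
  show "system g (\<lambda>_. 0) = (\<lambda>_. 0)" by (rule system_zero)
qed

text \<open>On the invariant set \<open>F\<close> both sides are zero. Thus the collapsing map is
  equivariant on all of \<open>Y\<close>, as the quotient argument requires.\<close>

lemma system_Moving:
  assumes g: "g \<in> carrier G" and y: "y \<in> mspace Y"
  shows "system g (emb (Moving y)) = emb (Moving (\<psi> g y))"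
proof (cases "y \<in> F")
  case True
  then have "\<psi> g y \<in> F" using small_orbit_points_invariant[OF tdsY is_group g] by blast
  then show ?thesis using True system_zero by (simp only: emb_Moving_F)
next
  case False
  then show ?thesis using y system_emb[of "Moving y" g] by (simp del: emb.simps)
qed

text \<open>On the collapsed copy of \<open>Y\<close> the action is continuous because the collapsing map is a quotient map.\<close>

lemma continuous_on_moving:
  assumes g: "g \<in> carrier G"
  shows "continuous_on moving_part (system g)"
proof -
  let ?h = "\<lambda>y. emb (Moving y)" and ?M = "(\<lambda>y. emb (Moving y)) ` mspace Y"
  have ch: "continuous_map (mtopology_of Y) (top_of_set ?M) ?h"
    using continuous_map_emb_Moving by (simp add: continuous_map_in_subtopology del: emb.simps)
  have "closed_map (mtopology_of Y) (top_of_set ?M) ?h"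
    by (rule continuous_imp_closed_map[OF ch]) (simp_all add: compact_spaceY Hausdorff_space_subtopology)
  then have q: "quotient_map (mtopology_of Y) (top_of_set ?M) ?h"
    using ch by (intro continuous_closed_imp_quotient_map) simp_all
  have "continuous_map (mtopology_of Y) euclidean (?h \<circ> \<psi> g)"
    using continuous_map_tds[OF tdsY g] continuous_map_emb_Moving by (rule continuous_map_compose)
  then have "continuous_map (mtopology_of Y) euclidean (system g \<circ> ?h)"
    by (rule continuous_map_eq) (simp add: system_Moving[OF g] del: emb.simps)
  then have "continuous_map (top_of_set ?M) euclidean (system g)"
    by (rule continuous_compose_quotient_map[OF q])
  then have "continuous_on ?M (system g)" by simp
  moreover have "continuous_on {\<lambda>_. 0} (system g)" by simp
  ultimately have "continuous_on ({\<lambda>_. 0} \<union> ?M) (system g)"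
    using compact_moving_image by (intro continuous_on_closed_Un) (auto intro: compact_imp_closed)
  then show ?thesis by (simp only: moving_part_def insert_is_Un[symmetric])
qed

lemma continuous_on_fibre:
  assumes g: "g \<in> carrier G" and c: "c \<in> rcosets H"
  shows "continuous_on (fibre_part c) (system g)"
proof -
  let ?f = "\<lambda>x :: nat \<Rightarrow> real. emb (Fibre (c #> inv g) (\<lambda>i. x (Suc i)))"
  have "continuous_on (fibre_part c) (\<lambda>x i. x (Suc i))"
    by (intro continuous_on_coordinatewise_then_product continuous_on_subset[OF continuous_on_product_coordinates]) simp
  then have "continuous_on (fibre_part c) ?f"
    by (rule continuous_on_compose2[OF continuous_on_emb_Fibre[of UNIV]]) simp
  moreover have "?f x = system g x" if x: "x \<in> fibre_part c" for x
  proof -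
    obtain z where z: "z \<in> skeleton d" "x = emb (Fibre c z)"
      using x unfolding fibre_part_def by blast
    then show ?thesis using system_emb[of "Fibre c z" g] c by simp
  qed
  ultimately show ?thesis by (rule continuous_on_eq)
qed

lemma continuous_on_system:
  assumes g: "g \<in> carrier G"
  shows "continuous_on points (system g)"
  unfolding points_eq
proof (intro continuous_on_closed_Un)
  show "continuous_on (\<Union>c\<in>rcosets H. fibre_part c) (system g)"
    by (rule continuous_on_closed_Union[OF fin_cosets])
      (auto intro: continuous_on_fibre[OF g] compact_imp_closed compact_fibre_part)
  show "continuous_on listed_part (system g)" "continuous_on moving_part (system g)"
    by (rule continuous_on_listed[OF g], rule continuous_on_moving[OF g])
  have "closed (\<Union>c\<in>rcosets H. fibre_part c)" "closed listed_part"
    by (intro compact_imp_closed compact_UN fin_cosets compact_fibre_part compact_listed_part)+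
  then show "closed (\<Union>c\<in>rcosets H. fibre_part c)" "closed listed_part"
    "closed ((\<Union>c\<in>rcosets H. fibre_part c) \<union> listed_part)" by (auto intro: closed_Un)
  show "closed moving_part" by (rule compact_imp_closed[OF compact_moving_part])
qed

text \<open>An element acting trivially fixes \<open>W\<close> through the moving points and
  \<open>D\<close> through the listed points, hence also \<open>F\<close> by the choice of
  \<open>D\<close>. Faithfulness of \<open>Y\<close> then applies.\<close>

lemma faithful_system: "faithful_tds G (metric (points, dist)) system"
  unfolding faithful_tds_def metric_dist_subset
proof (intro conjI ballI impI)
  show "tds G (metric (points, dist)) system"
    by (rule tds_metric_dist[OF group_action_system compact_points continuous_on_system])
  fix g assume g: "g \<in> carrier G" and fix': "\<forall>x\<in>points. system g x = x"
  have id: "act g \<omega> = \<omega>" if "\<omega> \<in> pts" for \<omega>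
    using fix' that system_emb[OF that, of g] act_pts[OF g that] inj_emb by (metis imageI inj_onD)
  have W': "\<psi> g y = y" if "y \<in> W" for y using id[of "Moving y"] that by simp
  have "\<psi> g y = y" if "y \<in> F" for y
    by (rule detect[OF g _ that]) (use id[of "Listed _"] in simp)
  then have "\<forall>y\<in>mspace Y. \<psi> g y = y" using W' by blast
  then show "g = \<one>" using faithful g by (simp add: faithful_tds_def)
qed

section \<open>Small orbits of the new system and their dimension\<close>

lemma system_orbit: "\<omega> \<in> pts \<Longrightarrow> orbit G system (emb \<omega>) = (\<lambda>g. emb (act g \<omega>)) ` carrier G"
  by (auto simp: orbit_def system_emb)

abbreviation small_part where "small_part \<equiv> (\<Union>c\<in>rcosets H. fibre_part c) \<union> listed_part"

text \<open>In a fibre only the coset changes, which bounds the orbit by \<open>N\<close>; listed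
  points inherit the bound from \<open>D\<close>. Moving points are embedded injectively, so their
  orbits remain too large.\<close>

lemma small_orbit_points_system:
  "small_orbit_points G (metric (points, dist)) system N = small_part"
proof -
  let ?small = "\<lambda>x. finite (orbit G system x) \<and> card (orbit G system x) \<le> N"
  have sub: "finite B \<and> card B \<le> N" if "B \<subseteq> A" "finite A" "card A \<le> N" for A B :: "(nat \<Rightarrow> real) set"
    using that by (meson card_mono finite_subset order.trans)
  have cosets: "?small (emb (Fibre c z))" if c: "c \<in> rcosets H" and z: "z \<in> skeleton d" for c z
  proof (rule sub[of _ "(\<lambda>c. emb (Fibre c z)) ` (rcosets H)"])
    show "orbit G system (emb (Fibre c z)) \<subseteq> (\<lambda>c. emb (Fibre c z)) ` (rcosets H)"
      using c z by (subst system_orbit) (auto intro: coset_act simp del: emb.simps)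
    show "card ((\<lambda>c. emb (Fibre c z)) ` (rcosets H)) \<le> N"
      using card_image_le[OF fin_cosets] card_cosets by simp
  qed (use fin_cosets in simp)
  have listed: "?small (emb (Listed y))" if y: "y \<in> D" for y
  proof -
    have fin: "finite (orbit G \<psi> y)" "card (orbit G \<psi> y) \<le> N"
      using y D(1) by (auto simp: small_orbit_points_def)
    show ?thesis
    proof (rule sub[of _ "(\<lambda>y. emb (Listed y)) ` orbit G \<psi> y"])
      show "orbit G system (emb (Listed y)) \<subseteq> (\<lambda>y. emb (Listed y)) ` orbit G \<psi> y"
        using y by (subst system_orbit) (auto simp: orbit_def simp del: emb.simps)
      show "card ((\<lambda>y. emb (Listed y)) ` orbit G \<psi> y) \<le> N"
        using card_image_le[OF fin(1)] fin(2) by (rule order.trans)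
    qed (use fin in simp)
  qed
  have origin: "?small (\<lambda>_. 0)"
  proof (rule sub[of _ "{\<lambda>_. 0}"])
    show "orbit G system (\<lambda>_. 0) \<subseteq> {\<lambda>_. 0}"
      using system_zero by (auto simp: orbit_def)
  qed (use N in auto)
  have moving: "\<not> ?small (emb (Moving y))" if y: "y \<in> W" for y
  proof -
    have eq: "orbit G system (emb (Moving y)) = (\<lambda>y. emb (Moving y)) ` orbit G \<psi> y"
      using y by (subst system_orbit) (auto simp: orbit_def simp del: emb.simps)
    have "orbit G \<psi> y \<subseteq> W" using W_invariant y by (auto simp: orbit_def)
    moreover have "inj_on (\<lambda>y. emb (Moving y)) W"
    proof (rule inj_onI)
      fix a b assume "a \<in> W" "b \<in> W" "emb (Moving a) = emb (Moving b)"
      then show "a = b" using inj_onD[OF inj_emb, of "Moving a" "Moving b"] by simp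
    qed
    ultimately have inj: "inj_on (\<lambda>y. emb (Moving y)) (orbit G \<psi> y)" by (rule inj_on_subset[rotated])
    then have "finite (orbit G system (emb (Moving y))) \<longleftrightarrow> finite (orbit G \<psi> y)"
      "card (orbit G system (emb (Moving y))) = card (orbit G \<psi> y)"
      unfolding eq by (simp_all only: finite_image_iff card_image)
    then show ?thesis using y by (auto simp: small_orbit_points_def)
  qed
  show ?thesis
    unfolding small_orbit_points_def metric_dist_subset
  proof (intro subset_antisym subsetI)
    fix x assume "x \<in> {x \<in> points. ?small x}"
    then obtain \<omega> where \<omega>: "\<omega> \<in> pts" "x = emb \<omega>" "?small (emb \<omega>)" by blast
    show "x \<in> small_part"
    proof (cases \<omega>)
      case (Fibre c z)
      then show ?thesis using \<omega> unfolding fibre_part_def by auto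
    next
      case (Moving y)
      then show ?thesis using \<omega> moving[of y] by simp
    next
      case (Listed y)
      then have "y \<in> D" using \<omega>(1) by simp
      then have "emb (Listed y) \<in> listed_part"
        unfolding listed_part_def by (intro insertI2 imageI)
      then show ?thesis unfolding \<omega>(2) Listed by (rule UnI2)
    next
      case Origin
      then show ?thesis using \<omega> by (simp add: listed_part_def)
    qed
  next
    fix x assume x: "x \<in> small_part"
    then have "x \<in> points" unfolding points_eq by blast
    moreover have "?small x"
      using x
    proof
      assume "x \<in> (\<Union>c\<in>rcosets H. fibre_part c)"
      then obtain c z where "c \<in> rcosets H" "z \<in> skeleton d" "x = emb (Fibre c z)"
        unfolding fibre_part_def by blast
      then show ?thesis using cosets by blast
    next
      assume "x \<in> listed_part"
      then consider "x = (\<lambda>_. 0)" | y where "y \<in> D" "x = emb (Listed y)"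
        unfolding listed_part_def by blast
      then show ?thesis using origin listed by cases simp_all
    qed
    ultimately show "x \<in> {x \<in> points. ?small x}" by blast
  qed
qed

lemma compact_fibres: "compact (\<Union>c\<in>rcosets H. fibre_part c)"
  by (intro compact_UN fin_cosets compact_fibre_part)

text \<open>Coordinate 0 is an integer label, so copies of the skeleton have as many noninteger
  coordinates as the skeleton itself.\<close>

lemma fibre_dim: "covering_dim_le (top_of_set (\<Union>c\<in>rcosets H. fibre_part c)) (int d)"
proof (rule covering_dim_le_cubical[OF compact_fibres, of "Suc (3 * (d + 1))"])
  fix x assume "x \<in> (\<Union>c\<in>rcosets H. fibre_part c)"
  then obtain c z where z: "z \<in> skeleton d" and x: "x = emb (Fibre c z)"
    unfolding fibre_part_def by blast
  show "x i = 0" if le: "Suc (3 * (d + 1)) \<le> i" for i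
  proof -
    have "\<forall>j. 0 \<le> z j \<and> z j \<le> (if j < 3 * (d + 1) then 1 else 0)"
      using z unfolding skeleton_def by blast
    then have zj: "0 \<le> z j \<and> z j \<le> (if j < 3 * (d + 1) then 1 else 0)" for j by (rule spec)
    obtain j where j: "i = Suc j" "\<not> j < 3 * (d + 1)" using le by (cases i) auto
    have "z j = 0" using zj[of j] unfolding if_not_P[OF j(2)] by linarith
    then show ?thesis using x j(1) by simp
  qed
  have "{i \<in> {..<Suc (3 * (d + 1))}. x i \<notin> \<int>} \<subseteq> Suc ` {i \<in> {..<3 * (d + 1)}. z i \<notin> \<int>}"
  proof
    fix i assume i: "i \<in> {i \<in> {..<Suc (3 * (d + 1))}. x i \<notin> \<int>}"
    have x0: "x 0 = of_nat (idx c + 1)" using x by simp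
    have "x 0 \<in> \<int>" unfolding x0 by (rule Ints_of_nat)
    then obtain k where "i = Suc k" using i by (cases i) auto
    then show "i \<in> Suc ` {i \<in> {..<3 * (d + 1)}. z i \<notin> \<int>}" using i x by auto
  qed
  then have "card {i \<in> {..<Suc (3 * (d + 1))}. x i \<notin> \<int>} \<le> card {i \<in> {..<3 * (d + 1)}. z i \<notin> \<int>}"
    by (intro surj_card_le) simp_all
  also have "\<dots> \<le> d" by (rule card_nonint_skeleton[OF z])
  finally show "card {i \<in> {..<Suc (3 * (d + 1))}. x i \<notin> \<int>} \<le> d" .
qed

text \<open>Coordinate 0 splits the set into two relatively open parts. The listed part is
  zero-dimensional, and the single fibre over \<open>H\<close> forces the lower bound.\<close>

lemma covering_dim_small_part: "covering_dim (top_of_set small_part) = ereal (real d)"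
proof -
  let ?A = "\<Union>c\<in>rcosets H. fibre_part c"
  have A0: "x 0 \<ge> 1" if "x \<in> ?A" for x using that by (auto simp: fibre_part_def)
  have L0: "x 0 = 0" if "x \<in> listed_part" for x using that by (auto simp: listed_part_def)
  have opA: "openin (top_of_set small_part) ?A"
  proof -
    have "open {x :: nat \<Rightarrow> real. x 0 > 1/2}"
      by (intro open_Collect_less continuous_on_product_coordinates continuous_on_const)
    moreover have "?A = small_part \<inter> {x. x 0 > 1/2}" using A0 L0 by fastforce
    ultimately show ?thesis by (metis openin_open_Int)
  qed
  have opL: "openin (top_of_set small_part) listed_part"
  proof -
    have "open {x :: nat \<Rightarrow> real. x 0 < 1/2}"
      by (intro open_Collect_less continuous_on_product_coordinates continuous_on_const)
    moreover have "listed_part = small_part \<inter> {x. x 0 < 1/2}" using A0 L0 by fastforce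
    ultimately show ?thesis by (metis openin_open_Int)
  qed
  have "covering_dim_le (top_of_set listed_part) 0"
    by (rule covering_dim_le_isolated[of "\<lambda>_. 0", OF _ isolated_listed]) (simp_all add: listed_part_def)
  then have "covering_dim_le (top_of_set listed_part) (int d)" by (rule covering_dim_le_mono) simp
  moreover have "?A \<inter> listed_part = {}" using A0 L0 by force
  ultimately have le: "covering_dim_le (top_of_set small_part) (int d)"
    using fibre_dim opA opL by (intro covering_dim_le_disjoint_Un)
  have Hc: "H \<in> rcosets H" using subgroup.subgroup_in_rcosets[OF H is_group] .
  have "\<not> covering_dim_le (top_of_set small_part) (int d - 1)"
  proof (rule not_covering_dim_le_if_skeleton)
    show "compact small_part" by (intro compact_Un compact_fibres compact_listed_part)
    show "continuous_on (skeleton d) (\<lambda>z. emb (Fibre H z))" by (rule continuous_on_emb_Fibre)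
    show "(\<lambda>z. emb (Fibre H z)) ` skeleton d \<subseteq> small_part"
      using Hc unfolding fibre_part_def by blast
  qed (use d in simp_all)
  then show ?thesis using covering_dim_eqI[OF le] by simp
qed

lemma not_inj_on_orbit_map:
  assumes rN: "r * N \<le> 2 * d"
    and f: "continuous_map (mtopology_of (metric (points, dist))) (unit_cube r) f"
  shows "\<not> inj_on (orbit_map G system f) (mspace (metric (points, dist)))"
proof
  assume inj: "inj_on (orbit_map G system f) (mspace (metric (points, dist)))"
  have "f \<in> points \<rightarrow> topspace (unit_cube r)"
    using f by (simp add: metric_dist_subset continuous_map_def)
  then have fcube: "f x \<in> {..<r} \<rightarrow>\<^sub>E {0..1}" if "x \<in> points" for x
    using that by (auto simp: unit_cube_def)
  have fcont: "continuous_on points (\<lambda>x. f x j)" if "j < r" for j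
  proof -
    have "continuous_map (top_of_set points) (top_of_set {0..1}) (\<lambda>x. f x j)"
      using f that by (auto simp: metric_dist_subset unit_cube_def continuous_map_componentwise)
    then show ?thesis by (simp add: continuous_map_in_subtopology)
  qed
  obtain b where b: "bij_betw b {..<N} (rcosets H)"
    using ex_bij_betw_nat_finite[OF fin_cosets] card_cosets by (auto simp: atLeast0LessThan)
  \<comment> \<open>The index \<open>i * r + j\<close> stands for coordinate \<open>j\<close> of
    \<open>f\<close> on the fibre number \<open>i\<close>. Indices from \<open>r * N\<close> on are
    filled with 0, since Flores' theorem takes \<open>2 * d\<close> functions.\<close>
  define h where "h = (\<lambda>k z. if k < r * N then f (emb (Fibre (b (k div r)) z)) (k mod r) else 0)"
  have bk: "b (k div r) \<in> rcosets H" "k mod r < r" if "k < r * N" for k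
  proof -
    have "r > 0" using that by (cases r) auto
    then show "k mod r < r" by simp
    have "k div r < N" using that by (simp add: less_mult_imp_div_less mult.commute)
    then show "b (k div r) \<in> rcosets H" using b by (auto simp: bij_betw_def)
  qed
  have "continuous_on (skeleton d) (h k)" for k
  proof (cases "k < r * N")
    case True
    have "continuous_on (skeleton d) (\<lambda>z. f (emb (Fibre (b (k div r)) z)) (k mod r))"
      using bk[OF True]
      by (intro continuous_on_compose2[OF fcont continuous_on_emb_Fibre] image_subsetI imageI) simp_all
    then show ?thesis using True by (simp add: h_def)
  next
    case False
    then show ?thesis by (simp add: h_def)
  qed
  then obtain x y where xy: "x \<in> skeleton d" "y \<in> skeleton d" "\<And>i. x i = 0 \<or> y i = 0"
    and eq: "\<And>k. k < 2 * d \<Longrightarrow> h k x = h k y"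
    using Flores[of d h] by blast
  have fib: "f (emb (Fibre c x)) = f (emb (Fibre c y))" if c: "c \<in> rcosets H" for c
  proof -
    have "emb (Fibre c x) \<in> points" "emb (Fibre c y) \<in> points" using c xy by (auto simp del: emb.simps)
    then show ?thesis
    proof (rule PiE_ext[OF fcube fcube])
      fix j assume "j \<in> {..<r}"
      then have j: "j < r" by simp
      obtain i where i: "i < N" "c = b i" using b c by (auto simp: bij_betw_def)
      define k where "k = i * r + j"
      have "k < Suc i * r" using j by (simp add: k_def)
      also have "\<dots> \<le> N * r" using i by (intro mult_le_mono1) simp
      finally have k: "k < r * N" by (simp add: mult.commute)
      have "k div r = i" "k mod r = j" using j by (simp_all add: k_def)
      then show "f (emb (Fibre c x)) j = f (emb (Fibre c y)) j"
        using eq[of k] k rN i by (simp add: h_def)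
    qed
  qed
  have Hc: "H \<in> rcosets H" using subgroup.subgroup_in_rcosets[OF H is_group] .
  have pts: "Fibre H x \<in> pts" "Fibre H y \<in> pts" using Hc xy by simp_all
  \<comment> \<open>The group carries both points through the fibres without changing
    \<open>x\<close> and \<open>y\<close>, and \<open>f\<close> takes equal values at
    \<open>x\<close> and \<open>y\<close> on every fibre.\<close>
  have "orbit_map G system f (emb (Fibre H x)) = orbit_map G system f (emb (Fibre H y))"
  proof (rule ext)
    fix g
    show "orbit_map G system f (emb (Fibre H x)) g = orbit_map G system f (emb (Fibre H y)) g"
    proof (cases "g \<in> carrier G")
      case True
      then show ?thesis
        using fib[OF coset_act[OF Hc inv_closed[OF True]]] pts
        by (simp add: orbit_map_def system_emb del: emb.simps)
    next
      case False
      then show ?thesis by (simp add: orbit_map_def)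
    qed
  qed
  then have "emb (Fibre H x) = emb (Fibre H y)"
    using inj pts by (intro inj_onD[OF inj]) (simp_all add: metric_dist_subset del: emb.simps)
  then have "Fibre H x = Fibre H y" using inj_emb pts by (auto dest: inj_onD simp del: emb.simps)
  then have "x = y" by simp
  moreover obtain i where "x i = 1" using xy(1) by (auto simp: skeleton_def)
  ultimately show False using xy(3)[of i] by simp
qed

end

theorem theorem1p4:
  fixes N r :: nat
    and G :: "('g, 'm) monoid_scheme" and G' :: "'g set"
    and Y :: "'y metric" and \<psi> :: "'g \<Rightarrow> 'y \<Rightarrow> 'y"
  assumes "N \<ge> 1" and "r \<ge> 1"
    and "group G"
    and "subgroup G' G" and "card (rcosets\<^bsub>G\<^esub> G') = N"
    and "faithful_tds G Y \<psi>"
  shows "\<exists>(X :: (nat \<Rightarrow> real) metric) (\<phi> :: 'g \<Rightarrow> (nat \<Rightarrow> real) \<Rightarrow> (nat \<Rightarrow> real)).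
    faithful_tds G X \<phi> \<and>
    covering_dim (subtopology (mtopology_of X) (small_orbit_points G X \<phi> N))
      = ereal (real_of_int \<lceil>real (r * N) / 2\<rceil>) \<and>
    \<not> covering_dim (subtopology (mtopology_of X) (small_orbit_points G X \<phi> N))
      < ereal (real (r * N) / 2) \<and>
    (\<forall>f. continuous_map (mtopology_of X) (unit_cube r) f \<longrightarrow>
       \<not> inj_on (orbit_map G \<phi> f) (mspace X))"
proof -
  define d where "d = nat \<lceil>real (r * N) / 2\<rceil>"
  have "r * N \<ge> 1" using assms(1,2) by (simp add: Suc_leI)
  then have pos: "real (r * N) \<ge> 1" by linarith
  then have dc: "int d = \<lceil>real (r * N) / 2\<rceil>" unfolding d_def by (intro nat_0_le) linarith
  then have d1: "d \<ge> 1" using pos by linarith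
  have dr: "real (r * N) / 2 \<le> real d" using dc by linarith
  then have "real (r * N) \<le> real (2 * d)" by simp
  then have rN: "r * N \<le> 2 * d" by (simp only: of_nat_le_iff)
  have Y: "tds G Y \<psi>" using assms(6) by (simp add: faithful_tds_def)
  then have "compact_space (mtopology_of Y)" by (simp add: tds_def)
  then obtain q :: "nat \<Rightarrow> 'y" where q: "\<And>y e. y \<in> mspace Y \<Longrightarrow> e > 0 \<Longrightarrow> \<exists>n. q n \<in> mspace Y \<and> mdist Y (q n) y < e"
    using compact_metric_dense_sequence[of Y] by blast
  have "\<exists>D \<subseteq> small_orbit_points G Y \<psi> N. countable D \<and> (\<forall>g\<in>carrier G. \<forall>y\<in>D. \<psi> g y \<in> D) \<and>
      (\<forall>g\<in>carrier G. (\<forall>y\<in>D. \<psi> g y = y) \<longrightarrow> (\<forall>y\<in>small_orbit_points G Y \<psi> N. \<psi> g y = y))"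
    by (rule exists_countable_detecting_set[OF Y assms(3)]) (rule q)
  then obtain D where D: "D \<subseteq> small_orbit_points G Y \<psi> N" "countable D"
      "\<forall>g\<in>carrier G. \<forall>y\<in>D. \<psi> g y \<in> D"
      "\<forall>g\<in>carrier G. (\<forall>y\<in>D. \<psi> g y = y) \<longrightarrow> (\<forall>y\<in>small_orbit_points G Y \<psi> N. \<psi> g y = y)"
    by (elim exE conjE) (rule that)
  \<comment> \<open>An infinite set has cardinality 0, so \<open>N \<ge> 1\<close> makes the index
    finite.\<close>
  have fin: "finite (rcosets\<^bsub>G\<^esub> G')" using assms(1,5) by (intro card_ge_0_finite) simp
  obtain idx :: "'g set \<Rightarrow> nat" where idx: "inj_on idx (rcosets\<^bsub>G\<^esub> G')"
    using finite_imp_inj_to_nat_seg[OF fin] by blast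
  interpret small_orbit_construction G G' N d Y \<psi> q D idx
    by (intro small_orbit_construction.intro small_orbit_construction_axioms.intro)
      (use assms fin d1 q D idx in auto)
  let ?X = "metric (points, dist)"
  have "subtopology (mtopology_of ?X) (small_orbit_points G ?X system N) = top_of_set small_part"
  proof -
    have "points \<inter> small_part = small_part" unfolding points_eq by blast
    then show ?thesis
      unfolding small_orbit_points_system metric_dist_subset by (simp only: subtopology_subtopology)
  qed
  then have dim: "covering_dim (subtopology (mtopology_of ?X) (small_orbit_points G ?X system N))
      = ereal (real d)"
    by (simp only: covering_dim_small_part)
  have rd: "real_of_int \<lceil>real (r * N) / 2\<rceil> = real d" using dc by linarith
  show ?thesis
  proof (rule exI[of _ ?X], rule exI[of _ system], intro conjI allI impI)
    show "faithful_tds G ?X system" by (rule faithful_system)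
    show "covering_dim (subtopology (mtopology_of ?X) (small_orbit_points G ?X system N))
        = ereal (real_of_int \<lceil>real (r * N) / 2\<rceil>)"
      unfolding rd by (rule dim)
    show "\<not> covering_dim (subtopology (mtopology_of ?X) (small_orbit_points G ?X system N))
        < ereal (real (r * N) / 2)"
      unfolding dim using dr by simp
  qed (rule not_inj_on_orbit_map[OF rN])
qed

end
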